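(* Let $\mathcal B\subset\mathcal A^{p,q}(x,\alpha)$ be a reference ring with maximal ideal $\mathcal M$, let $\chi\in\Xi\mathcal B$, and let $U_0\subset(\mathbb R^{+*})^p\times\mathbb R^q$ be a subset whose closure contains $0$ and whose germ at $0$ is invariant by $\chi$. Let $\mathcal B_0\subset\mathcal B$ be a subalgebra which is $\chi$-finite on $U_0$ (resp. locally $\chi$-finite on $U_0$) and $\chi$-stable. Let $\mathcal M_0\subset\mathcal M$ be a $\chi$-stable ideal of $\mathcal B$, and let $\mathcal N_{U_0}\subset\mathcal B$ be the ideal of germs vanishing on $(U_0,0)$. Then the class $$\mathcal C_{\mathcal B_0,\mathcal M_0}=\{f\in g+\mathcal M_0 I_{\chi,g}+\mathcal N_{U_0};\ g\in\mathcal B_0\}\subset\mathcal B$$ is $\chi$-finite on $U_0$ (resp. locally $\chi$-finite on $U_0$).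
   Context: $\mathbb R^{+*}=(0,\infty)$; $U\in((\mathbb R^{+*})^p\times\mathbb R^q,0)$ means that $U$ is the intersection of $(\mathbb R^{+*})^p\times\mathbb R^q$ with an open neighbourhood of $0$. $B_p=\{x_1\cdots x_p=0\}$. $\mathcal A^{p,q}(x,\alpha)$ is the algebra of germs at $0$ of real analytic functions on $((\mathbb R^{+*})^p,0)\times(\mathbb R^q,0)$ which extend continuously to the germ at $0$ of $B_p$. A reference ring is a local ring $\mathcal B$ with $\mathbb R\{x,\alpha\}\subset\mathcal B\subset\mathcal A^{p,q}(x,\alpha)$, stable under the derivations $\big(\prod_{j=1}^p x_j\big)\partial/\partial y_i$, where $y=(x,\alpha)$; its maximal ideal consists of germs vanishing at $0$. $\Xi\mathcal B$ is the class of germs at $0$ of vector fields $\chi=\sum_j a_j\,\partial/\partial y_j$ with $a_j\in\mathcal B$, such that $\chi(\mathcal B)\subset\mathcal B$ and such that there is an open set $U\in((\mathbb R^{+*})^p\times\mathbb R^q,0)$ (called admissible) on whose closure $\chi$ extends continuously, with singular set in $\overline U$ contained in $\partial_0U=B_p\cap\overline U$, and $\partial_0 U$ is a union of orbits of $\chi$ in $\overline U$. The germ $(U_0,0)$ is invariant by $\chi$ if there is an admissible $U$ such that $U_0\cap U$ is a union of orbits of $\chi$ in $U$. For $f\in\mathcal B$, $I_{\chi,f}=\langle\chi^nf;\ n\in\mathbb N\rangle\subset\mathcal B$ is the differential ideal. $\mathcal B_{|U_0}$ is the ring of restrictions to the germ $(U_0,0)$ of elements of $\mathcal B$, and $I_{|U_0}$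 is the image of an ideal $I$ in it. For $S$ adherent to $0$ and $U$ admissible, $d^\circ\pi_{\chi,U|S}=\sup_{\gamma}b_0(\gamma\cap S)$, the supremum being over all orbits $\gamma$ of $\chi$ in $U$ and $b_0$ being the number of connected components; $d^\circ\pi_{\chi|(S,0)}=\inf_U d^\circ\pi_{\chi,U|S}$ over admissible $U$. $f$ is $\chi$-regular on $U_0$ if $d^\circ\pi_{\chi|Z(f)\cap(U_0,0)}<\infty$, $Z(f)$ being the germ of the zero set of $f$. In this lemma, noetherianity is understood in the restriction rings: $f$ is $\chi$-finite on $U_0$ if it is $\chi$-regular on $U_0$ and $I_{\chi,f|U_0}$ is a finitely generated ideal of $\mathcal B_{|U_0}$; $f$ is locally $\chi$-finite on $U_0$ if it is $\chi$-regular on $U_0$ and there is a finite subdivision of $U_0$ into subsets $U_{i,0}$ adherent to $0$ and invariant by $\chi$ such that each $I_{\chi,f|U_{i,0}}$ is a finitely generated ideal of $\mathcal B_{|U_{i,0}}$. A class $\mathcal C\subset\mathcal B$ is (locally) $\chi$-finite on $U_0$ if each of its elements is; it is $\chi$-stable if $\chi(\mathcal C)\subset\mathcal C$. *)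

theory Defs
  imports
    "HOL-Analysis.Analysis"
    "HOL-Library.Extended_Nat"
    "HOL-Library.Disjoint_Sets"
    "HOL-Algebra.Ideal_Product"
    "HOL-Algebra.Subrings"
begin

section \<open>Rings of germs along a filter\<close>

text \<open>A germ along \<open>F\<close> is an equivalence class of total functions, two functions being equivalent
  iff they agree eventually along \<open>F\<close>. Along the filter \<^term>\<open>near0 S\<close> below, these are the
  germs at 0 of functions on \<open>S\<close>; the values of a representative off \<open>S\<close> are irrelevant.\<close>

definition germ :: "'a filter \<Rightarrow> ('a \<Rightarrow> real) \<Rightarrow> ('a \<Rightarrow> real) set" where
  "germ F f = {g. eventually (\<lambda>y. g y = f y) F}"

definition germ_ring :: "'a filter \<Rightarrow> ('a \<Rightarrow> real) set ring" where
  "germ_ring F = \<lparr> carrier = range (germ F),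
     mult = (\<lambda>a b. {h. \<exists>f\<in>a. \<exists>g\<in>b. eventually (\<lambda>y. h y = f y * g y) F}),
     one = germ F (\<lambda>_. 1),
     zero = germ F (\<lambda>_. 0),
     add = (\<lambda>a b. {h. \<exists>f\<in>a. \<exists>g\<in>b. eventually (\<lambda>y. h y = f y + g y) F}) \<rparr>"

text \<open>Unlike \<^term>\<open>at 0 within S\<close>, this keeps the point 0 when \<open>0 \<in> S\<close>.\<close>

definition near0 :: "'a::{topological_space, zero} set \<Rightarrow> 'a filter" where
  "near0 S = inf (nhds 0) (principal S)"

definition restr :: "'a::{topological_space, zero} set \<Rightarrow> ('a \<Rightarrow> real) set \<Rightarrow> ('a \<Rightarrow> real) set" where
  "restr S a = {h. \<exists>f\<in>a. eventually (\<lambda>y. h y = f y) (near0 S)}"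

abbreviation sub_ring :: "('a \<Rightarrow> real) set ring \<Rightarrow> ('a \<Rightarrow> real) set set \<Rightarrow> ('a \<Rightarrow> real) set ring" where
  "sub_ring R B \<equiv> R\<lparr>carrier := B\<rparr>"

definition local_ring :: "('a, 'b) ring_scheme \<Rightarrow> bool" where
  "local_ring R \<longleftrightarrow> cring R \<and> (\<exists>!M. maximalideal M R)"

definition fin_gen_ideal :: "('a, 'b) ring_scheme \<Rightarrow> 'a set \<Rightarrow> bool" where
  "fin_gen_ideal R J \<longleftrightarrow> (\<exists>S. finite S \<and> S \<subseteq> carrier R \<and> J = Idl\<^bsub>R\<^esub> S)"

section \<open>The quadrant and the algebra of admissible germs\<close>

text \<open>The coordinates \<open>y = (x, \<alpha>)\<close> are indexed by the finite type \<open>'n\<close>; \<open>P\<close> is the set of indices of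
  the positive coordinates \<open>x\<close>, its complement that of the coordinates \<open>\<alpha>\<close>. So \<open>p = card P\<close> and
  \<open>q = card (- P)\<close>, and either of them may be 0.\<close>

definition quadrant :: "'n set \<Rightarrow> (real^'n) set" where
  "quadrant P = {y. \<forall>i\<in>P. 0 < y $ i}"

definition xprod :: "'n set \<Rightarrow> real^'n \<Rightarrow> real" where
  "xprod P y = (\<Prod>i\<in>P. y $ i)"

definition bdry :: "'n set \<Rightarrow> (real^'n) set" where
  "bdry P = {y. xprod P y = 0}"

abbreviation qgerm :: "'n set \<Rightarrow> (real^'n \<Rightarrow> real) \<Rightarrow> (real^'n \<Rightarrow> real) set" where
  "qgerm P \<equiv> germ (near0 (quadrant P))"

abbreviation qring :: "'n set \<Rightarrow> (real^'n \<Rightarrow> real) set ring" where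
  "qring P \<equiv> germ_ring (near0 (quadrant P))"

text \<open>Real analyticity in several variables; the power series is indexed by multi-indices \<open>k\<close>.\<close>

definition real_analytic_at :: "(real^'n \<Rightarrow> real) \<Rightarrow> real^'n \<Rightarrow> bool" where
  "real_analytic_at f a \<longleftrightarrow> (\<exists>(c :: ('n \<Rightarrow> nat) \<Rightarrow> real) r. r > 0 \<and>
     (\<forall>y\<in>ball a r. ((\<lambda>k. c k * (\<Prod>i\<in>UNIV. (y $ i - a $ i) ^ k i)) has_sum f y) UNIV))"

definition real_analytic_on :: "(real^'n \<Rightarrow> real) \<Rightarrow> (real^'n) set \<Rightarrow> bool" where
  "real_analytic_on f S \<longleftrightarrow> (\<forall>a\<in>S. real_analytic_at f a)"

definition conv_series :: "'n set \<Rightarrow> (real^'n \<Rightarrow> real) set set" where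
  "conv_series P = {qgerm P f | f. real_analytic_at f 0}"

definition cont_ext_germs :: "'n set \<Rightarrow> (real^'n \<Rightarrow> real) set set" where
  "cont_ext_germs P = {qgerm P f | f. \<exists>V. open V \<and> 0 \<in> V \<and> real_analytic_on f (V \<inter> quadrant P) \<and>
     (\<exists>g. continuous_on (V \<inter> closure (quadrant P)) g \<and> (\<forall>y\<in>V \<inter> quadrant P. g y = f y))}"

text \<open>The value at 0 of the continuous extension of the germ is 0.\<close>

definition vanishes_at_0 :: "'n set \<Rightarrow> (real^'n \<Rightarrow> real) set \<Rightarrow> bool" where
  "vanishes_at_0 P a \<longleftrightarrow> (\<exists>f\<in>a. (f \<longlongrightarrow> 0) (near0 (quadrant P)))"

text \<open>Partial derivative of a germ; meaningful for germs of differentiable functions.\<close>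

definition germ_pd :: "'n set \<Rightarrow> 'n \<Rightarrow> (real^'n \<Rightarrow> real) set \<Rightarrow> (real^'n \<Rightarrow> real) set" where
  "germ_pd P i a = {h. \<exists>f\<in>a. eventually
     (\<lambda>y. h y = frechet_derivative f (at y) (axis i 1)) (near0 (quadrant P))}"

definition reference_ring :: "'n::finite set \<Rightarrow> (real^'n \<Rightarrow> real) set set \<Rightarrow> bool" where
  "reference_ring P B \<longleftrightarrow>
     subring B (qring P) \<and> local_ring (sub_ring (qring P) B) \<and>
     maximalideal {a\<in>B. vanishes_at_0 P a} (sub_ring (qring P) B) \<and>
     conv_series P \<subseteq> B \<and> B \<subseteq> cont_ext_germs P \<and>
     (\<forall>i. \<forall>a\<in>B. qgerm P (xprod P) \<otimes>\<^bsub>qring P\<^esub> germ_pd P i a \<in> B)"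

definition subalgebra_of :: "'n set \<Rightarrow> (real^'n \<Rightarrow> real) set set \<Rightarrow> (real^'n \<Rightarrow> real) set set \<Rightarrow> bool" where
  "subalgebra_of P B0 B \<longleftrightarrow> B0 \<subseteq> B \<and> subring B0 (qring P) \<and> (\<forall>c. qgerm P (\<lambda>_. c) \<in> B0)"

section \<open>Orbits\<close>

text \<open>Union of all integral curves of \<open>X\<close> in \<open>S\<close> through \<open>y\<close>. Where \<open>X\<close> is analytic on an open \<open>S\<close> this
  is the image of the maximal solution through \<open>y\<close>. On a closure, where \<open>X\<close> is only continuous,
  solutions need not be unique and the orbit collects all of them. The interval \<open>I\<close> may be
  degenerate, so \<open>y \<in> orbit X S y\<close> for all \<open>y \<in> S\<close>.\<close>

definition orbit :: "(real^'n \<Rightarrow> real^'n) \<Rightarrow> (real^'n) set \<Rightarrow> real^'n \<Rightarrow> (real^'n) set" where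
  "orbit X S y = {c t | c t. \<exists>I. is_interval I \<and> 0 \<in> I \<and> t \<in> I \<and> c 0 = y \<and>
     (\<forall>s\<in>I. c s \<in> S \<and> (c has_vector_derivative X (c s)) (at s within I))}"

definition union_of_orbits :: "(real^'n \<Rightarrow> real^'n) \<Rightarrow> (real^'n) set \<Rightarrow> (real^'n) set \<Rightarrow> bool" where
  "union_of_orbits X S T \<longleftrightarrow> T \<subseteq> S \<and> T = (\<Union>y\<in>T. orbit X S y)"

section \<open>Germs of vector fields\<close>

text \<open>A germ of vector field is the family \<open>\<xi>\<close> of its coefficients; it acts on germs as
  \<open>\<Sum>\<^sub>j \<xi>\<^sub>j \<partial>/\<partial>y\<^sub>j\<close>.\<close>

definition vf_apply :: "'n::finite set \<Rightarrow> ('n \<Rightarrow> (real^'n \<Rightarrow> real) set)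
    \<Rightarrow> (real^'n \<Rightarrow> real) set \<Rightarrow> (real^'n \<Rightarrow> real) set" where
  "vf_apply P \<xi> a = (\<Oplus>\<^bsub>qring P\<^esub> j\<in>UNIV. \<xi> j \<otimes>\<^bsub>qring P\<^esub> germ_pd P j a)"

definition vf_stable :: "'n::finite set \<Rightarrow> ('n \<Rightarrow> (real^'n \<Rightarrow> real) set) \<Rightarrow> (real^'n \<Rightarrow> real) set set \<Rightarrow> bool" where
  "vf_stable P \<xi> C \<longleftrightarrow> vf_apply P \<xi> ` C \<subseteq> C"

text \<open>\<open>U\<close> is admissible for \<open>\<xi>\<close>, where \<open>X\<close> is the representative of \<open>\<xi>\<close> on \<open>U\<close>, continuously extended
  to the closure.\<close>

definition admissible :: "'n set \<Rightarrow> ('n \<Rightarrow> (real^'n \<Rightarrow> real) set) \<Rightarrow> (real^'n) set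
    \<Rightarrow> (real^'n \<Rightarrow> real^'n) \<Rightarrow> bool" where
  "admissible P \<xi> U X \<longleftrightarrow>
     (\<exists>V. open V \<and> 0 \<in> V \<and> U = quadrant P \<inter> V) \<and>
     (\<forall>j. (\<lambda>y. X y $ j) \<in> \<xi> j \<and> real_analytic_on (\<lambda>y. X y $ j) U) \<and>
     continuous_on (closure U) X \<and>
     {y\<in>closure U. X y = 0} \<subseteq> bdry P \<inter> closure U \<and>
     union_of_orbits X (closure U) (bdry P \<inter> closure U)"

definition Xi :: "'n::finite set \<Rightarrow> (real^'n \<Rightarrow> real) set set \<Rightarrow> ('n \<Rightarrow> (real^'n \<Rightarrow> real) set) set" where
  "Xi P B = {\<xi>. (\<forall>j. \<xi> j \<in> B) \<and> vf_apply P \<xi> ` B \<subseteq> B \<and> (\<exists>U X. admissible P \<xi> U X)}"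

definition invariant_germ :: "'n set \<Rightarrow> ('n \<Rightarrow> (real^'n \<Rightarrow> real) set) \<Rightarrow> (real^'n) set \<Rightarrow> bool" where
  "invariant_germ P \<xi> U0 \<longleftrightarrow> (\<exists>U X. admissible P \<xi> U X \<and> union_of_orbits X U (U0 \<inter> U))"

definition diff_ideal :: "'n::finite set \<Rightarrow> (real^'n \<Rightarrow> real) set set \<Rightarrow> ('n \<Rightarrow> (real^'n \<Rightarrow> real) set)
    \<Rightarrow> (real^'n \<Rightarrow> real) set \<Rightarrow> (real^'n \<Rightarrow> real) set set" where
  "diff_ideal P B \<xi> a = Idl\<^bsub>sub_ring (qring P) B\<^esub> (range (\<lambda>n. (vf_apply P \<xi> ^^ n) a))"

definition vanishing_ideal :: "(real^'n \<Rightarrow> real) set set \<Rightarrow> (real^'n) set \<Rightarrow> (real^'n \<Rightarrow> real) set set" where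
  "vanishing_ideal B U0 = {a\<in>B. restr U0 a = \<zero>\<^bsub>germ_ring (near0 U0)\<^esub>}"

section \<open>Regularity and finiteness\<close>

definition b0 :: "'a::topological_space set \<Rightarrow> enat" where
  "b0 S = (if finite (components S) then enat (card (components S)) else \<infinity>)"

definition proj_degree_on :: "(real^'n \<Rightarrow> real^'n) \<Rightarrow> (real^'n) set \<Rightarrow> (real^'n) set \<Rightarrow> enat" where
  "proj_degree_on X U S = (SUP \<gamma>\<in>orbit X U ` U. b0 (\<gamma> \<inter> S))"

text \<open>The degree of the projection along \<open>\<xi>\<close> on the germ at 0 of \<open>Z(a) \<inter> U0\<close>. On an admissible \<open>U\<close> the
  germ \<open>Z(a)\<close> is the zero set of a representative of \<open>a\<close> that is analytic on \<open>U\<close>; an arbitrary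
  representative would have meaningless zeros away from 0.\<close>

definition zero_degree :: "'n set \<Rightarrow> ('n \<Rightarrow> (real^'n \<Rightarrow> real) set) \<Rightarrow> (real^'n) set
    \<Rightarrow> (real^'n \<Rightarrow> real) set \<Rightarrow> enat" where
  "zero_degree P \<xi> U0 a = Inf {proj_degree_on X U ({y\<in>U. f y = 0} \<inter> U0) | X U f.
     admissible P \<xi> U X \<and> f \<in> a \<and> real_analytic_on f U}"

definition chi_regular :: "'n set \<Rightarrow> ('n \<Rightarrow> (real^'n \<Rightarrow> real) set) \<Rightarrow> (real^'n) set
    \<Rightarrow> (real^'n \<Rightarrow> real) set \<Rightarrow> bool" where
  "chi_regular P \<xi> U0 a \<longleftrightarrow> zero_degree P \<xi> U0 a < \<infinity>"

definition restr_fin_gen :: "'n::finite set \<Rightarrow> (real^'n \<Rightarrow> real) set set \<Rightarrow> ('n \<Rightarrow> (real^'n \<Rightarrow> real) set)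
    \<Rightarrow> (real^'n) set \<Rightarrow> (real^'n \<Rightarrow> real) set \<Rightarrow> bool" where
  "restr_fin_gen P B \<xi> U0 a \<longleftrightarrow>
     fin_gen_ideal (sub_ring (germ_ring (near0 U0)) (restr U0 ` B)) (restr U0 ` diff_ideal P B \<xi> a)"

definition chi_finite :: "'n::finite set \<Rightarrow> (real^'n \<Rightarrow> real) set set \<Rightarrow> ('n \<Rightarrow> (real^'n \<Rightarrow> real) set)
    \<Rightarrow> (real^'n) set \<Rightarrow> (real^'n \<Rightarrow> real) set \<Rightarrow> bool" where
  "chi_finite P B \<xi> U0 a \<longleftrightarrow> chi_regular P \<xi> U0 a \<and> restr_fin_gen P B \<xi> U0 a"

definition locally_chi_finite :: "'n::finite set \<Rightarrow> (real^'n \<Rightarrow> real) set set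
    \<Rightarrow> ('n \<Rightarrow> (real^'n \<Rightarrow> real) set) \<Rightarrow> (real^'n) set \<Rightarrow> (real^'n \<Rightarrow> real) set \<Rightarrow> bool" where
  "locally_chi_finite P B \<xi> U0 a \<longleftrightarrow> chi_regular P \<xi> U0 a \<and>
     (\<exists>\<U>. finite \<U> \<and> partition_on U0 \<U> \<and>
       (\<forall>W\<in>\<U>. 0 \<in> closure W \<and> invariant_germ P \<xi> W \<and> restr_fin_gen P B \<xi> W a))"

definition chi_finite_class where
  "chi_finite_class P B \<xi> U0 C \<longleftrightarrow> (\<forall>a\<in>C. chi_finite P B \<xi> U0 a)"

definition locally_chi_finite_class where
  "locally_chi_finite_class P B \<xi> U0 C \<longleftrightarrow> (\<forall>a\<in>C. locally_chi_finite P B \<xi> U0 a)"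

definition perturbation_class :: "'n::finite set \<Rightarrow> (real^'n \<Rightarrow> real) set set
    \<Rightarrow> ('n \<Rightarrow> (real^'n \<Rightarrow> real) set) \<Rightarrow> (real^'n) set
    \<Rightarrow> (real^'n \<Rightarrow> real) set set \<Rightarrow> (real^'n \<Rightarrow> real) set set \<Rightarrow> (real^'n \<Rightarrow> real) set set" where
  "perturbation_class P B \<xi> U0 B0 M0 =
     (let R = sub_ring (qring P) B in
       \<Union>g\<in>B0. g <+\<^bsub>R\<^esub> (ideal_prod R M0 (diff_ideal P B \<xi> g) <+>\<^bsub>R\<^esub> vanishing_ideal B U0))"

end

theory Submission
  imports Defs "HOL-Algebra.Ring_Divisibility"
begin

text \<open>Let \<open>f = g + \<Sum> m\<^sub>i \<chi>\<^sup>i g\<close> on \<open>U\<^sub>0\<close>, with \<open>m\<^sub>i\<close> in the \<open>\<chi>\<close>-stable ideal \<open>M\<^sub>0\<close>, and let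
  \<open>\<chi>\<^sup>i g\<close>, \<open>i < l\<close>, generate the restricted differential ideal of \<open>g\<close>. Then
  \<open>\<chi>\<^sup>k f = \<chi>\<^sup>k g + \<Sum>\<^sub>i\<^sub><\<^sub>l m\<^sub>k\<^sub>i \<chi>\<^sup>i g\<close> with coefficients vanishing at 0, and Nakayama's lemma shows that
  \<open>f\<close> has the same restricted differential ideal.

  Along an orbit in \<open>U\<^sub>0\<close> the functions \<open>\<chi>\<^sup>i g\<close>, \<open>i < l\<close>, solve a linear differential system, so
  they vanish identically, and then so does \<open>f\<close>, or they have no common zero. In the latter case the
  zeros of the functions \<open>(\<chi>\<^sup>i g)\<^sup>2 - (\<chi>\<^sup>j g)\<^sup>2\<close>, which belong to the \<open>\<chi>\<close>-finite algebra \<open>B\<^sub>0\<close> and hence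
  have a bounded number of zeros, cut the orbit into boundedly many arcs. On each arc some \<open>\<chi>\<^sup>k g\<close>
  dominates the others, so \<open>\<chi>\<^sup>k f\<close> has no zero and, by Rolle, \<open>f\<close> has at most \<open>k\<close> zeros.

  Components are counted in the topology of the ambient space, where an orbit may be recurrent. By the
  Cauchy estimates an analytic function is analytic along the orbits, hence its zeros on an orbit are the
  whole orbit or a countable set, whose components are points.\<close>

text \<open>The degree of the projection is an infimum over admissible sets, and each hypothesis of
  regularity brings its own set, field and representative. A smaller corner only shortens orbits,
  but a part of a set with few components may have many components. So regularity has to become a
  bound on the number of points before anything is localized: where an analytic function does not
  vanish on the whole orbit, its zeros are countable, components are points, and a bound on points
  is inherited by every part of the orbit. Times and points are then exchanged along injective
  curves, since a closed orbit may visit a point many times.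

  Dominance is tested with differences of squares because absolute values are not analytic, while
  these differences stay in \<open>B0\<close>, where regularity is known.

  In the local version finite generation holds on the pieces of a subdivision, regularity on all of
  \<open>U0\<close>. The argument works on one invariant piece at a time; a relation valid only
  there can still be differentiated along the field, because the piece contains the integral curves
  through its points.\<close>

section \<open>Differential inequalities, Rolle's theorem and zero counts on intervals\<close>

lemma interval_Icc_subset: "{a..b} \<subseteq> J" if "is_interval J" "a \<in> J" "b \<in> J" for a b :: real
proof
  fix x assume "x \<in> {a..b}"
  then show "x \<in> J" using mem_is_interval_1_I[OF that, of x] by simp
qed

lemma mvt_within:
  fixes f :: "real \<Rightarrow> real"
  assumes "a < b"
    and der: "\<And>x. x \<in> {a..b} \<Longrightarrow> (f has_real_derivative f' x) (at x within {a..b})"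
  shows "\<exists>x\<in>{a<..<b}. f b - f a = f' x * (b - a)"
  by (rule mvt_simple[OF assms(1)]) (use der in \<open>simp add: has_field_derivative_def\<close>)

text \<open>The inequality makes \<open>w t * exp (-K * t)\<close> nonincreasing and
  \<open>w t * exp (K * t)\<close> nondecreasing. Both are 0 at \<open>t0\<close>, so the first is
  at most 0 to the right of \<open>t0\<close> and the second to the left, while \<open>w\<close> is
  nonnegative.\<close>

lemma gronwall_zero:
  fixes w :: "real \<Rightarrow> real"
  assumes J: "is_interval J" and t0: "t0 \<in> J" "w t0 = 0"
    and der: "\<And>t. t \<in> J \<Longrightarrow> (w has_real_derivative w' t) (at t within J)"
    and nonneg: "\<And>t. t \<in> J \<Longrightarrow> 0 \<le> w t"
    and bd: "\<And>t. t \<in> J \<Longrightarrow> \<bar>w' t\<bar> \<le> K * w t"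
    and t: "t \<in> J"
  shows "w t = 0"
proof -
  have sub: "{a..b} \<subseteq> J" if "a \<in> J" "b \<in> J" for a b
    using interval_Icc_subset J that by blast
  have der': "((\<lambda>t. w t * exp (c * t)) has_real_derivative
      w' s * exp (c * s) + w s * (c * exp (c * s))) (at s within {a..b})"
    if "{a..b} \<subseteq> J" "s \<in> {a..b}" for a b c s
  proof -
    have w: "(w has_real_derivative w' s) (at s within {a..b})"
      by (rule DERIV_subset[OF der]) (use that in auto)
    have e: "((\<lambda>t. exp (c * t)) has_real_derivative c * exp (c * s)) (at s within {a..b})"
      by (auto intro!: derivative_eq_intros)
    show ?thesis using DERIV_mult[OF w e] by (simp only: mult.commute add.commute)
  qed
  consider "t = t0" | "t0 < t" | "t < t0" by linarith
  then show ?thesis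
  proof cases
    case 1 then show ?thesis using t0 by simp
  next
    case 2
    have J': "{t0..t} \<subseteq> J" using sub t0 t by blast
    obtain x where x: "x \<in> {t0<..<t}"
      "w t * exp (-K * t) - w t0 * exp (-K * t0)
        = (w' x * exp (-K * x) + w x * (-K * exp (-K * x))) * (t - t0)"
      using mvt_within[OF 2 der'[OF J']] by blast
    have "x \<in> J" using x J' by auto
    then have "w' x - K * w x \<le> 0" using bd[of x] by auto
    then have "(w' x - K * w x) * exp (-K * x) * (t - t0) \<le> 0"
      using 2 by (simp add: mult_nonpos_nonneg)
    then have "w t * exp (-K * t) \<le> 0" using x t0 by (simp add: algebra_simps)
    then show ?thesis using nonneg[OF t] by (simp add: mult_le_0_iff)
  next
    case 3
    have J': "{t..t0} \<subseteq> J" using sub t0 t by blast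
    obtain x where x: "x \<in> {t<..<t0}"
      "w t0 * exp (K * t0) - w t * exp (K * t)
        = (w' x * exp (K * x) + w x * (K * exp (K * x))) * (t0 - t)"
      using mvt_within[OF 3 der'[OF J']] by blast
    have "x \<in> J" using x J' by auto
    then have "w' x + K * w x \<ge> 0" using bd[of x] by auto
    then have "(w' x + K * w x) * exp (K * x) * (t0 - t) \<ge> 0"
      using 3 by simp
    then have "w t * exp (K * t) \<le> 0" using x t0 by (simp add: algebra_simps)
    then show ?thesis using nonneg[OF t] by (simp add: mult_le_0_iff)
  qed
qed

lemma rolle_within:
  fixes f :: "real \<Rightarrow> real"
  assumes "a < b" "f a = f b" "is_interval K" "a \<in> K" "b \<in> K"
    and der: "\<And>t. t \<in> K \<Longrightarrow> (f has_real_derivative f' t) (at t within K)"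
  shows "\<exists>x\<in>{a<..<b}. f' x = 0"
proof -
  have "{a..b} \<subseteq> K" using interval_Icc_subset assms(3-5) by blast
  then have "(f has_real_derivative f' x) (at x within {a..b})" if "x \<in> {a..b}" for x
    using der DERIV_subset that by blast
  then obtain x where "x \<in> {a<..<b}" "f b - f a = f' x * (b - a)"
    using mvt_within[OF assms(1)] by blast
  then show ?thesis using assms(1,2) by auto
qed

text \<open>The clause \<open>t < Max A\<close> lets the induction run: when a larger zero
  \<open>b\<close> is added, Rolle's theorem gives a zero of \<open>f'\<close> between the old
  maximum and \<open>b\<close>, which is therefore new and again below the maximum.\<close>

lemma rolle_finite_zeros:
  fixes f :: "real \<Rightarrow> real"
  assumes K: "is_interval K"
    and der: "\<And>t. t \<in> K \<Longrightarrow> (f has_real_derivative f' t) (at t within K)"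
    and "finite A" "A \<noteq> {}" "A \<subseteq> K" "\<And>t. t \<in> A \<Longrightarrow> f t = 0"
  shows "\<exists>A'. finite A' \<and> A' \<subseteq> K \<and> (\<forall>t\<in>A'. f' t = 0 \<and> t < Max A) \<and> Suc (card A') = card A"
  using assms(3-6)
proof (induction A rule: finite_linorder_max_induct)
  case empty then show ?case by simp
next
  case (insert b A)
  show ?case
  proof (cases "A = {}")
    case True then show ?thesis by (intro exI[of _ "{}"]) auto
  next
    case False
    then obtain A' where A': "finite A'" "A' \<subseteq> K" "\<forall>t\<in>A'. f' t = 0 \<and> t < Max A" "Suc (card A') = card A"
      using insert by auto
    have m: "Max A \<in> A" using False insert by simp
    then obtain x where x: "x \<in> {Max A<..<b}" "f' x = 0"
      using rolle_within[of "Max A" b f K f'] insert K der by (metis insertCI subsetD)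
    have "Max (insert b A) = b" using insert by (intro Max_eqI) (auto intro: less_imp_le)
    moreover have "x \<in> K" using x m insert.prems(2) mem_is_interval_1_I[OF K, of "Max A" b x] by auto
    moreover have "x \<notin> A'" using A'(3) x by auto
    moreover have "b \<notin> A" using insert by auto
    moreover have "\<forall>t\<in>insert x A'. f' t = 0 \<and> t < b" using A'(3) x by force
    ultimately show ?thesis using A' insert
      by (intro exI[of _ "insert x A'"]) simp
  qed
qed

text \<open>Each derivative costs one zero: a finite set of zeros of \<open>u i\<close> has at most
  \<open>k - i\<close> elements, by descent to \<open>u k\<close>, which has none. A bound on all
  finite sets of zeros then yields finiteness.\<close>

lemma rolle_iterated:
  fixes u :: "nat \<Rightarrow> real \<Rightarrow> real"
  assumes K: "is_interval K"
    and der: "\<And>i t. i < k \<Longrightarrow> t \<in> K \<Longrightarrow> (u i has_real_derivative u (Suc i) t) (at t within K)"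
    and nz: "\<And>t. t \<in> K \<Longrightarrow> u k t \<noteq> 0"
  shows "finite {t\<in>K. u 0 t = 0} \<and> card {t\<in>K. u 0 t = 0} \<le> k"
proof -
  have *: "card A \<le> k - i" if "i \<le> k" "finite A" "A \<subseteq> {t\<in>K. u i t = 0}" for A i
    using that
  proof (induction "k - i" arbitrary: i A)
    case 0
    then have "A = {}" using nz by auto
    then show ?case by simp
  next
    case (Suc n)
    then have i: "i < k" by auto
    show ?case
    proof (cases "A = {}")
      case False
      obtain A' where A': "finite A'" "A' \<subseteq> K" "\<forall>t\<in>A'. u (Suc i) t = 0 \<and> t < Max A" "Suc (card A') = card A"
        using rolle_finite_zeros[OF K der[OF i] Suc.prems(2) False] Suc.prems by blast
      have "card A' \<le> k - Suc i"
        using Suc.hyps(1)[of "Suc i" A'] A' i Suc.hyps(2) by fastforce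
      then show ?thesis using A'(4) i by linarith
    qed auto
  qed
  have "finite {t\<in>K. u 0 t = 0}"
  proof (rule ccontr)
    assume "infinite {t\<in>K. u 0 t = 0}"
    then obtain A where "A \<subseteq> {t\<in>K. u 0 t = 0}" "finite A" "card A = Suc k"
      using infinite_arbitrarily_large by blast
    then show False using *[of 0 A] by auto
  qed
  then show ?thesis using *[of 0] by auto
qed

text \<open>A point of \<open>E\<close> in \<open>K\<close> cuts it into two intervals with fewer
  points of \<open>E\<close>. The bound is strict so that it absorbs the cutting point: two halves
  with fewer than \<open>2 ^ n * (l + 1)\<close> points each, together with this point, still have
  fewer than twice that number.\<close>

lemma card_interval_split:
  fixes A E :: "real set"
  assumes base: "\<And>K'. is_interval K' \<Longrightarrow> K' \<subseteq> J \<Longrightarrow> K' \<inter> E = {} \<Longrightarrow> finite (A \<inter> K') \<and> card (A \<inter> K') \<le> l"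
    and K: "is_interval K" "K \<subseteq> J" "finite (E \<inter> K)" "card (E \<inter> K) \<le> n"
  shows "finite (A \<inter> K) \<and> card (A \<inter> K) < 2 ^ n * (l + 1)"
  using K
proof (induction n arbitrary: K)
  case 0
  then have "K \<inter> E = {}" by auto
  then show ?case using base[of K] 0 by simp
next
  case (Suc n)
  have le: "(2::nat) ^ n * (l + 1) \<le> 2 ^ Suc n * (l + 1)" by simp
  show ?case
  proof (cases "E \<inter> K = {}")
    case True
    then show ?thesis using Suc.IH[of K] Suc.prems le by (metis card.empty less_le_trans zero_le)
  next
    case False
    then obtain e where e: "e \<in> E" "e \<in> K" by auto
    have *: "finite (A \<inter> (K \<inter> S)) \<and> card (A \<inter> (K \<inter> S)) < 2 ^ n * (l + 1)"
      if "is_interval S" "e \<notin> S" for S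
    proof (rule Suc.IH)
      show "is_interval (K \<inter> S)" using Suc.prems that by (simp add: is_interval_Int)
      show "K \<inter> S \<subseteq> J" using Suc.prems by auto
      show "finite (E \<inter> (K \<inter> S))" using Suc.prems(3) by (rule rev_finite_subset) auto
      have "card (E \<inter> (K \<inter> S)) < card (E \<inter> K)"
        using Suc.prems(3) e that by (intro psubset_card_mono) auto
      then show "card (E \<inter> (K \<inter> S)) \<le> n" using Suc.prems by linarith
    qed
    have l: "finite (A \<inter> (K \<inter> {..<e})) \<and> card (A \<inter> (K \<inter> {..<e})) < 2 ^ n * (l + 1)"
      by (rule *) (auto simp: is_interval_1)
    have r: "finite (A \<inter> (K \<inter> {e<..})) \<and> card (A \<inter> (K \<inter> {e<..})) < 2 ^ n * (l + 1)"
      by (rule *) (auto simp: is_interval_1)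
    have sub: "A \<inter> K \<subseteq> insert e (A \<inter> (K \<inter> {..<e}) \<union> A \<inter> (K \<inter> {e<..}))" (is "_ \<subseteq> ?S") by auto
    have fin: "finite ?S" using l r by auto
    have "card (A \<inter> K) \<le> card ?S" using sub fin by (rule card_mono[rotated])
    also have "\<dots> \<le> Suc (card (A \<inter> (K \<inter> {..<e}) \<union> A \<inter> (K \<inter> {e<..})))"
      by (rule card_insert_le_m1) auto
    also have "\<dots> \<le> Suc (card (A \<inter> (K \<inter> {..<e})) + card (A \<inter> (K \<inter> {e<..})))"
      using card_Un_le by simp
    also have "\<dots> < 2 ^ Suc n * (l + 1)" using l r by simp
    finally show ?thesis using finite_subset[OF sub fin] by simp
  qed
qed

lemma sign_constant:
  fixes f :: "real \<Rightarrow> real"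
  assumes "is_interval K" "continuous_on K f" "\<And>t. t \<in> K \<Longrightarrow> f t \<noteq> 0" "s \<in> K" "0 \<le> f s" "t \<in> K"
  shows "0 \<le> f t"
proof (rule ccontr)
  assume "\<not> 0 \<le> f t"
  moreover have "connected (f ` K)"
    using assms connected_continuous_image is_interval_connected by blast
  ultimately have "0 \<in> f ` K"
    using assms connected_contains_Icc[of "f ` K" "f t" "f s"] by auto
  then show False using assms by auto
qed

lemma finite_argmax:
  fixes v :: "nat \<Rightarrow> real"
  assumes "0 < l"
  obtains k where "k < l" "\<And>i. i < l \<Longrightarrow> v i \<le> v k"
proof -
  have "Max (v ` {..<l}) \<in> v ` {..<l}" using assms by (intro Max_in) auto
  then obtain k where "k < l" "v k = Max (v ` {..<l})" by auto
  then show thesis using that[of k] by simp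
qed

text \<open>Away from the zeros of the differences \<open>(v i)\<^sup>2 - (v j)\<^sup>2\<close> a single \<open>v k\<close> dominates, so that
  \<open>u k\<close>, which is the \<open>k\<close>-th derivative of \<open>u 0\<close>, has no zero.\<close>

lemma zeros_of_dominated:
  fixes u v :: "nat \<Rightarrow> real \<Rightarrow> real"
  assumes J: "is_interval J"
    and der: "\<And>i t. i < l \<Longrightarrow> t \<in> J \<Longrightarrow> (u i has_real_derivative u (Suc i) t) (at t within J)"
    and cont: "\<And>i. i < l \<Longrightarrow> continuous_on J (v i)"
    and nv: "\<And>t. t \<in> J \<Longrightarrow> \<exists>i<l. v i t \<noteq> 0"
    and dom: "\<And>k t. k < l \<Longrightarrow> t \<in> J \<Longrightarrow> v k t \<noteq> 0 \<Longrightarrow> (\<And>i. i < l \<Longrightarrow> \<bar>v i t\<bar> \<le> \<bar>v k t\<bar>) \<Longrightarrow> u k t \<noteq> 0"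
    and few: "\<And>i j. i < l \<Longrightarrow> j < l \<Longrightarrow>
      (\<forall>t\<in>J. (v i t)\<^sup>2 - (v j t)\<^sup>2 = 0) \<or>
      finite {t\<in>J. (v i t)\<^sup>2 - (v j t)\<^sup>2 = 0} \<and> card {t\<in>J. (v i t)\<^sup>2 - (v j t)\<^sup>2 = 0} \<le> N"
  shows "finite {t\<in>J. u 0 t = 0} \<and> card {t\<in>J. u 0 t = 0} < 2 ^ (l * l * N) * (l + 1)"
proof -
  define d where "d = (\<lambda>(i, j) t. (v i t)\<^sup>2 - (v j t)\<^sup>2)"
  define Z where "Z p = {t\<in>J. d p t = 0}" for p
  \<comment> \<open>Pairs whose difference vanishes on all of J are left out: they would put the
    whole of J into \<open>E\<close>, and they never change sign.\<close>
  define I where "I = {p \<in> {..<l} \<times> {..<l}. \<not> (\<forall>t\<in>J. d p t = 0)}"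
  define E where "E = (\<Union>p\<in>I. Z p)"
  have finI: "finite I" unfolding I_def by (rule finite_subset[of _ "{..<l} \<times> {..<l}"]) auto
  have Zfin: "finite (Z p)" and Zcard: "card (Z p) \<le> N" if "p \<in> I" for p
    using that few[of "fst p" "snd p"] by (auto simp: I_def Z_def d_def case_prod_beta)
  have "card E \<le> (\<Sum>p\<in>I. card (Z p))" unfolding E_def by (rule card_UN_le[OF finI])
  also have "\<dots> \<le> card I * N" using Zcard sum_bounded_above[of I "\<lambda>p. card (Z p)" N] by simp
  also have "\<dots> \<le> card ({..<l} \<times> {..<l}) * N"
    by (intro mult_right_mono card_mono) (auto simp: I_def)
  finally have cE: "card E \<le> l * l * N" by simp
  have finE: "finite E" using finI Zfin by (auto simp: E_def)
  have EJ: "E \<inter> J = E" by (auto simp: E_def Z_def)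
  have "finite ({t\<in>J. u 0 t = 0} \<inter> J) \<and> card ({t\<in>J. u 0 t = 0} \<inter> J) < 2 ^ (l * l * N) * (l + 1)"
  proof (rule card_interval_split[where J = J and E = E])
    fix K assume K: "is_interval K" "K \<subseteq> J" "K \<inter> E = {}"
    have KK: "{t\<in>J. u 0 t = 0} \<inter> K = {t\<in>K. u 0 t = 0}" using K by auto
    show "finite ({t\<in>J. u 0 t = 0} \<inter> K) \<and> card ({t\<in>J. u 0 t = 0} \<inter> K) \<le> l"
    proof (cases "K = {}")
      case False
      then obtain s where s: "s \<in> K" by auto
      \<comment> \<open>The index \<open>i0\<close> shows that l is positive, so a maximum over i <
        l exists. Dominance of \<open>k\<close> is obtained at the single point \<open>s\<close>;
        the next fact carries it over K.\<close>
      then obtain i0 where "i0 < l" using nv K by blast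
      then obtain k where k: "k < l" "\<And>i. i < l \<Longrightarrow> \<bar>v i s\<bar> \<le> \<bar>v k s\<bar>"
        using finite_argmax[of l "\<lambda>i. \<bar>v i s\<bar>"] by auto
      \<comment> \<open>K avoids the zeros of \<open>d (k, i)\<close>, so the sign found at
        \<open>s\<close> persists; for a pair outside \<open>I\<close> the difference is 0
        throughout.\<close>
      have dge: "0 \<le> d (k, i) t" if "i < l" "t \<in> K" for i t
      proof (cases "(k, i) \<in> I")
        case True
        have "continuous_on K (d (k, i))" unfolding d_def
          using cont that k K by (auto intro!: continuous_intros intro: continuous_on_subset)
        moreover have "d (k, i) x \<noteq> 0" if "x \<in> K" for x
          using True that K unfolding E_def Z_def by blast
        moreover have "0 \<le> d (k, i) s"
          using k(2)[OF that(1)] by (simp add: d_def abs_le_square_iff)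
        ultimately show ?thesis using sign_constant[OF K(1)] s that by blast
      next
        case False
        then show ?thesis using that k K unfolding I_def by auto
      qed
      have nz: "u k t \<noteq> 0" if "t \<in> K" for t
      proof (rule dom)
        show *: "\<bar>v i t\<bar> \<le> \<bar>v k t\<bar>" if "i < l" for i
          using dge[OF that \<open>t \<in> K\<close>] by (simp add: d_def abs_le_square_iff)
        obtain i where "i < l" "v i t \<noteq> 0" using nv \<open>t \<in> K\<close> K by blast
        then show "v k t \<noteq> 0" using *[of i] by auto
      qed (use k that K in auto)
      have "finite {t\<in>K. u 0 t = 0} \<and> card {t\<in>K. u 0 t = 0} \<le> k"
        using nz k(1) K by (intro rolle_iterated) (auto intro: DERIV_subset[OF der])
      then show ?thesis using k(1) unfolding KK by auto
    qed auto
  qed (use J finE cE EJ in auto)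
  moreover have "{t\<in>J. u 0 t = 0} \<inter> J = {t\<in>J. u 0 t = 0}" by auto
  ultimately show ?thesis by metis
qed

section \<open>Real analytic functions as majorized power series\<close>

definition mmonom :: "('n \<Rightarrow> nat) \<Rightarrow> real^'n::finite \<Rightarrow> real" where
  "mmonom \<kappa> z = (\<Prod>i\<in>UNIV. z $ i ^ \<kappa> i)"

definition total_degree :: "('n::finite \<Rightarrow> nat) \<Rightarrow> nat" where
  "total_degree \<kappa> = (\<Sum>i\<in>UNIV. \<kappa> i)"

text \<open>A closed ball of the maximum norm. A monomial is bounded there by \<rho> to its total
  degree, with equality at a vertex, so absolute convergence at one vertex controls the series on
  the whole cube.\<close>

definition cube :: "real^'n \<Rightarrow> real \<Rightarrow> (real^'n::finite) set" where
  "cube a \<rho> = {y. \<forall>i. \<bar>y $ i - a $ i\<bar> \<le> \<rho>}"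

text \<open>\<open>f\<close> is on the cube the sum of a power series of norm at most \<open>C\<close>. Exponents may repeat in the
  enumeration \<open>\<kappa>\<close>, so that products and derivatives need no collecting of terms.\<close>

definition power_series_bound :: "real^'n::finite \<Rightarrow> real \<Rightarrow> real \<Rightarrow> (real^'n \<Rightarrow> real) \<Rightarrow> bool" where
  "power_series_bound a \<rho> C f \<longleftrightarrow> 0 < \<rho> \<and> (\<exists>(c :: nat \<Rightarrow> real) \<kappa> S.
     ((\<lambda>s. \<bar>c s\<bar> * \<rho> ^ total_degree (\<kappa> s)) has_sum S) UNIV \<and> S \<le> C \<and>
     (\<forall>y\<in>cube a \<rho>. ((\<lambda>s. c s * mmonom (\<kappa> s) (y - a)) has_sum f y) UNIV))"

lemma cube_mono: "\<rho> \<le> \<rho>' \<Longrightarrow> cube a \<rho> \<subseteq> cube a \<rho>'"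
  unfolding cube_def by (blast intro: order_trans)

lemma abs_mmonom_le:
  assumes "\<And>i. \<bar>z $ i\<bar> \<le> \<rho>"
  shows "\<bar>mmonom \<kappa> z\<bar> \<le> \<rho> ^ total_degree \<kappa>"
proof -
  have "\<bar>mmonom \<kappa> z\<bar> = (\<Prod>i\<in>UNIV. \<bar>z $ i\<bar> ^ \<kappa> i)"
    by (simp add: mmonom_def abs_prod power_abs)
  also have "\<dots> \<le> (\<Prod>i\<in>UNIV. \<rho> ^ \<kappa> i)"
    using assms by (intro prod_mono) (auto intro: power_mono)
  finally show ?thesis by (simp add: power_sum total_degree_def)
qed

lemma power_series_bound_le:
  assumes "power_series_bound a \<rho> C f" "y \<in> cube a \<rho>"
  shows "\<bar>f y\<bar> \<le> C"
proof -
  obtain c \<kappa> S where *: "((\<lambda>s. \<bar>c s\<bar> * \<rho> ^ total_degree (\<kappa> s)) has_sum S) (UNIV :: nat set)" "S \<le> C"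
    "((\<lambda>s. c s * mmonom (\<kappa> s) (y - a)) has_sum f y) UNIV"
    using assms unfolding power_series_bound_def by blast
  have "norm (f y) \<le> S"
    using assms(2)
    by (intro norm_infsum_le[OF *(3,1)]) (auto simp: abs_mult cube_def intro!: mult_left_mono abs_mmonom_le)
  then show ?thesis using *(2) by simp
qed

lemma power_series_bound_mono:
  assumes "power_series_bound a \<rho> C f" "0 < \<rho>'" "\<rho>' \<le> \<rho>" "C \<le> C'"
  shows "power_series_bound a \<rho>' C' f"
proof -
  obtain c \<kappa> S where *: "((\<lambda>s. \<bar>c s\<bar> * \<rho> ^ total_degree (\<kappa> s)) has_sum S) (UNIV :: nat set)" "S \<le> C"
    "\<forall>y\<in>cube a \<rho>. ((\<lambda>s. c s * mmonom (\<kappa> s) (y - a)) has_sum f y) UNIV"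
    using assms unfolding power_series_bound_def by blast
  have le: "\<bar>c s\<bar> * \<rho>' ^ total_degree (\<kappa> s) \<le> \<bar>c s\<bar> * \<rho> ^ total_degree (\<kappa> s)" for s
    using assms(2,3) by (intro mult_left_mono power_mono) auto
  have "(\<lambda>s. \<bar>c s\<bar> * \<rho>' ^ total_degree (\<kappa> s)) summable_on UNIV"
    by (rule summable_on_comparison_test[OF has_sum_imp_summable[OF *(1)]])
      (use le assms(2) in auto)
  then obtain S' where S': "((\<lambda>s. \<bar>c s\<bar> * \<rho>' ^ total_degree (\<kappa> s)) has_sum S') UNIV"
    by (auto simp: summable_on_def)
  have "S' \<le> S" by (rule has_sum_mono[OF S' *(1)]) (use le in auto)
  then show ?thesis
    unfolding power_series_bound_def using assms(2-4) S' * cube_mono[OF assms(3), of a]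
    by (intro conjI exI[of _ c] exI[of _ \<kappa>] exI[of _ S']) auto
qed

lemma power_series_bound_zero: "0 < \<rho> \<Longrightarrow> power_series_bound a \<rho> 0 (\<lambda>y. 0)"
  unfolding power_series_bound_def
  by (intro conjI exI[of _ "\<lambda>_. 0"] exI[of _ "\<lambda>_ _. 0"] exI[of _ 0]) (simp_all add: has_sum_0)

lemma has_sum_nat_encode:
  fixes h :: "'b \<Rightarrow> real"
  assumes "bij e" "(h has_sum S) UNIV"
  shows "((\<lambda>s :: nat. h (e s)) has_sum S) UNIV"
  using has_sum_reindex_bij_betw[of e UNIV UNIV h S] assms by simp

text \<open>Unordered summability of real families is absolute. The products are therefore summable
  over pairs by comparison with the iterated sum of absolute values, and the sum may be evaluated
  row by row.\<close>

lemma has_sum_times: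
  fixes f :: "'a \<Rightarrow> real" and g :: "'b \<Rightarrow> real"
  assumes f: "(f has_sum S) UNIV" and g: "(g has_sum T) UNIV"
  shows "((\<lambda>(s, t). f s * g t) has_sum (S * T)) UNIV"
proof -
  have "(\<lambda>s. \<bar>f s\<bar>) summable_on UNIV" "(\<lambda>t. \<bar>g t\<bar>) summable_on UNIV"
    using has_sum_imp_summable[OF f] has_sum_imp_summable[OF g]
      summable_on_iff_abs_summable_on_real[of f] summable_on_iff_abs_summable_on_real[of g] by simp_all
  then have "(\<lambda>(s, t). \<bar>f s\<bar> * \<bar>g t\<bar>) summable_on UNIV \<times> UNIV"
  proof (intro summable_on_SigmaI[where g = "\<lambda>s. \<bar>f s\<bar> * infsum (\<lambda>t. \<bar>g t\<bar>) UNIV"])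
    fix s assume "(\<lambda>t. \<bar>g t\<bar>) summable_on UNIV"
    then show "((\<lambda>t. case (s, t) of (s, t) \<Rightarrow> \<bar>f s\<bar> * \<bar>g t\<bar>) has_sum \<bar>f s\<bar> * infsum (\<lambda>t. \<bar>g t\<bar>) UNIV) UNIV"
      by (auto intro!: has_sum_cmult_right has_sum_infsum)
  qed (auto intro: summable_on_cmult_left)
  then have "(\<lambda>x. norm (case x of (s, t) \<Rightarrow> f s * g t)) summable_on UNIV \<times> UNIV"
    by (rule summable_on_cong[THEN iffD1, rotated]) (auto simp: abs_mult)
  then have "(\<lambda>(s, t). f s * g t) summable_on (SIGMA s:UNIV. UNIV)"
    by (rule abs_summable_summable)
  then show ?thesis
    using has_sum_SigmaI[where A = UNIV and B = "\<lambda>_. UNIV" and f = "\<lambda>(s, t). f s * g t"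
        and g = "\<lambda>s. f s * T" and S = "S * T"]
      has_sum_cmult_right[OF g] has_sum_cmult_left[OF f] by simp
qed

lemma power_series_bound_mult:
  assumes "power_series_bound a \<rho> C f" "power_series_bound a \<rho> D g"
  shows "power_series_bound a \<rho> (C * D) (\<lambda>y. f y * g y)"
proof -
  have \<rho>: "0 < \<rho>" using assms unfolding power_series_bound_def by simp
  obtain c \<kappa> S where 1: "((\<lambda>s. \<bar>c s\<bar> * \<rho> ^ total_degree (\<kappa> s)) has_sum S) (UNIV :: nat set)" "S \<le> C"
    "\<And>y. y\<in>cube a \<rho> \<Longrightarrow> ((\<lambda>s. c s * mmonom (\<kappa> s) (y - a)) has_sum f y) UNIV"
    using assms unfolding power_series_bound_def by blast
  obtain d l T where 2: "((\<lambda>s. \<bar>d s\<bar> * \<rho> ^ total_degree (l s)) has_sum T) (UNIV :: nat set)" "T \<le> D"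
    "\<And>y. y\<in>cube a \<rho> \<Longrightarrow> ((\<lambda>s. d s * mmonom (l s) (y - a)) has_sum g y) UNIV"
    using assms unfolding power_series_bound_def by blast
  define c' where "c' s = (case prod_decode s of (i, j) \<Rightarrow> c i * d j)" for s
  define k' where "k' s = (case prod_decode s of (i, j) \<Rightarrow> \<lambda>m. \<kappa> i m + l j m)" for s
  have "((\<lambda>s. \<bar>c' s\<bar> * \<rho> ^ total_degree (k' s)) has_sum S * T) UNIV"
    using has_sum_nat_encode[OF bij_prod_decode has_sum_times[OF 1(1) 2(1)]]
    by (simp add: c'_def k'_def case_prod_beta total_degree_def sum.distrib power_add abs_mult mult_ac)
  moreover have "((\<lambda>s. c' s * mmonom (k' s) (y - a)) has_sum f y * g y) UNIV" if "y \<in> cube a \<rho>" for y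
    using has_sum_nat_encode[OF bij_prod_decode has_sum_times[OF 1(3)[OF that] 2(3)[OF that]]]
    by (simp add: c'_def k'_def case_prod_beta mmonom_def prod.distrib power_add mult_ac)
  moreover have "0 \<le> S" "0 \<le> T"
    using \<rho> by (auto intro!: has_sum_nonneg[OF 1(1)] has_sum_nonneg[OF 2(1)])
  then have "S * T \<le> C * D" using 1(2) 2(2) by (intro mult_mono) auto
  ultimately show ?thesis unfolding power_series_bound_def using \<rho> by blast
qed

lemma has_sum_Plus:
  fixes f :: "'a \<Rightarrow> real" and g :: "'b \<Rightarrow> real"
  assumes "(f has_sum S) UNIV" "(g has_sum T) UNIV"
  shows "(case_sum f g has_sum (S + T)) UNIV"
proof -
  have "(case_sum f g has_sum (S + T)) (range Inl \<union> range Inr)"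
    using assms by (intro has_sum_Un_disjoint) (auto simp: has_sum_reindex o_def)
  then show ?thesis by (simp add: UNIV_sum)
qed

lemma power_series_bound_add:
  assumes "power_series_bound a \<rho> C f" "power_series_bound a \<rho> D g"
  shows "power_series_bound a \<rho> (C + D) (\<lambda>y. f y + g y)"
proof -
  have \<rho>: "0 < \<rho>" using assms unfolding power_series_bound_def by simp
  obtain c \<kappa> S where 1: "((\<lambda>s. \<bar>c s\<bar> * \<rho> ^ total_degree (\<kappa> s)) has_sum S) (UNIV :: nat set)" "S \<le> C"
    "\<And>y. y\<in>cube a \<rho> \<Longrightarrow> ((\<lambda>s. c s * mmonom (\<kappa> s) (y - a)) has_sum f y) UNIV"
    using assms unfolding power_series_bound_def by blast
  obtain d l T where 2: "((\<lambda>s. \<bar>d s\<bar> * \<rho> ^ total_degree (l s)) has_sum T) (UNIV :: nat set)" "T \<le> D"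
    "\<And>y. y\<in>cube a \<rho> \<Longrightarrow> ((\<lambda>s. d s * mmonom (l s) (y - a)) has_sum g y) UNIV"
    using assms unfolding power_series_bound_def by blast
  define c' where "c' s = case_sum c d (sum_decode s)" for s
  define k' where "k' s = case_sum \<kappa> l (sum_decode s)" for s
  have "((\<lambda>s. \<bar>c' s\<bar> * \<rho> ^ total_degree (k' s)) has_sum S + T) UNIV"
    using has_sum_nat_encode[OF bij_sum_decode has_sum_Plus[OF 1(1) 2(1)]]
    by (rule has_sum_cong[THEN iffD1, rotated]) (auto simp: c'_def k'_def split: sum.split)
  moreover have "((\<lambda>s. c' s * mmonom (k' s) (y - a)) has_sum f y + g y) UNIV" if "y \<in> cube a \<rho>" for y
    using has_sum_nat_encode[OF bij_sum_decode has_sum_Plus[OF 1(3)[OF that] 2(3)[OF that]]]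
    by (rule has_sum_cong[THEN iffD1, rotated]) (auto simp: c'_def k'_def split: sum.split)
  moreover have "S + T \<le> C + D" using 1(2) 2(2) by simp
  ultimately show ?thesis unfolding power_series_bound_def using \<rho> by blast
qed

lemma power_series_bound_sum:
  fixes C :: real
  assumes "finite I" "0 < \<rho>" "\<And>i. i \<in> I \<Longrightarrow> power_series_bound a \<rho> C (f i)"
  shows "power_series_bound a \<rho> (card I * C) (\<lambda>y. \<Sum>i\<in>I. f i y)"
  using assms(1,3)
proof (induction I)
  case empty then show ?case using power_series_bound_zero[OF assms(2)] by simp
next
  case (insert i I)
  then have "power_series_bound a \<rho> (C + card I * C) (\<lambda>y. f i y + (\<Sum>i\<in>I. f i y))"
    by (intro power_series_bound_add) auto
  then show ?case using insert by (simp add: algebra_simps)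
qed

lemma power_series_bound_of_analytic:
  fixes f :: "real^'n::finite \<Rightarrow> real"
  assumes "real_analytic_at f a"
  obtains \<rho> C where "power_series_bound a \<rho> C f"
proof -
  obtain c :: "('n \<Rightarrow> nat) \<Rightarrow> real" and r where r: "r > 0" and
    f: "\<And>y. y \<in> ball a r \<Longrightarrow> ((\<lambda>k. c k * mmonom k (y - a)) has_sum f y) UNIV"
  proof -
    from assms obtain c :: "('n \<Rightarrow> nat) \<Rightarrow> real" and r where "r > 0"
      "\<forall>y\<in>ball a r. ((\<lambda>k. c k * mmonom k (y - a)) has_sum f y) UNIV"
      unfolding real_analytic_at_def mmonom_def vector_minus_component by blast
    then show thesis using that by blast
  qed
  \<comment> \<open>Dividing by the dimension brings the cube into the ball through the l1 norm; the
    factor 2 makes the distance at most r / 2 and hence less than r.\<close>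
  define \<rho> where "\<rho> = r / (2 * CARD('n))"
  have \<rho>: "0 < \<rho>" using r by (simp add: \<rho>_def)
  have sub: "cube a \<rho> \<subseteq> ball a r"
  proof
    fix y assume "y \<in> cube a \<rho>"
    then have "(\<Sum>i\<in>UNIV. \<bar>(y - a) $ i\<bar>) \<le> of_nat CARD('n) * \<rho>"
      by (intro sum_bounded_above) (auto simp: cube_def)
    then have "norm (y - a) \<le> r / 2"
      using norm_le_l1_cart[of "y - a"] by (simp add: \<rho>_def)
    then show "y \<in> ball a r" using r by (simp add: dist_norm norm_minus_commute)
  qed
  \<comment> \<open>At this vertex of the cube each monomial equals \<rho> to its degree, so
    convergence at a single point yields the majorant series.\<close>
  define y0 where "y0 = a + (\<chi> i. \<rho>)"
  have "y0 \<in> cube a \<rho>" using \<rho> by (simp add: y0_def cube_def)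
  then have "(\<lambda>k. c k * mmonom k (y0 - a)) summable_on UNIV"
    using f sub has_sum_imp_summable by blast
  then have "(\<lambda>k. \<bar>c k * mmonom k (y0 - a)\<bar>) summable_on UNIV"
    using summable_on_iff_abs_summable_on_real[of "\<lambda>k. c k * mmonom k (y0 - a)"] by simp
  then have "(\<lambda>k. \<bar>c k\<bar> * \<rho> ^ total_degree k) summable_on UNIV"
    using \<rho> by (simp add: y0_def mmonom_def total_degree_def abs_mult abs_prod power_sum)
  then obtain C where C: "((\<lambda>k. \<bar>c k\<bar> * \<rho> ^ total_degree k) has_sum C) UNIV"
    by (auto simp: summable_on_def)
  \<comment> \<open>Multi-indices are countable but \<open>to_nat\<close> need not be onto: a number
    that encodes no multi-index gets the coefficient 0, whatever \<open>from_nat\<close> returns for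
    it.\<close>
  define c' where "c' s = (if s \<in> range (to_nat :: ('n \<Rightarrow> nat) \<Rightarrow> nat) then c (from_nat s) else 0)" for s
  have ext: "((\<lambda>s. g (c' s) (from_nat s)) has_sum S) UNIV"
    if g: "((\<lambda>k. g (c k) k) has_sum S) UNIV" "\<And>k. g 0 k = 0"
    for S and g :: "real \<Rightarrow> ('n \<Rightarrow> nat) \<Rightarrow> real"
  proof -
    have "((\<lambda>s. g (c' s) (from_nat s)) has_sum S) (range (to_nat :: ('n \<Rightarrow> nat) \<Rightarrow> nat))"
      using g(1) by (subst has_sum_reindex) (auto simp: o_def c'_def)
    then show ?thesis
      by (rule has_sum_cong_neutral[THEN iffD1, rotated -1]) (auto simp: c'_def g(2))
  qed
  show thesis
  proof (rule that[of \<rho> C])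
    show "power_series_bound a \<rho> C f"
      unfolding power_series_bound_def
      using \<rho> ext[of "\<lambda>x k. \<bar>x\<bar> * \<rho> ^ total_degree k", OF C]
        ext[of "\<lambda>x k. x * mmonom k (y - a)" "f y" for y, OF f] sub
      by (intro conjI exI[of _ c'] exI[of _ from_nat] exI[of _ C]) auto
  qed
qed

subsection \<open>Termwise differentiation\<close>

text \<open>For \<open>\<kappa> j = 0\<close> the truncated subtraction is harmless, since the
  factor in front is 0.\<close>

definition dmonom :: "('n \<Rightarrow> nat) \<Rightarrow> 'n \<Rightarrow> real^'n::finite \<Rightarrow> real" where
  "dmonom \<kappa> j z = \<kappa> j * mmonom (\<kappa>(j := \<kappa> j - 1)) z"

lemma has_derivative_mmonom:
  "((\<lambda>y. mmonom \<kappa> (y - a)) has_derivative (\<lambda>h. \<Sum>j\<in>UNIV. dmonom \<kappa> j (y - a) * h $ j)) (at y)"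
proof -
  have "((\<lambda>y. \<Prod>i\<in>UNIV. (y - a) $ i ^ \<kappa> i) has_derivative
    (\<lambda>h. \<Sum>j\<in>UNIV. (of_nat (\<kappa> j) * h $ j * (y - a) $ j ^ (\<kappa> j - 1)) * (\<Prod>i\<in>UNIV - {j}. (y - a) $ i ^ \<kappa> i))) (at y)"
    by (intro has_derivative_prod has_derivative_power) (auto intro!: derivative_eq_intros bounded_linear_imp_has_derivative bounded_linear_vec_nth)
  moreover have "dmonom \<kappa> j z = of_nat (\<kappa> j) * z $ j ^ (\<kappa> j - 1) * (\<Prod>i\<in>UNIV - {j}. z $ i ^ \<kappa> i)" for j z
    by (simp add: dmonom_def mmonom_def prod.remove[of UNIV j])
  ultimately show ?thesis unfolding mmonom_def by (simp add: mult_ac)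
qed

text \<open>Bernoulli's inequality: the left side is the linear term of the binomial expansion. It
  exchanges the factor m produced by a differentiation for a loss \<delta> of radius and a factor 1
  / \<delta>.\<close>

lemma power_step_bound:
  fixes r \<delta> :: real
  assumes "0 \<le> r" "0 \<le> \<delta>"
  shows "m * r ^ (m - 1) * \<delta> \<le> (r + \<delta>) ^ m"
proof -
  have "r ^ m + m * r ^ (m - 1) * \<delta> \<le> (r + \<delta>) ^ m"
  proof (induction m)
    case (Suc m)
    have "r ^ Suc m + Suc m * r ^ m * \<delta> \<le> (r + \<delta>) * (r ^ m + m * r ^ (m - 1) * \<delta>)"
    proof (cases m)
      case (Suc k)
      then show ?thesis using assms by (simp add: algebra_simps)
    qed (use assms in simp)
    also have "\<dots> \<le> (r + \<delta>) * (r + \<delta>) ^ m"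
      using Suc assms by (intro mult_left_mono) auto
    finally show ?case by simp
  qed simp
  then show ?thesis using assms zero_le_power[of r m] by linarith
qed

lemma abs_dmonom_le:
  assumes "\<And>i. \<bar>z $ i\<bar> \<le> r" "0 \<le> r"
  shows "\<bar>dmonom \<kappa> j z\<bar> \<le> \<kappa> j * r ^ (total_degree \<kappa> - 1)"
proof (cases "\<kappa> j")
  case (Suc m)
  have "total_degree (\<kappa>(j := \<kappa> j - 1)) = total_degree \<kappa> - 1"
    by (simp add: total_degree_def sum.remove[of UNIV j] Suc)
  then show ?thesis
    using abs_mmonom_le[of z r "\<kappa>(j := \<kappa> j - 1)"] assms(1) unfolding dmonom_def
    by (auto simp: abs_mult intro!: mult_left_mono)
qed (simp add: dmonom_def)

text \<open>On the open cube of radius r the derivatives of the terms are dominated by a convergent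
  numerical series, so their sums converge uniformly and the series is differentiated term by term.
  The room between r and \<rho> pays for the exponents brought down.\<close>

lemma has_derivative_power_series:
  fixes f :: "real^'n::finite \<Rightarrow> real" and c :: "nat \<Rightarrow> real"
  assumes sum: "((\<lambda>s. \<bar>c s\<bar> * \<rho> ^ total_degree (\<kappa> s)) has_sum S) UNIV"
    and f: "\<And>y. y \<in> cube a \<rho> \<Longrightarrow> ((\<lambda>s. c s * mmonom (\<kappa> s) (y - a)) has_sum f y) UNIV"
    and r: "0 < r" "r < \<rho>" and y: "\<And>i. \<bar>y $ i - a $ i\<bar> < r"
  shows "(f has_derivative (\<lambda>h. \<Sum>s. c s * (\<Sum>j\<in>UNIV. dmonom (\<kappa> s) j (y - a) * h $ j))) (at y)"
proof -
  define \<delta> where "\<delta> = \<rho> - r"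
  have \<delta>: "0 < \<delta>" "r + \<delta> = \<rho>" using r by (simp_all add: \<delta>_def)
  define B where "B = {y :: real^'n. \<forall>i. \<bar>y $ i - a $ i\<bar> < r}"
  have B_box: "B = box (a - (\<chi> i. r)) (a + (\<chi> i. r))"
    unfolding B_def box_def by (auto simp: Basis_vec_def inner_axis abs_less_iff algebra_simps)
  have "open B" "convex B" by (simp_all add: B_box open_box convex_box)
  have "B \<subseteq> cube a \<rho>"
  proof
    fix x assume "x \<in> B"
    then have "\<bar>x $ i - a $ i\<bar> < r" for i by (simp add: B_def)
    then have "\<bar>x $ i - a $ i\<bar> \<le> \<rho>" for i using r by (meson less_eq_real_def less_trans)
    then show "x \<in> cube a \<rho>" by (simp add: cube_def)
  qed
  define F' where "F' s x h = c s * (\<Sum>j\<in>UNIV. dmonom (\<kappa> s) j (x - a) * h $ j)" for s x and h :: "real^'n"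
  \<comment> \<open>By \<open>power_step_bound\<close> the degree times r to the degree minus 1 is
    at most \<rho> to the degree over \<delta>, so the given majorant, divided by \<delta>,
    dominates the derivatives.\<close>
  define M where "M s = \<bar>c s\<bar> * \<rho> ^ total_degree (\<kappa> s) / \<delta>" for s
  have bd: "\<bar>F' s x h\<bar> \<le> M s * norm h" if "x \<in> B" for s x h
  proof -
    have "\<bar>\<Sum>j\<in>UNIV. dmonom (\<kappa> s) j (x - a) * h $ j\<bar> \<le> (\<Sum>j\<in>UNIV. \<bar>dmonom (\<kappa> s) j (x - a)\<bar> * \<bar>h $ j\<bar>)"
      by (rule sum_abs[THEN order_trans]) (simp add: abs_mult)
    also have "\<dots> \<le> (\<Sum>j\<in>UNIV. \<kappa> s j * r ^ (total_degree (\<kappa> s) - 1) * norm h)"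
      using that r(1)
      by (intro sum_mono mult_mono abs_dmonom_le) (auto simp: B_def component_le_norm_cart less_imp_le)
    also have "\<dots> = total_degree (\<kappa> s) * r ^ (total_degree (\<kappa> s) - 1) * norm h"
      by (simp add: total_degree_def sum_distrib_right)
    also have "\<dots> \<le> \<rho> ^ total_degree (\<kappa> s) / \<delta> * norm h"
    proof (rule mult_right_mono)
      show "total_degree (\<kappa> s) * r ^ (total_degree (\<kappa> s) - 1) \<le> \<rho> ^ total_degree (\<kappa> s) / \<delta>"
        using power_step_bound[of r \<delta> "total_degree (\<kappa> s)"] r \<delta> by (simp add: pos_le_divide_eq)
    qed simp
    finally have "\<bar>c s\<bar> * \<bar>\<Sum>j\<in>UNIV. dmonom (\<kappa> s) j (x - a) * h $ j\<bar> \<le> \<bar>c s\<bar> * (\<rho> ^ total_degree (\<kappa> s) / \<delta> * norm h)"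
      by (rule mult_left_mono) simp
    then show ?thesis by (simp add: F'_def M_def abs_mult mult.assoc)
  qed
  have sM: "summable M"
    unfolding M_def using has_sum_imp_sums[OF sum] by (intro summable_divide) (simp add: sums_iff)
  have sF: "summable (\<lambda>s. F' s x h)" if "x \<in> B" for x h
    using bd[OF that] by (intro summable_comparison_test'[OF summable_mult2[OF sM]]) auto
  have "\<exists>g. \<forall>x\<in>B. (\<lambda>s. c s * mmonom (\<kappa> s) (x - a)) sums g x \<and>
      (g has_derivative (\<lambda>h. \<Sum>s. F' s x h)) (at x within B)"
  proof (rule has_derivative_series[OF \<open>convex B\<close>])
    show "((\<lambda>y. c s * mmonom (\<kappa> s) (y - a)) has_derivative F' s x) (at x within B)" for s x
      unfolding F'_def by (intro has_derivative_mult_right has_derivative_at_withinI[OF has_derivative_mmonom])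
    show "\<forall>\<^sub>F n in sequentially. \<forall>x\<in>B. \<forall>h. norm ((\<Sum>s<n. F' s x h) - (\<Sum>s. F' s x h)) \<le> e * norm h"
      if "0 < e" for e
    proof -
      have "(\<lambda>n. \<Sum>s<n. M s) \<longlonglongrightarrow> suminf M" using summable_LIMSEQ[OF sM] .
      then have "\<forall>\<^sub>F n in sequentially. dist (\<Sum>s<n. M s) (suminf M) < e" using that by (rule tendstoD)
      then show ?thesis
      proof (rule eventually_mono, intro ballI allI)
        fix n x h assume n: "dist (\<Sum>s<n. M s) (suminf M) < e" and x: "x \<in> B"
        have "(\<Sum>s. F' s x h) - (\<Sum>s<n. F' s x h) = (\<Sum>s. F' (s + n) x h)"
          using suminf_minus_initial_segment[OF sF[OF x]] by simp
        moreover have "norm (\<Sum>s. F' (s + n) x h) \<le> (\<Sum>s. M (s + n) * norm h)"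
          using bd[OF x] summable_ignore_initial_segment[OF sM]
          by (intro norm_suminf_le summable_mult2) auto
        moreover have "(\<Sum>s. M (s + n) * norm h) = (suminf M - (\<Sum>s<n. M s)) * norm h"
          using summable_ignore_initial_segment[OF sM] suminf_minus_initial_segment[OF sM]
          by (simp add: suminf_mult2[symmetric])
        moreover have "(suminf M - (\<Sum>s<n. M s)) * norm h \<le> e * norm h"
          using n by (intro mult_right_mono) (auto simp: dist_real_def)
        ultimately show "norm ((\<Sum>s<n. F' s x h) - (\<Sum>s. F' s x h)) \<le> e * norm h"
          by (simp add: norm_minus_commute)
      qed
    qed
    show "a \<in> B" using r by (simp add: B_def)
    then show "(\<lambda>s. c s * mmonom (\<kappa> s) (a - a)) sums f a"
      using f \<open>B \<subseteq> cube a \<rho>\<close> has_sum_imp_sums by blast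
  qed
  then obtain g where g: "\<And>x. x \<in> B \<Longrightarrow> (\<lambda>s. c s * mmonom (\<kappa> s) (x - a)) sums g x"
    "\<And>x. x \<in> B \<Longrightarrow> (g has_derivative (\<lambda>h. \<Sum>s. F' s x h)) (at x within B)" by blast
  have fg: "g x = f x" if "x \<in> B" for x
    using g(1)[OF that] f[of x] that \<open>B \<subseteq> cube a \<rho>\<close> has_sum_imp_sums sums_unique2 by blast
  have "y \<in> B" using y by (simp add: B_def)
  then have "(g has_derivative (\<lambda>h. \<Sum>s. F' s y h)) (at y)"
    using g(2) \<open>open B\<close> by (metis at_within_open)
  then show ?thesis
    unfolding F'_def
    by (rule has_derivative_transform_within_open[OF _ \<open>open B\<close> \<open>y \<in> B\<close>]) (use fg in auto)
qed

lemma power_series_bound_differentiable: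
  assumes "power_series_bound a \<rho> C f" "\<And>i. \<bar>y $ i - a $ i\<bar> < \<rho>"
  shows "f differentiable (at y)"
proof -
  obtain c \<kappa> S where *: "((\<lambda>s. \<bar>c s\<bar> * \<rho> ^ total_degree (\<kappa> s)) has_sum S) (UNIV :: nat set)" "0 < \<rho>"
    "\<And>y. y\<in>cube a \<rho> \<Longrightarrow> ((\<lambda>s. c s * mmonom (\<kappa> s) (y - a)) has_sum f y) UNIV"
    using assms unfolding power_series_bound_def by blast
  \<comment> \<open>Finitely many strict inequalities leave room for a common radius: the largest
    offset is still below \<rho>.\<close>
  define m where "m = Max (range (\<lambda>i. \<bar>y $ i - a $ i\<bar>))"
  have m: "m < \<rho>" "\<And>i. \<bar>y $ i - a $ i\<bar> \<le> m"
    using assms(2) by (auto simp: m_def)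
  obtain r where "max 0 m < r" "r < \<rho>" using dense[of "max 0 m" \<rho>] m *(2) by auto
  moreover have "\<bar>y $ i - a $ i\<bar> < r" for i using m(2)[of i] calculation by simp
  ultimately show ?thesis
    using has_derivative_power_series[OF *(1,3)] unfolding differentiable_def by (meson max_less_iff_conj)
qed

text \<open>Cauchy's estimate, coefficient by coefficient: shrinking the radius by \<delta> costs
  the factor 1 / \<delta>.\<close>

lemma power_series_bound_derivative:
  fixes f :: "real^'n::finite \<Rightarrow> real"
  assumes f: "power_series_bound a \<rho> C f" and \<delta>: "0 < \<delta>" "\<delta> < \<rho>"
  shows "power_series_bound a (\<rho> - \<delta>) (C / \<delta>) (\<lambda>y. frechet_derivative f (at y) (axis j 1))"
proof -
  obtain c \<kappa> S where *: "((\<lambda>s. \<bar>c s\<bar> * \<rho> ^ total_degree (\<kappa> s)) has_sum S) (UNIV :: nat set)" "S \<le> C"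
    "\<And>y. y\<in>cube a \<rho> \<Longrightarrow> ((\<lambda>s. c s * mmonom (\<kappa> s) (y - a)) has_sum f y) UNIV"
    using f unfolding power_series_bound_def by blast
  define r where "r = \<rho> - \<delta>"
  have r: "0 < r" "r + \<delta> = \<rho>" using \<delta> by (simp_all add: r_def)
  define c' where "c' s = c s * \<kappa> s j" for s
  define k' where "k' s = (\<kappa> s)(j := \<kappa> s j - 1)" for s
  have deg: "total_degree (k' s) = total_degree (\<kappa> s) - 1" if "\<kappa> s j \<noteq> 0" for s
    using that by (simp add: total_degree_def sum.remove[of UNIV j] k'_def)
  have le: "\<bar>c' s\<bar> * r ^ total_degree (k' s) \<le> \<bar>c s\<bar> * \<rho> ^ total_degree (\<kappa> s) / \<delta>" for s
  proof (cases "\<kappa> s j = 0")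
    case False
    have "\<kappa> s j \<le> total_degree (\<kappa> s)" by (simp add: total_degree_def member_le_sum)
    then have "\<kappa> s j * r ^ (total_degree (\<kappa> s) - 1) * \<delta> \<le> total_degree (\<kappa> s) * r ^ (total_degree (\<kappa> s) - 1) * \<delta>"
      using r \<delta> by (intro mult_right_mono) auto
    also have "\<dots> \<le> \<rho> ^ total_degree (\<kappa> s)" using power_step_bound[of r \<delta>] r \<delta> by auto
    finally have "\<kappa> s j * r ^ (total_degree (\<kappa> s) - 1) \<le> \<rho> ^ total_degree (\<kappa> s) / \<delta>"
      using \<delta> by (simp add: pos_le_divide_eq)
    from mult_left_mono[OF this, of "\<bar>c s\<bar>"] show ?thesis
      using deg[OF False] by (simp add: c'_def abs_mult mult.assoc)
  qed (use \<delta> in \<open>simp add: c'_def\<close>)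
  have S\<delta>: "((\<lambda>s. \<bar>c s\<bar> * \<rho> ^ total_degree (\<kappa> s) / \<delta>) has_sum S / \<delta>) UNIV"
    using has_sum_cmult_left[OF *(1), of "inverse \<delta>"] by (simp add: field_simps)
  have "(\<lambda>s. \<bar>c' s\<bar> * r ^ total_degree (k' s)) summable_on UNIV"
    by (rule summable_on_comparison_test[OF has_sum_imp_summable[OF S\<delta>]]) (use le r in auto)
  then obtain S' where S': "((\<lambda>s. \<bar>c' s\<bar> * r ^ total_degree (k' s)) has_sum S') UNIV"
    by (auto simp: summable_on_def)
  have "S' \<le> S / \<delta>" by (rule has_sum_mono[OF S' S\<delta>]) (use le in auto)
  also have "\<dots> \<le> C / \<delta>" using *(2) \<delta> by (simp add: divide_right_mono)
  finally have "S' \<le> C / \<delta>" .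
  moreover have "((\<lambda>s. c' s * mmonom (k' s) (y - a)) has_sum frechet_derivative f (at y) (axis j 1)) UNIV"
    if y: "y \<in> cube a r" for y
  proof -
    have "(\<lambda>s. norm (c' s * mmonom (k' s) (y - a))) summable_on UNIV"
      by (rule summable_on_comparison_test[OF has_sum_imp_summable[OF S']])
        (use y in \<open>auto simp: cube_def abs_mult intro!: mult_left_mono abs_mmonom_le\<close>)
    then have hs: "((\<lambda>s. c' s * mmonom (k' s) (y - a)) has_sum infsum (\<lambda>s. c' s * mmonom (k' s) (y - a)) UNIV) UNIV"
      by (rule has_sum_infsum[OF abs_summable_summable])
    have "\<bar>y $ i - a $ i\<bar> < \<rho> - \<delta> / 2" for i
    proof -
      have "\<bar>y $ i - a $ i\<bar> \<le> \<rho> - \<delta>" using y by (simp add: cube_def r_def)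
      then show ?thesis using \<delta> by simp
    qed
    then have fd: "(f has_derivative (\<lambda>h. \<Sum>s. c s * (\<Sum>i\<in>UNIV. dmonom (\<kappa> s) i (y - a) * h $ i))) (at y)"
      using \<delta> by (intro has_derivative_power_series[OF *(1,3), of "\<rho> - \<delta> / 2"]) auto
    have "frechet_derivative f (at y) (axis j 1) =
        (\<Sum>s. c s * (\<Sum>i\<in>UNIV. dmonom (\<kappa> s) i (y - a) * axis j 1 $ i))"
      by (rule fun_cong[OF frechet_derivative_at[OF fd], symmetric])
    also have "\<dots> = (\<Sum>s. c' s * mmonom (k' s) (y - a))"
      by (simp add: axis_def dmonom_def c'_def k'_def if_distrib[of "\<lambda>x. _ * x"] sum.delta mult.assoc cong: if_cong)
    also have "\<dots> = infsum (\<lambda>s. c' s * mmonom (k' s) (y - a)) UNIV"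
      using sums_unique[OF has_sum_imp_sums[OF hs]] by simp
    finally show ?thesis using hs by simp
  qed
  ultimately show ?thesis
    unfolding power_series_bound_def r_def[symmetric] using r S'
    by (intro conjI exI[of _ c'] exI[of _ k'] exI[of _ S']) auto
qed

subsection \<open>Iterated derivatives along an analytic vector field\<close>

definition lie_deriv :: "(real^'n::finite \<Rightarrow> real^'n) \<Rightarrow> (real^'n \<Rightarrow> real) \<Rightarrow> real^'n \<Rightarrow> real" where
  "lie_deriv X \<phi> y = (\<Sum>j\<in>UNIV. X y $ j * frechet_derivative \<phi> (at y) (axis j 1))"

definition analytic_field_on :: "(real^'n::finite \<Rightarrow> real^'n) \<Rightarrow> (real^'n) set \<Rightarrow> bool" where
  "analytic_field_on X S \<longleftrightarrow> (\<forall>j. real_analytic_on (\<lambda>y. X y $ j) S)"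

lemma power_series_bound_lie_deriv:
  fixes f :: "real^'n::finite \<Rightarrow> real" and M :: real
  assumes f: "power_series_bound a \<rho> C f" and X: "\<And>j. power_series_bound a \<rho> M (\<lambda>y. X y $ j)"
    and \<delta>: "0 < \<delta>" "\<delta> < \<rho>"
  shows "power_series_bound a (\<rho> - \<delta>) (C * (CARD('n) * M / \<delta>)) (lie_deriv X f)"
proof -
  have "power_series_bound a (\<rho> - \<delta>) (CARD('n) * (M * (C / \<delta>)))
     (\<lambda>y. \<Sum>j\<in>UNIV. X y $ j * frechet_derivative f (at y) (axis j 1))"
    using \<delta> power_series_bound_mono[OF X, of "\<rho> - \<delta>" M]
    by (intro power_series_bound_sum power_series_bound_mult power_series_bound_derivative[OF f]) auto
  then show ?thesis by (simp add: lie_deriv_def[abs_def] mult_ac)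
qed

lemma power_series_bound_common:
  fixes f :: "real^'n::finite \<Rightarrow> real"
  assumes "real_analytic_at f a" "\<And>j. real_analytic_at (\<lambda>y. X y $ j) a"
  obtains \<rho> C M where "power_series_bound a \<rho> C f" "\<And>j :: 'n. power_series_bound a \<rho> M (\<lambda>y. X y $ j)"
proof -
  obtain \<rho>0 C where f: "power_series_bound a \<rho>0 C f"
    using power_series_bound_of_analytic[OF assms(1)] by blast
  have "\<exists>\<rho> M. power_series_bound a \<rho> M (\<lambda>y. X y $ j)" for j
    using power_series_bound_of_analytic[OF assms(2)] by metis
  then obtain \<rho> M where X: "\<And>j. power_series_bound a (\<rho> j) (M j) (\<lambda>y. X y $ j)" by metis
  define r where "r = Min (insert \<rho>0 (range \<rho>))"
  have "r \<in> insert \<rho>0 (range \<rho>)" unfolding r_def by (intro Min_in) auto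
  then have r: "0 < r" using f X unfolding power_series_bound_def by auto
  have le: "r \<le> \<rho>0" "r \<le> \<rho> j" "M j \<le> Max (range M)" for j
    unfolding r_def by (rule Min_le Max_ge; simp)+
  show thesis
    by (rule that[of r C "Max (range M)"])
      (use power_series_bound_mono[OF f r le(1)] power_series_bound_mono[OF X r le(2,3)] in auto)
qed

text \<open>The quotient of \<open>N ^ N\<close> by \<open>fact N\<close> is a single term of the
  series of \<open>exp N\<close>. This converts the powers of N from N successive shrinkings into a
  factorial.\<close>

lemma power_le_fact_exp: "real N ^ N \<le> exp 1 ^ N * fact N"
proof -
  have "real N ^ N / fact N \<le> (\<Sum>k. real N ^ k /\<^sub>R fact k)"
    using sum_le_suminf[OF summable_exp_generic[of "real N"], of "{N}"] by (simp add: divide_inverse mult.commute)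
  then have "real N ^ N / fact N \<le> exp (real N)" by (simp add: exp_def)
  then show ?thesis by (simp add: field_simps exp_of_nat_mult[symmetric])
qed

text \<open>Cauchy estimates with the radius shrunk by \<open>\<rho> / (2 N)\<close> at each of \<open>N\<close> steps.\<close>

lemma lie_deriv_iterate_bound:
  fixes f :: "real^'n::finite \<Rightarrow> real"
  assumes "real_analytic_at f a" "\<And>j. real_analytic_at (\<lambda>y. X y $ j) a"
  obtains r C K where "0 < r" "0 \<le> C" "0 \<le> K"
    "\<And>N y. y \<in> ball a r \<Longrightarrow> \<bar>(lie_deriv X ^^ N) f y\<bar> \<le> C * K ^ N * fact N"
    "\<And>N y. y \<in> ball a r \<Longrightarrow> (lie_deriv X ^^ N) f differentiable (at y)"
proof -
  obtain \<rho> C M where f: "power_series_bound a \<rho> C f"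
    and X: "\<And>j :: 'n. power_series_bound a \<rho> M (\<lambda>y. X y $ j)"
    using power_series_bound_common[OF assms] by blast
  have \<rho>: "0 < \<rho>" using f by (simp add: power_series_bound_def)
  then have a: "a \<in> cube a \<rho>" by (simp add: cube_def)
  have C: "0 \<le> C" and M: "0 \<le> M"
    using power_series_bound_le[OF f a] power_series_bound_le[OF X a, of undefined] by linarith+
  \<comment> \<open>The factor 2 comes from spending only half of the radius,
    \<open>CARD('n) * M\<close> from the sum over the coordinates of the field, and
    \<open>exp 1\<close> from replacing \<open>N ^ N\<close> by a factorial.\<close>
  define K where "K = 2 * CARD('n) * M / \<rho> * exp 1"
  have K: "0 \<le> K" using M \<rho> by (simp add: K_def)
  have iter: "power_series_bound a (\<rho> / 2) (C * (2 * CARD('n) * M / \<rho> * N) ^ N) ((lie_deriv X ^^ N) f)" for N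
  proof (cases "N = 0")
    case True
    then show ?thesis using power_series_bound_mono[OF f, of "\<rho> / 2" C] \<rho> by simp
  next
    case False
    define \<delta> where "\<delta> = \<rho> / (2 * N)"
    have \<delta>: "0 < \<delta>" "N * \<delta> = \<rho> / 2" using \<rho> False by (simp_all add: \<delta>_def)
    have "power_series_bound a (\<rho> - k * \<delta>) (C * (CARD('n) * M / \<delta>) ^ k) ((lie_deriv X ^^ k) f)" if "k \<le> N" for k
      using that
    proof (induction k)
      case (Suc k)
      \<comment> \<open>The N steps together consume half of the radius, so each of them finds room
        for a further \<delta>.\<close>
      have "Suc k * \<delta> \<le> N * \<delta>" using Suc.prems \<delta>(1) by (intro mult_right_mono) auto
      then have k: "\<delta> < \<rho> - k * \<delta>" using \<delta> \<rho> by (simp add: algebra_simps)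
      have "power_series_bound a (\<rho> - k * \<delta>) M (\<lambda>y. X y $ j)" for j
        using power_series_bound_mono[OF X] k \<delta> by simp
      from power_series_bound_lie_deriv[OF Suc.IH this \<delta>(1) k] Suc.prems
      show ?case by (simp add: algebra_simps)
    qed (use f in simp)
    from this[of N] show ?thesis using \<delta> \<rho> False by (simp add: \<delta>_def field_simps)
  qed
  have sub: "\<bar>y $ i - a $ i\<bar> < \<rho> / 2" if "y \<in> ball a (\<rho> / 2)" for y i
    using that component_le_norm_cart[of "y - a" i] by (simp add: dist_norm norm_minus_commute)
  show thesis
  proof (rule that[OF _ C K, of "\<rho> / 2"])
    fix N y assume y: "y \<in> ball a (\<rho> / 2)"
    then have "y \<in> cube a (\<rho> / 2)" using sub by (simp add: cube_def less_imp_le)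
    then have "\<bar>(lie_deriv X ^^ N) f y\<bar> \<le> C * (2 * CARD('n) * M / \<rho> * N) ^ N"
      by (rule power_series_bound_le[OF iter])
    also have "\<dots> = C * (2 * CARD('n) * M / \<rho>) ^ N * real N ^ N" by (simp only: power_mult_distrib mult.assoc)
    also have "\<dots> \<le> C * (2 * CARD('n) * M / \<rho>) ^ N * (exp 1 ^ N * fact N)"
      using C M \<rho> by (intro mult_left_mono power_le_fact_exp) auto
    also have "\<dots> = C * K ^ N * fact N" by (simp only: K_def power_mult_distrib mult.assoc)
    finally show "\<bar>(lie_deriv X ^^ N) f y\<bar> \<le> C * K ^ N * fact N" .
    show "(lie_deriv X ^^ N) f differentiable (at y)"
      by (rule power_series_bound_differentiable[OF iter sub[OF y]])
  qed (use \<rho> in simp)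
qed

section \<open>Differentiability and Lipschitz bounds of analytic functions\<close>

lemma real_analytic_at_differentiable:
  fixes f :: "real^'n::finite \<Rightarrow> real"
  assumes "real_analytic_at f a"
  shows "f differentiable (at a)"
proof -
  obtain \<rho> C where "power_series_bound a \<rho> C f"
    using power_series_bound_of_analytic[OF assms] by blast
  then show ?thesis
    by (rule power_series_bound_differentiable) (use \<open>power_series_bound a \<rho> C f\<close> in \<open>simp add: power_series_bound_def\<close>)
qed

lemma frechet_derivative_expansion:
  fixes f :: "real^'n::finite \<Rightarrow> real"
  assumes "f differentiable (at y)"
  shows "frechet_derivative f (at y) v = (\<Sum>j\<in>UNIV. v $ j * frechet_derivative f (at y) (axis j 1))"
proof -
  have lin: "linear (frechet_derivative f (at y))" using assms by (rule linear_frechet_derivative)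
  have "frechet_derivative f (at y) v = frechet_derivative f (at y) (\<Sum>j\<in>UNIV. v $ j *\<^sub>R axis j 1)"
    using basis_expansion[of v] by (simp add: scalar_mult_eq_scaleR)
  also have "\<dots> = (\<Sum>j\<in>UNIV. v $ j * frechet_derivative f (at y) (axis j 1))"
    by (simp add: linear_sum[OF lin] linear_cmul[OF lin])
  finally show ?thesis .
qed

text \<open>The estimate holds on a full ball, which may leave S; this suits analyticity at a point,
  which concerns a full neighbourhood.\<close>

definition locally_lipschitz_on :: "(real^'n \<Rightarrow> real^'n) \<Rightarrow> (real^'n::finite) set \<Rightarrow> bool" where
  "locally_lipschitz_on X S \<longleftrightarrow>
     (\<forall>a\<in>S. \<exists>r>0. \<exists>L. \<forall>y\<in>ball a r. \<forall>z\<in>ball a r. norm (X y - X z) \<le> L * norm (y - z))"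

text \<open>The mean value inequality on a ball of half the radius, where Cauchy's estimate bounds
  each partial derivative by \<open>2 * C / \<rho>\<close>.\<close>

lemma power_series_bound_lipschitz:
  fixes f :: "real^'n::finite \<Rightarrow> real"
  assumes f: "power_series_bound a \<rho> C f" and y: "y \<in> ball a (\<rho> / 2)" and z: "z \<in> ball a (\<rho> / 2)"
  shows "\<bar>f y - f z\<bar> \<le> CARD('n) * (2 * C / \<rho>) * norm (y - z)"
proof -
  have \<rho>: "0 < \<rho>" using f by (simp add: power_series_bound_def)
  have ball: "\<bar>w $ i - a $ i\<bar> \<le> \<rho> / 2" if "w \<in> ball a (\<rho> / 2)" for w i
    using that component_le_norm_cart[of "w - a" i] by (simp add: dist_norm norm_minus_commute)
  have der: "power_series_bound a (\<rho> / 2) (2 * C / \<rho>) (\<lambda>y. frechet_derivative f (at y) (axis j 1))" for j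
    using power_series_bound_derivative[OF f, of "\<rho> / 2" j] \<rho> by (simp add: mult.commute)
  have "norm (f y - f z) \<le> CARD('n) * (2 * C / \<rho>) * norm (y - z)"
  proof (rule differentiable_bound[OF convex_ball _ _ y z])
    fix w assume w: "w \<in> ball a (\<rho> / 2)"
    have "\<bar>w $ i - a $ i\<bar> < \<rho>" for i using ball[OF w, of i] \<rho> by simp
    then have d: "f differentiable (at w)" by (rule power_series_bound_differentiable[OF f])
    then show "(f has_derivative frechet_derivative f (at w)) (at w within ball a (\<rho> / 2))"
      using frechet_derivative_works has_derivative_at_withinI by blast
    have w': "w \<in> cube a (\<rho> / 2)" using ball[OF w] by (simp add: cube_def)
    have "norm (frechet_derivative f (at w) h) \<le> CARD('n) * (2 * C / \<rho>) * norm h" for h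
    proof -
      have "norm (frechet_derivative f (at w) h) \<le> (\<Sum>j\<in>UNIV. \<bar>h $ j * frechet_derivative f (at w) (axis j 1)\<bar>)"
        by (simp add: frechet_derivative_expansion[OF d, of h])
      also have "\<dots> \<le> of_nat CARD('n) * (norm h * (2 * C / \<rho>))"
      proof (rule sum_bounded_above)
        show "\<bar>h $ j * frechet_derivative f (at w) (axis j 1)\<bar> \<le> norm h * (2 * C / \<rho>)" for j
          unfolding abs_mult
          by (intro mult_mono component_le_norm_cart power_series_bound_le[OF der w']) auto
      qed
      finally show ?thesis by (simp add: mult_ac)
    qed
    then show "onorm (frechet_derivative f (at w)) \<le> CARD('n) * (2 * C / \<rho>)"
      by (rule onorm_le)
  qed
  then show ?thesis by simp
qed

lemma analytic_field_locally_lipschitz: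
  fixes X :: "real^'n::finite \<Rightarrow> real^'n"
  assumes "analytic_field_on X S"
  shows "locally_lipschitz_on X S"
  unfolding locally_lipschitz_on_def
proof
  fix a :: "real^'n" assume "a \<in> S"
  then have "real_analytic_at (\<lambda>y. X y $ j) a" for j
    using assms by (simp add: analytic_field_on_def real_analytic_on_def)
  \<comment> \<open>Any coordinate may take the place of the function there; the aim is a common
    radius and bound for the coordinates of the field.\<close>
  from power_series_bound_common[OF this[of undefined] this]
  obtain \<rho> M where X: "\<And>j :: 'n. power_series_bound a \<rho> M (\<lambda>y. X y $ j)" by blast
  have "norm (X y - X z) \<le> of_nat CARD('n) * (CARD('n) * (2 * M / \<rho>)) * norm (y - z)"
    if "y \<in> ball a (\<rho> / 2)" "z \<in> ball a (\<rho> / 2)" for y z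
  proof -
    have "norm (X y - X z) \<le> (\<Sum>j\<in>UNIV. \<bar>(X y - X z) $ j\<bar>)" by (rule norm_le_l1_cart)
    also have "\<dots> \<le> of_nat CARD('n) * (CARD('n) * (2 * M / \<rho>) * norm (y - z))"
      using power_series_bound_lipschitz[OF X that] by (intro sum_bounded_above) auto
    finally show ?thesis by (simp add: mult_ac)
  qed
  moreover have "0 < \<rho> / 2" using X[of undefined] by (simp add: power_series_bound_def)
  ultimately show "\<exists>r>0. \<exists>L. \<forall>y\<in>ball a r. \<forall>z\<in>ball a r. norm (X y - X z) \<le> L * norm (y - z)" by blast
qed

subsection \<open>Integral curves\<close>

text \<open>The condition on curves inside \<open>orbit\<close>, for a parameter set of any shape.
  At an endpoint the derivative is one-sided, and at an isolated parameter the derivative condition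
  is void.\<close>

definition integral_curve :: "(real^'n \<Rightarrow> real^'n::finite) \<Rightarrow> (real^'n) set \<Rightarrow> real set \<Rightarrow> (real \<Rightarrow> real^'n) \<Rightarrow> bool" where
  "integral_curve X S I c \<longleftrightarrow> (\<forall>s\<in>I. c s \<in> S \<and> (c has_vector_derivative X (c s)) (at s within I))"

lemma integral_curve_subset: "integral_curve X S I c \<Longrightarrow> J \<subseteq> I \<Longrightarrow> integral_curve X S J c"
  unfolding integral_curve_def by (meson has_vector_derivative_within_subset subsetD)

lemma integral_curve_mono: "integral_curve X S I c \<Longrightarrow> S \<subseteq> T \<Longrightarrow> integral_curve X T I c"
  unfolding integral_curve_def by blast

lemma integral_curve_cong:
  "integral_curve X S I c \<Longrightarrow> (\<And>y. y \<in> S \<Longrightarrow> X y = Y y) \<Longrightarrow> integral_curve Y S I c"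
  unfolding integral_curve_def by metis

lemma integral_curve_in: "integral_curve X S I c \<Longrightarrow> t \<in> I \<Longrightarrow> c t \<in> S"
  unfolding integral_curve_def by blast

lemma integral_curve_continuous: "integral_curve X S I c \<Longrightarrow> continuous_on I c"
  unfolding integral_curve_def by (meson continuous_on_eq_continuous_within has_vector_derivative_continuous)

lemma integral_curve_near:
  assumes "integral_curve X S I c" "t \<in> I" "0 < r"
  obtains \<epsilon> where "0 < \<epsilon>" "\<And>s. s \<in> I \<Longrightarrow> \<bar>s - t\<bar> < \<epsilon> \<Longrightarrow> c s \<in> ball (c t) r"
  using integral_curve_continuous[OF assms(1)] assms(2,3)
  unfolding continuous_on_iff by (metis dist_commute dist_real_def mem_ball)

lemma integral_curve_shift:
  assumes c: "integral_curve X S I c" and J: "(\<lambda>s. s + d) ` J \<subseteq> I"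
  shows "integral_curve X S J (\<lambda>s. c (s + d))"
  unfolding integral_curve_def
proof (intro ballI conjI)
  fix s assume s: "s \<in> J"
  then show "c (s + d) \<in> S" using c J integral_curve_in by blast
  have "((\<lambda>s. s + d) has_vector_derivative 1) (at s within J)"
    by (auto intro!: derivative_eq_intros)
  moreover have "(c has_vector_derivative X (c (s + d))) (at (s + d) within (\<lambda>s. s + d) ` J)"
    using c J s unfolding integral_curve_def by (meson has_vector_derivative_within_subset image_subset_iff)
  ultimately have "(c \<circ> (\<lambda>s. s + d) has_vector_derivative 1 *\<^sub>R X (c (s + d))) (at s within J)"
    by (rule vector_diff_chain_within)
  then show "((\<lambda>s. c (s + d)) has_vector_derivative X (c (s + d))) (at s within J)"
    by (simp add: o_def)
qed

lemma integral_curve_reverse: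
  assumes c: "integral_curve X S I c"
  shows "integral_curve (\<lambda>y. - X y) S (uminus ` I) (\<lambda>s. c (- s))"
  unfolding integral_curve_def
proof (intro ballI conjI)
  fix s assume s: "s \<in> uminus ` I"
  then show "c (- s) \<in> S" using c integral_curve_in by force
  have "(uminus has_vector_derivative -1) (at s within uminus ` I)"
    by (auto intro!: derivative_eq_intros)
  moreover have "(c has_vector_derivative X (c (- s))) (at (- s) within uminus ` uminus ` I)"
    using c s unfolding integral_curve_def by (auto simp: image_image)
  ultimately have "(c \<circ> uminus has_vector_derivative -1 *\<^sub>R X (c (- s))) (at s within uminus ` I)"
    by (rule vector_diff_chain_within)
  then show "((\<lambda>s. c (- s)) has_vector_derivative - X (c (- s))) (at s within uminus ` I)"
    by (simp add: o_def)
qed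

lemma lie_deriv_along_curve:
  assumes c: "integral_curve X S I c" "t \<in> I" and d: "\<phi> differentiable (at (c t))"
  shows "((\<lambda>s. \<phi> (c s)) has_real_derivative lie_deriv X \<phi> (c t)) (at t within I)"
proof -
  have "(c has_derivative (\<lambda>h. h *\<^sub>R X (c t))) (at t within I)"
    using c by (simp add: integral_curve_def has_vector_derivative_def)
  moreover have "(\<phi> has_derivative frechet_derivative \<phi> (at (c t))) (at (c t))"
    using d frechet_derivative_works by blast
  ultimately have "((\<lambda>s. \<phi> (c s)) has_derivative (\<lambda>h. frechet_derivative \<phi> (at (c t)) (h *\<^sub>R X (c t)))) (at t within I)"
    by (rule has_derivative_compose)
  moreover have "frechet_derivative \<phi> (at (c t)) (h *\<^sub>R X (c t)) = lie_deriv X \<phi> (c t) * h" for h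
    using linear_cmul[OF linear_frechet_derivative[OF d]]
    by (simp add: lie_deriv_def frechet_derivative_expansion[OF d, of "X (c t)"])
  ultimately show ?thesis by (simp add: has_field_derivative_def)
qed

text \<open>Whether the two curves agree is a locally constant property of the time, hence constant
  on the interval. A disagreement persists by continuity; an agreement spreads by Gronwall's
  inequality in a ball where the field is Lipschitz.\<close>

lemma integral_curve_unique:
  assumes lip: "locally_lipschitz_on X S" and c: "integral_curve X S I c" "integral_curve X S I c'"
    and I: "is_interval I" "t0 \<in> I" "t \<in> I" and eq: "c t0 = c' t0"
  shows "c t = c' t"
proof -
  have cont: "continuous_on I c" "continuous_on I c'"
    using c integral_curve_continuous by auto
  have "eventually (\<lambda>s. (c t = c' t) = (c s = c' s)) (at t within I)" if t: "t \<in> I" for t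
  proof (cases "c t = c' t")
    case False
    have "((\<lambda>s. c s - c' s) \<longlongrightarrow> c t - c' t) (at t within I)"
      using cont t unfolding continuous_on_def by (intro tendsto_diff) auto
    then have "eventually (\<lambda>s. c s - c' s \<noteq> 0) (at t within I)"
      by (rule tendsto_imp_eventually_ne) (use False in simp)
    then show ?thesis by eventually_elim (use False in simp)
  next
    case True
    obtain r L where r: "r > 0"
      "\<And>y z. y \<in> ball (c t) r \<Longrightarrow> z \<in> ball (c t) r \<Longrightarrow> norm (X y - X z) \<le> L * norm (y - z)"
      using lip integral_curve_in[OF c(1) t] unfolding locally_lipschitz_on_def by meson
    obtain e1 where e1: "0 < e1" "\<And>s. s \<in> I \<Longrightarrow> \<bar>s - t\<bar> < e1 \<Longrightarrow> c s \<in> ball (c t) r"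
      using integral_curve_near[OF c(1) t r(1)] by blast
    obtain e2 where e2: "0 < e2" "\<And>s. s \<in> I \<Longrightarrow> \<bar>s - t\<bar> < e2 \<Longrightarrow> c' s \<in> ball (c t) r"
      using integral_curve_near[OF c(2) t r(1)] True by metis
    define e where "e = min e1 e2"
    define J where "J = I \<inter> {t - e<..<t + e}"
    have J: "is_interval J" "t \<in> J" "J \<subseteq> I"
      using I t e1 e2 by (auto simp: J_def e_def is_interval_Int)
    \<comment> \<open>The squared distance is used because it remains differentiable where the
      curves meet; its Gronwall constant is 2 L.\<close>
    define w where "w s = (c s - c' s) \<bullet> (c s - c' s)" for s
    have w: "w s = 0" if s: "s \<in> J" for s
    proof (rule gronwall_zero[OF J(1,2) _ _ _ _ s])
      show "w t = 0" using True by (simp add: w_def)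
      fix u assume u: "u \<in> J"
      show "(w has_real_derivative 2 * ((c u - c' u) \<bullet> (X (c u) - X (c' u)))) (at u within J)"
      proof -
        have "(c has_vector_derivative X (c u)) (at u within J)" "(c' has_vector_derivative X (c' u)) (at u within J)"
          using integral_curve_subset[OF c(1) J(3)] integral_curve_subset[OF c(2) J(3)] u
          by (auto simp: integral_curve_def)
        then have d: "((\<lambda>s. c s - c' s) has_derivative (\<lambda>h. h *\<^sub>R (X (c u) - X (c' u)))) (at u within J)"
          unfolding has_vector_derivative_def[symmetric] by (rule has_vector_derivative_diff)
        show ?thesis unfolding w_def has_field_derivative_def
          by (rule has_derivative_eq_rhs[OF has_derivative_inner[OF d d]]) (simp add: fun_eq_iff inner_commute)
      qed
      have "norm (X (c u) - X (c' u)) \<le> L * norm (c u - c' u)"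
        using u e1 e2 by (intro r(2)) (auto simp: J_def e_def)
      then have "norm (c u - c' u) * norm (X (c u) - X (c' u)) \<le> norm (c u - c' u) * (L * norm (c u - c' u))"
        by (rule mult_left_mono) simp
      then have "\<bar>(c u - c' u) \<bullet> (X (c u) - X (c' u))\<bar> \<le> L * w u"
        using Cauchy_Schwarz_ineq2[of "c u - c' u" "X (c u) - X (c' u)"]
        by (simp add: w_def dot_square_norm power2_eq_square mult_ac)
      then show "\<bar>2 * ((c u - c' u) \<bullet> (X (c u) - X (c' u)))\<bar> \<le> (2 * L) * w u" by simp
    qed (simp add: w_def)
    have "\<forall>\<^sub>F s in at t within I. \<bar>s - t\<bar> < e \<and> s \<in> I"
      using e1 e2 unfolding eventually_at by (intro exI[of _ e]) (auto simp: e_def dist_real_def)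
    then show ?thesis
    proof eventually_elim
      case (elim s)
      then have "s \<in> J" by (auto simp: J_def abs_less_iff)
      then show ?case using w True by (simp add: w_def)
    qed
  qed
  then have "(c t0 = c' t0) = (c t = c' t)"
    by (intro connected_local_const[OF is_interval_connected[OF I(1)] I(2,3), of "\<lambda>s. c s = c' s"] ballI)
  then show ?thesis using eq by simp
qed

text \<open>By the Cauchy estimates, Taylor's formula propagates flatness along a curve.\<close>

lemma flat_near:
  fixes f :: "real^'n::finite \<Rightarrow> real"
  assumes f: "real_analytic_on f S" and X: "analytic_field_on X S"
    and c: "integral_curve X S I c" "is_interval I" "t \<in> I"
    and flat: "\<And>k. (lie_deriv X ^^ k) f (c t) = 0"
  obtains \<epsilon> where "0 < \<epsilon>" "\<And>s k. s \<in> I \<Longrightarrow> \<bar>s - t\<bar> < \<epsilon> \<Longrightarrow> (lie_deriv X ^^ k) f (c s) = 0"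
proof -
  have "c t \<in> S" using c integral_curve_in by blast
  then obtain r C K where r: "0 < r" "0 \<le> C" "0 \<le> K"
    and bd: "\<And>N y. y \<in> ball (c t) r \<Longrightarrow> \<bar>(lie_deriv X ^^ N) f y\<bar> \<le> C * K ^ N * fact N"
    and dif: "\<And>N y. y \<in> ball (c t) r \<Longrightarrow> (lie_deriv X ^^ N) f differentiable (at y)"
    using lie_deriv_iterate_bound[of f "c t" X] f X
    unfolding real_analytic_on_def analytic_field_on_def by metis
  obtain e where e: "0 < e" "\<And>s. s \<in> I \<Longrightarrow> \<bar>s - t\<bar> < e \<Longrightarrow> c s \<in> ball (c t) r"
    using integral_curve_near[OF c(1,3) r(1)] by blast
  \<comment> \<open>This radius makes the ratio \<open>x = 2 * K * \<bar>s - t\<bar>\<close> of the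
    estimate below less than 1.\<close>
  define \<epsilon> where "\<epsilon> = min e (1 / (2 * K + 1))"
  have \<epsilon>: "0 < \<epsilon>" "\<epsilon> \<le> e" using e r by (auto simp: \<epsilon>_def)
  define J where "J = I \<inter> {t - \<epsilon><..<t + \<epsilon>}"
  have J: "is_interval J" "t \<in> J" "J \<subseteq> I"
    using c \<epsilon> by (auto simp: J_def is_interval_Int)
  have near: "c s \<in> ball (c t) r" if "s \<in> J" for s
    using that e(2)[of s] \<epsilon> by (auto simp: J_def abs_less_iff)
  show thesis
  proof (rule that[OF \<epsilon>(1)])
    fix s k assume "s \<in> I" "\<bar>s - t\<bar> < \<epsilon>"
    then have s: "s \<in> J" by (auto simp: J_def abs_less_iff)
    define u where "u i \<tau> = (lie_deriv X ^^ (k + i)) f (c \<tau>)" for i \<tau>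
    define x where "x = 2 * K * \<bar>s - t\<bar>"
    have "\<bar>s - t\<bar> < 1 / (2 * K + 1)" using \<open>\<bar>s - t\<bar> < \<epsilon>\<close> by (simp add: \<epsilon>_def)
    then have "(2 * K + 1) * \<bar>s - t\<bar> < 1" using r by (simp add: pos_less_divide_eq mult.commute)
    then have x: "\<bar>x\<bar> < 1" using r unfolding x_def by (auto simp: algebra_simps)
    \<comment> \<open>All Taylor coefficients at t vanish, so only the remainder is left, with
      \<open>fact n\<close> in its denominator. A binomial coefficient is at most the power of 2,
      which bounds \<open>fact (k + Suc n)\<close> by
      \<open>2 ^ (k + Suc n) * fact k * fact (Suc n)\<close>; hence the factors 2 and
      \<open>Suc n\<close>.\<close>
    have le: "\<bar>u 0 s\<bar> \<le> C * (2 * K) ^ k * fact k * (Suc n * x ^ Suc n)" for n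
    proof -
      have "norm (u 0 s - (\<Sum>i\<le>n. u i t * (s - t) ^ i / fact i))
        \<le> (C * K ^ (k + Suc n) * fact (k + Suc n)) * norm (s - t) ^ Suc n / fact n"
      proof (rule field_Taylor[OF _ _ _ J(2) s])
        show "convex J" using J is_interval_convex by blast
        show "(u i has_field_derivative u (Suc i) \<tau>) (at \<tau> within J)" if "\<tau> \<in> J" for i \<tau>
          using lie_deriv_along_curve[OF integral_curve_subset[OF c(1) J(3)] that dif[OF near[OF that]]]
          by (simp add: u_def[abs_def])
        show "norm (u (Suc n) \<tau>) \<le> C * K ^ (k + Suc n) * fact (k + Suc n)" if "\<tau> \<in> J" for \<tau>
          unfolding u_def real_norm_def by (rule bd[OF near[OF that]])
      qed
      moreover have "u i t = 0" for i using flat by (simp add: u_def)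
      ultimately have "\<bar>u 0 s\<bar> \<le> (C * K ^ (k + Suc n) * fact (k + Suc n)) * \<bar>s - t\<bar> ^ Suc n / fact n"
        by simp
      also have "\<dots> \<le> (C * K ^ (k + Suc n) * (2 ^ (k + Suc n) * fact k * fact (Suc n))) * \<bar>s - t\<bar> ^ Suc n / fact n"
      proof -
        have "real ((k + Suc n) choose k) \<le> 2 ^ (k + Suc n)"
          using binomial_le_pow2[of "k + Suc n" k] by (metis of_nat_le_iff of_nat_numeral of_nat_power)
        then have "fact k * fact (Suc n) * real ((k + Suc n) choose k) \<le> fact k * fact (Suc n) * 2 ^ (k + Suc n)"
          by (rule mult_left_mono) simp
        moreover have "fact k * fact (k + Suc n - k) * real ((k + Suc n) choose k) = fact (k + Suc n)"
          using binomial_fact_lemma[of k "k + Suc n"] by (metis le_add1 of_nat_fact of_nat_mult)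
        ultimately have "fact (k + Suc n) \<le> (2 ^ (k + Suc n) * fact k * fact (Suc n) :: real)"
          by (simp only: mult.assoc mult.commute mult.left_commute add_diff_cancel_left')
        then show ?thesis using r by (intro divide_right_mono mult_right_mono mult_left_mono) auto
      qed
      also have "\<dots> = C * (2 * K) ^ k * fact k * (Suc n * x ^ Suc n)"
        by (simp add: x_def power_mult_distrib power_add field_simps)
      finally show ?thesis .
    qed
    have "(\<lambda>n. of_nat n * x ^ n) \<longlonglongrightarrow> 0" by (rule powser_times_n_limit_0) (use x in simp)
    then have "(\<lambda>n. C * (2 * K) ^ k * fact k * (Suc n * x ^ Suc n)) \<longlonglongrightarrow> 0"
      using tendsto_mult_right_zero LIMSEQ_Suc by fastforce
    then have "\<bar>u 0 s\<bar> \<le> 0" using le by (intro LIMSEQ_le_const) auto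
    then show "(lie_deriv X ^^ k) f (c s) = 0" by (simp add: u_def)
  qed
qed

lemma lie_deriv_iterate_differentiable:
  fixes f :: "real^'n::finite \<Rightarrow> real"
  assumes "real_analytic_on f S" "analytic_field_on X S" "y \<in> S"
  shows "(lie_deriv X ^^ k) f differentiable (at y)"
proof -
  have f: "real_analytic_at f y" and X: "\<And>j. real_analytic_at (\<lambda>y. X y $ j) y"
    using assms by (simp_all add: real_analytic_on_def analytic_field_on_def)
  show ?thesis by (rule lie_deriv_iterate_bound[OF f X]) simp
qed

text \<open>Flatness at a time spreads to nearby times by \<open>flat_near\<close>, and the
  nonvanishing of some iterated derivative spreads by continuity. Both alternatives are thus open in
  the interval, which is connected.\<close>

lemma flat_along_curve:
  fixes f :: "real^'n::finite \<Rightarrow> real"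
  assumes f: "real_analytic_on f S" and X: "analytic_field_on X S"
    and c: "integral_curve X S I c" "is_interval I" "t0 \<in> I" "t \<in> I"
  shows "(\<forall>k. (lie_deriv X ^^ k) f (c t0) = 0) \<longleftrightarrow> (\<forall>k. (lie_deriv X ^^ k) f (c t) = 0)"
    and "(lie_deriv X ^^ k) f (c t) \<noteq> 0 \<Longrightarrow>
      \<exists>\<epsilon>>0. \<forall>s\<in>I. \<bar>s - t\<bar> < \<epsilon> \<longrightarrow> (lie_deriv X ^^ k) f (c s) \<noteq> 0"
proof -
  note dif = lie_deriv_iterate_differentiable[OF f X]
  have near: "\<exists>\<epsilon>>0. \<forall>s\<in>I. \<bar>s - t\<bar> < \<epsilon> \<longrightarrow> (lie_deriv X ^^ k) f (c s) \<noteq> 0"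
    if t: "t \<in> I" and k: "(lie_deriv X ^^ k) f (c t) \<noteq> 0" for t k
  proof -
    have "continuous (at t within I) (\<lambda>s. (lie_deriv X ^^ k) f (c s))"
      using lie_deriv_along_curve[OF c(1) t dif] integral_curve_in[OF c(1) t] DERIV_continuous by blast
    then obtain \<epsilon> where "0 < \<epsilon>"
      "\<forall>s\<in>I. dist s t < \<epsilon> \<longrightarrow> dist ((lie_deriv X ^^ k) f (c s)) ((lie_deriv X ^^ k) f (c t)) < \<bar>(lie_deriv X ^^ k) f (c t)\<bar>"
      using k unfolding continuous_within_eps_delta by (metis zero_less_abs_iff)
    then show ?thesis by (intro exI[of _ \<epsilon>]) (force simp: dist_real_def)
  qed
  show "(lie_deriv X ^^ k) f (c t) \<noteq> 0 \<Longrightarrow>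
      \<exists>\<epsilon>>0. \<forall>s\<in>I. \<bar>s - t\<bar> < \<epsilon> \<longrightarrow> (lie_deriv X ^^ k) f (c s) \<noteq> 0"
    using near c(4) by blast
  have "eventually (\<lambda>s. (\<forall>k. (lie_deriv X ^^ k) f (c t) = 0) = (\<forall>k. (lie_deriv X ^^ k) f (c s) = 0)) (at t within I)"
    if t: "t \<in> I" for t
  proof -
    have "\<exists>\<epsilon>>0. \<forall>s\<in>I. \<bar>s - t\<bar> < \<epsilon> \<longrightarrow> (\<forall>k. (lie_deriv X ^^ k) f (c t) = 0) = (\<forall>k. (lie_deriv X ^^ k) f (c s) = 0)"
    proof (cases "\<forall>k. (lie_deriv X ^^ k) f (c t) = 0")
      case True
      obtain \<epsilon> where "0 < \<epsilon>" "\<And>s k. s \<in> I \<Longrightarrow> \<bar>s - t\<bar> < \<epsilon> \<Longrightarrow> (lie_deriv X ^^ k) f (c s) = 0"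
        using flat_near[OF f X c(1,2) t] True by metis
      then show ?thesis using True by blast
    next
      case False
      then obtain k where "(lie_deriv X ^^ k) f (c t) \<noteq> 0" by blast
      then show ?thesis using near[OF t] False by blast
    qed
    then show ?thesis unfolding eventually_at dist_real_def by blast
  qed
  then show "(\<forall>k. (lie_deriv X ^^ k) f (c t0) = 0) \<longleftrightarrow> (\<forall>k. (lie_deriv X ^^ k) f (c t) = 0)"
    by (intro connected_local_const[OF is_interval_connected[OF c(2)] c(3,4),
          of "\<lambda>t. \<forall>k. (lie_deriv X ^^ k) f (c t) = 0"] ballI)
qed

lemma lie_deriv_iterate_along_curve:
  fixes f :: "real^'n::finite \<Rightarrow> real"
  assumes "real_analytic_on f S" "analytic_field_on X S" "integral_curve X S I c" "t \<in> I"
  shows "((\<lambda>s. (lie_deriv X ^^ k) f (c s)) has_real_derivative (lie_deriv X ^^ Suc k) f (c t)) (at t within I)"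
  using lie_deriv_along_curve[OF assms(3,4) lie_deriv_iterate_differentiable[OF assms(1,2)]]
    integral_curve_in[OF assms(3,4)] by simp

text \<open>The curve is flat at no time, so near each time some iterated derivative has no zero and
  Rolle's theorem leaves finitely many zeros. Lindelof's theorem selects countably many such
  neighbourhoods.\<close>

lemma countable_zeros_along_curve:
  fixes f :: "real^'n::finite \<Rightarrow> real"
  assumes f: "real_analytic_on f S" and X: "analytic_field_on X S"
    and c: "integral_curve X S I c" "is_interval I" "t0 \<in> I"
    and nz: "(lie_deriv X ^^ k0) f (c t0) \<noteq> 0"
  shows "countable {t\<in>I. f (c t) = 0}"
proof -
  have "\<exists>\<epsilon>>0. finite {s\<in>I. \<bar>s - t\<bar> < \<epsilon> \<and> f (c s) = 0}" if t: "t \<in> I" for t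
  proof -
    obtain k where "(lie_deriv X ^^ k) f (c t) \<noteq> 0"
      using flat_along_curve(1)[OF f X c t] nz by blast
    then obtain \<epsilon> where \<epsilon>: "0 < \<epsilon>" "\<And>s. s \<in> I \<Longrightarrow> \<bar>s - t\<bar> < \<epsilon> \<Longrightarrow> (lie_deriv X ^^ k) f (c s) \<noteq> 0"
      using flat_along_curve(2)[OF f X c t] by blast
    define J where "J = I \<inter> {t - \<epsilon><..<t + \<epsilon>}"
    have J: "is_interval J" "J \<subseteq> I" using c by (auto simp: J_def is_interval_Int)
    have "finite {s\<in>J. (lie_deriv X ^^ 0) f (c s) = 0} \<and> card {s\<in>J. (lie_deriv X ^^ 0) f (c s) = 0} \<le> k"
    proof (rule rolle_iterated[OF J(1)])
      show "(lie_deriv X ^^ k) f (c s) \<noteq> 0" if "s \<in> J" for s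
        using that \<epsilon>(2)[of s] by (auto simp: J_def abs_less_iff)
      show "((\<lambda>t. (lie_deriv X ^^ i) f (c t)) has_real_derivative (lie_deriv X ^^ Suc i) f (c s)) (at s within J)"
        if "s \<in> J" for i s
        using lie_deriv_iterate_along_curve[OF f X integral_curve_subset[OF c(1) J(2)] that] .
    qed
    moreover have "{s\<in>I. \<bar>s - t\<bar> < \<epsilon> \<and> f (c s) = 0} = {s\<in>J. (lie_deriv X ^^ 0) f (c s) = 0}"
      by (auto simp: J_def abs_less_iff)
    ultimately show ?thesis using \<epsilon>(1) by auto
  qed
  then obtain \<epsilon> where \<epsilon>: "\<And>t. t \<in> I \<Longrightarrow> 0 < \<epsilon> t \<and> finite {s\<in>I. \<bar>s - t\<bar> < \<epsilon> t \<and> f (c s) = 0}"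
    by metis
  obtain \<F> where \<F>: "\<F> \<subseteq> (\<lambda>t. ball t (\<epsilon> t)) ` I" "countable \<F>" "\<Union>\<F> = \<Union>((\<lambda>t. ball t (\<epsilon> t)) ` I)"
    using Lindelof[of "(\<lambda>t. ball t (\<epsilon> t)) ` I"] by blast
  have "{t\<in>I. f (c t) = 0} \<subseteq> (\<Union>B\<in>\<F>. {t\<in>I. t \<in> B \<and> f (c t) = 0})"
  proof
    fix t assume t: "t \<in> {t\<in>I. f (c t) = 0}"
    then have "t \<in> ball t (\<epsilon> t)" using \<epsilon> by simp
    then have "t \<in> \<Union>\<F>" using t \<F>(3) by blast
    then show "t \<in> (\<Union>B\<in>\<F>. {t\<in>I. t \<in> B \<and> f (c t) = 0})" using t by blast
  qed
  moreover have "countable {t\<in>I. t \<in> B \<and> f (c t) = 0}" if "B \<in> \<F>" for B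
  proof -
    obtain t where "t \<in> I" "B = ball t (\<epsilon> t)" using \<F>(1) \<open>B \<in> \<F>\<close> by blast
    then have "{s\<in>I. s \<in> B \<and> f (c s) = 0} = {s\<in>I. \<bar>s - t\<bar> < \<epsilon> t \<and> f (c s) = 0}"
      by (auto simp: dist_real_def abs_minus_commute)
    then show ?thesis using \<epsilon>[OF \<open>t \<in> I\<close>] by (simp add: countable_finite)
  qed
  then have "countable (\<Union>B\<in>\<F>. {t\<in>I. t \<in> B \<and> f (c t) = 0})" using \<F>(2) by (intro countable_UN)
  ultimately show ?thesis by (rule countable_subset)
qed

text \<open>Picard's contraction argument. The curve will serve to differentiate, in the direction
  of the field, relations known only on an invariant set.\<close>

lemma local_integral_curve:
  fixes X :: "real^'n::finite \<Rightarrow> real^'n"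
  assumes lip: "locally_lipschitz_on X S" and "open S" and y: "y \<in> S"
  obtains \<epsilon> c where "0 < \<epsilon>" "c 0 = y" "integral_curve X S {0..\<epsilon>} c"
proof -
  obtain r0 L0 where r0: "0 < r0" "\<And>a b. a \<in> ball y r0 \<Longrightarrow> b \<in> ball y r0 \<Longrightarrow> norm (X a - X b) \<le> L0 * norm (a - b)"
    using lip y unfolding locally_lipschitz_on_def by meson
  obtain r1 where r1: "0 < r1" "ball y r1 \<subseteq> S" using \<open>open S\<close> y open_contains_ball by blast
  define r where "r = min r0 r1 / 2"
  define L where "L = max L0 0"
  have r: "0 < r" "cball y r \<subseteq> ball y r0" "cball y r \<subseteq> S"
    using r0 r1 by (auto simp: r_def subset_iff dist_commute)
  have L: "norm (X a - X b) \<le> L * norm (a - b)" if "a \<in> cball y r" "b \<in> cball y r" for a b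
  proof -
    have "norm (X a - X b) \<le> L0 * norm (a - b)" using that r by (intro r0(2)) auto
    also have "\<dots> \<le> L * norm (a - b)" by (intro mult_right_mono) (auto simp: L_def)
    finally show ?thesis .
  qed
  have L0: "0 \<le> L" by (simp add: L_def)
  have cX: "continuous_on (cball y r) X"
    using L L0 by (intro lipschitz_on_continuous_on[of L] lipschitz_onI) (auto simp: dist_norm)
  define M where "M = norm (X y) + L * r"
  have M: "norm (X a) \<le> M" if "a \<in> cball y r" for a
  proof -
    have "norm (X a) \<le> norm (X y) + norm (X a - X y)" by (rule norm_triangle_sub)
    also have "norm (X a - X y) \<le> L * norm (a - y)" using that r by (intro L) auto
    also have "\<dots> \<le> L * r" using that L0 by (intro mult_left_mono) (auto simp: dist_norm norm_minus_commute)
    finally show ?thesis by (simp add: M_def)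
  qed
  have M0: "0 \<le> M" using M[of y] r norm_ge_zero[of "X y"] by (simp add: M_def L0)
  \<comment> \<open>The first bound keeps the iterates in the ball of radius r, the second makes the
    contraction factor at most 1 / 2. The added 1 keeps the denominators positive.\<close>
  define \<epsilon> where "\<epsilon> = min (r / (M + 1)) (1 / (2 * L + 1))"
  have \<epsilon>: "0 < \<epsilon>" using r M0 L0 by (simp add: \<epsilon>_def)
  have "\<epsilon> * (M + 1) \<le> r" "\<epsilon> * (2 * L + 1) \<le> 1"
    using M0 L0 by (simp_all add: pos_le_divide_eq[symmetric] \<epsilon>_def)
  then have \<epsilon>M: "\<epsilon> * M \<le> r" and \<epsilon>L: "\<epsilon> * L \<le> 1 / 2" using \<epsilon> by (simp_all add: algebra_simps)
  \<comment> \<open>Curves on \<open>{0..\<epsilon>}\<close> are extended to the line by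
    \<open>clamp\<close>, so that the operator acts on a closed subset of the complete space of
    bounded continuous functions.\<close>
  define T :: "(real \<Rightarrow>\<^sub>C (real^'n)) set" where "T = PiC UNIV (\<lambda>_. cball y r)"
  have T_iff: "u \<in> T \<longleftrightarrow> (\<forall>t. apply_bcontfun u t \<in> cball y r)" for u
    by (simp add: T_def mem_PiC_iff Pi_iff)
  have T_closed: "closed T" unfolding T_def by (rule closed_PiC) simp
  have cu: "continuous_on A (\<lambda>s. X (apply_bcontfun u s))" if "u \<in> T" for u A
  proof (rule continuous_on_compose2[OF cX])
    show "continuous_on A (apply_bcontfun u)" by simp
  qed (use that in \<open>auto simp: T_iff\<close>)
  define \<phi> where "\<phi> u t = y + integral {0..t} (\<lambda>s. X (apply_bcontfun u s))"
    for u :: "real \<Rightarrow>\<^sub>C (real^'n)" and t :: real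
  have nb: "norm (integral {0..t} g) \<le> B * t"
    if "0 \<le> t" "continuous_on {0..t} g" "\<And>s. s \<in> {0..t} \<Longrightarrow> norm (g s) \<le> B" for t B and g :: "real \<Rightarrow> real^'n"
    using integral_bound[of 0 t g B] that by simp
  have \<phi>_mem: "\<phi> u t \<in> cball y r" if "u \<in> T" "t \<in> {0..\<epsilon>}" for u t
  proof -
    have "norm (integral {0..t} (\<lambda>s. X (apply_bcontfun u s))) \<le> M * t"
      using that M by (intro nb cu) (auto simp: T_iff)
    also have "\<dots> \<le> M * \<epsilon>" using that M0 by (intro mult_left_mono) auto
    also have "\<dots> \<le> r" using \<epsilon>M by (simp add: mult.commute)
    finally show ?thesis by (simp add: \<phi>_def dist_norm)
  qed
  have \<phi>_der: "(\<phi> u has_vector_derivative X (apply_bcontfun u t)) (at t within {0..\<epsilon>})"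
    if "u \<in> T" "t \<in> {0..\<epsilon>}" for u t
  proof -
    have "((\<lambda>t. integral {0..t} (\<lambda>s. X (apply_bcontfun u s))) has_vector_derivative X (apply_bcontfun u t)) (at t within {0..\<epsilon>})"
      by (rule integral_has_vector_derivative[OF cu[OF that(1)] that(2)])
    from has_vector_derivative_add[OF has_vector_derivative_const this] show ?thesis
      unfolding \<phi>_def[abs_def] by simp
  qed
  have \<phi>_cont: "continuous_on (cbox 0 \<epsilon>) (\<phi> u)" if "u \<in> T" for u
    by (auto simp: continuous_on_eq_continuous_within
        intro: has_vector_derivative_continuous[OF \<phi>_der[OF that]])
  have "\<exists>v. \<forall>t. apply_bcontfun v t = \<phi> u (clamp 0 \<epsilon> t)" if "u \<in> T" for u
    using continuous_on_cbox_bcontfunE[OF \<phi>_cont[OF that]] by metis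
  then obtain \<Phi> where \<Phi>: "\<And>u t. u \<in> T \<Longrightarrow> apply_bcontfun (\<Phi> u) t = \<phi> u (clamp 0 \<epsilon> t)"
    by metis
  have clamp: "clamp 0 \<epsilon> t \<in> {0..\<epsilon>}" for t :: real
    using clamp_in_interval[of "0::real" \<epsilon> t] \<epsilon> by simp
  obtain u0 :: "real \<Rightarrow>\<^sub>C (real^'n)" where "\<And>t. apply_bcontfun u0 t = y"
    using continuous_on_cbox_bcontfunE[of "0::real" 0 "\<lambda>_. y"] by (metis continuous_on_const)
  then have u0: "u0 \<in> T" using r by (simp add: T_iff)
  have "\<exists>!u\<in>T. \<Phi> u = u"
  proof (rule Banach_fix)
    show "complete T" using T_closed by (simp add: complete_eq_closed)
    show "T \<noteq> {}" using u0 by blast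
    show "\<Phi> ` T \<subseteq> T" using \<Phi> \<phi>_mem clamp by (auto simp: T_iff)
    fix u v assume uv: "u \<in> T" "v \<in> T"
    show "dist (\<Phi> u) (\<Phi> v) \<le> 1 / 2 * dist u v"
    proof (rule dist_bound)
      fix t
      define \<tau> where "\<tau> = clamp 0 \<epsilon> t"
      have \<tau>: "\<tau> \<in> {0..\<epsilon>}" using clamp by (simp add: \<tau>_def)
      have "\<phi> u \<tau> - \<phi> v \<tau> = integral {0..\<tau>} (\<lambda>s. X (apply_bcontfun u s) - X (apply_bcontfun v s))"
        unfolding \<phi>_def using cu[OF uv(1)] cu[OF uv(2)]
        by (subst integral_diff) (auto intro: integrable_continuous_interval)
      moreover have "norm (integral {0..\<tau>} (\<lambda>s. X (apply_bcontfun u s) - X (apply_bcontfun v s))) \<le> (L * dist u v) * \<tau>"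
      proof (rule nb)
        fix s
        have "norm (X (apply_bcontfun u s) - X (apply_bcontfun v s)) \<le> L * norm (apply_bcontfun u s - apply_bcontfun v s)"
          using uv by (intro L) (auto simp: T_iff)
        also have "\<dots> \<le> L * dist u v"
          using dist_bounded[of u s v] L0 by (intro mult_left_mono) (auto simp: dist_norm)
        finally show "norm (X (apply_bcontfun u s) - X (apply_bcontfun v s)) \<le> L * dist u v" .
      qed (use \<tau> in \<open>auto intro!: continuous_on_diff cu uv\<close>)
      moreover have "(L * dist u v) * \<tau> \<le> (L * dist u v) * \<epsilon>" using \<tau> L0 by (intro mult_left_mono) auto
      moreover have "(L * dist u v) * \<epsilon> \<le> 1 / 2 * dist u v"
        using mult_right_mono[OF \<epsilon>L, of "dist u v"] by (simp add: mult_ac)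
      ultimately have "norm (\<phi> u \<tau> - \<phi> v \<tau>) \<le> 1 / 2 * dist u v" by simp
      then show "dist (apply_bcontfun (\<Phi> u) t) (apply_bcontfun (\<Phi> v) t) \<le> 1 / 2 * dist u v"
        by (simp add: \<Phi>[OF uv(1)] \<Phi>[OF uv(2)] \<tau>_def dist_norm)
    qed
  qed auto
  then obtain u where u: "u \<in> T" "\<Phi> u = u" by blast
  have eq: "apply_bcontfun u t = \<phi> u t" if "t \<in> {0..\<epsilon>}" for t
    using \<Phi>[OF u(1), of t] that clamp_cancel_cbox[of t 0 \<epsilon>] by (simp add: u(2))
  show thesis
  proof (rule that[OF \<epsilon>, of "\<phi> u"])
    show "\<phi> u 0 = y" by (simp add: \<phi>_def)
    show "integral_curve X S {0..\<epsilon>} (\<phi> u)"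
      unfolding integral_curve_def using \<phi>_der[OF u(1)] \<phi>_mem[OF u(1)] r(3) eq by auto
  qed
qed

subsection \<open>Orbits\<close>

lemma mem_orbit_iff:
  "z \<in> orbit X S y \<longleftrightarrow> (\<exists>c t I. is_interval I \<and> 0 \<in> I \<and> t \<in> I \<and> c 0 = y \<and> c t = z \<and> integral_curve X S I c)"
  unfolding orbit_def integral_curve_def by blast

lemma orbitI:
  "\<lbrakk>integral_curve X S I c; is_interval I; 0 \<in> I; t \<in> I\<rbrakk> \<Longrightarrow> c t \<in> orbit X S (c 0)"
  unfolding mem_orbit_iff by blast

lemma orbit_base:
  assumes "y \<in> S" shows "y \<in> orbit X S y"
proof -
  have "integral_curve X S {0} (\<lambda>_. y)"
    using assms by (auto simp: integral_curve_def has_vector_derivative_def has_derivative_within_singleton_iff bounded_linear_scaleR_left)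
  from orbitI[OF this, of 0] show ?thesis by (simp add: is_interval_1)
qed

lemma orbit_subset: "orbit X S y \<subseteq> S"
  unfolding mem_orbit_iff subset_iff using integral_curve_in by blast

lemma orbit_mono:
  assumes "S \<subseteq> T" "\<And>z. z \<in> S \<Longrightarrow> X z = Y z"
  shows "orbit X S y \<subseteq> orbit Y T y"
proof
  fix z assume "z \<in> orbit X S y"
  then obtain c t I where *: "is_interval I" "0 \<in> I" "t \<in> I" "c 0 = y" "c t = z" "integral_curve X S I c"
    unfolding mem_orbit_iff by blast
  have "integral_curve Y T I c"
    using integral_curve_mono[OF integral_curve_cong[OF *(6) assms(2)] assms(1)] by blast
  then show "z \<in> orbit Y T y" unfolding mem_orbit_iff using * by blast
qed

lemma orbit_sym:
  assumes "z \<in> orbit X S y" shows "y \<in> orbit X S z"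
proof -
  obtain c t I where *: "is_interval I" "0 \<in> I" "t \<in> I" "c 0 = y" "c t = z" "integral_curve X S I c"
    using assms unfolding mem_orbit_iff by blast
  define J where "J = (\<lambda>s. s - t) ` I"
  have "integral_curve X S J (\<lambda>s. c (s + t))"
    by (rule integral_curve_shift[OF *(6)]) (auto simp: J_def)
  moreover have "is_interval J" unfolding J_def using *(1) by simp
  moreover have "0 \<in> J" "- t \<in> J" using *(2,3) by (force simp: J_def)+
  ultimately show ?thesis
    unfolding mem_orbit_iff using *(4,5) by (intro exI[of _ "\<lambda>s. c (s + t)"] exI[of _ "- t"] exI[of _ J]) simp
qed

text \<open>The orbit is a union of images of intervals that all contain y, whether or not the
  solution through y is unique.\<close>

lemma connected_orbit: "connected (orbit X S y)"
proof -
  define K where "K = {c ` I | c I. is_interval I \<and> (0::real) \<in> I \<and> c 0 = y \<and> integral_curve X S I c}"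
  have "orbit X S y = \<Union>K"
  proof (intro equalityI subsetI)
    fix z assume "z \<in> orbit X S y"
    then obtain c t I where *: "is_interval I" "0 \<in> I" "t \<in> I" "c 0 = y" "c t = z" "integral_curve X S I c"
      unfolding mem_orbit_iff by blast
    then have "c ` I \<in> K" unfolding K_def by blast
    then show "z \<in> \<Union>K" using * by blast
  next
    fix z assume "z \<in> \<Union>K"
    then obtain c I where "is_interval I" "0 \<in> I" "c 0 = y" "integral_curve X S I c" "z \<in> c ` I"
      unfolding K_def by blast
    then show "z \<in> orbit X S y" unfolding mem_orbit_iff by blast
  qed
  moreover have "connected (\<Union>K)"
  proof (rule connected_Union)
    fix A assume "A \<in> K"
    then have "\<exists>c I. A = c ` I \<and> is_interval I \<and> 0 \<in> I \<and> c 0 = y \<and> integral_curve X S I c"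
      by (simp add: K_def)
    then obtain c I where A: "A = c ` I" "is_interval I" "integral_curve X S I c" by (elim exE conjE)
    show "connected A"
      unfolding A(1) by (intro connected_continuous_image integral_curve_continuous[OF A(3)] is_interval_connected A(2))
  next
    have "y \<in> A" if "A \<in> K" for A
    proof -
      have "\<exists>c I. A = c ` I \<and> is_interval I \<and> 0 \<in> I \<and> c 0 = y \<and> integral_curve X S I c"
        using that by (simp add: K_def)
      then obtain c and I :: "real set" where "A = c ` I" "0 \<in> I" "c 0 = y" by (elim exE conjE)
      then show ?thesis by (simp add: rev_image_eqI)
    qed
    then show "\<Inter>K \<noteq> {}" by blast
  qed
  ultimately show ?thesis by simp
qed

lemma union_of_orbits_orbit_subset:
  "union_of_orbits X S T \<Longrightarrow> y \<in> T \<Longrightarrow> orbit X S y \<subseteq> T"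
  unfolding union_of_orbits_def by blast

text \<open>The points reached at nonnegative times. Under a Lipschitz condition the curves from y
  on the intervals \<open>{0..T}\<close> extend one another, so they form a nested family; the
  points at negative times belong to the forward orbit of the opposite field.\<close>

definition forward_orbit :: "(real^'n \<Rightarrow> real^'n::finite) \<Rightarrow> (real^'n) set \<Rightarrow> real^'n \<Rightarrow> (real^'n) set" where
  "forward_orbit X S y = {z. \<exists>c T. 0 \<le> T \<and> integral_curve X S {0..T} c \<and> c 0 = y \<and> c T = z}"

lemma orbit_eq_forward_backward:
  "orbit X S y = forward_orbit X S y \<union> forward_orbit (\<lambda>y. - X y) S y"
proof
  show "orbit X S y \<subseteq> forward_orbit X S y \<union> forward_orbit (\<lambda>y. - X y) S y"
  proof
    fix z assume "z \<in> orbit X S y"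
    then obtain c t I where *: "is_interval I" "0 \<in> I" "t \<in> I" "c 0 = y" "c t = z" "integral_curve X S I c"
      unfolding mem_orbit_iff by blast
    show "z \<in> forward_orbit X S y \<union> forward_orbit (\<lambda>y. - X y) S y"
    proof (cases "0 \<le> t")
      case True
      have "integral_curve X S {0..t} c"
        using integral_curve_subset[OF *(6)] interval_Icc_subset[OF *(1-3)] by blast
      then show ?thesis unfolding forward_orbit_def using True * by blast
    next
      case False
      have "integral_curve X S {t..0} c"
        using integral_curve_subset[OF *(6)] interval_Icc_subset[OF *(1,3,2)] by blast
      from integral_curve_reverse[OF this]
      have "integral_curve (\<lambda>y. - X y) S {0..- t} (\<lambda>s. c (- s))" by simp
      then have "z \<in> forward_orbit (\<lambda>y. - X y) S y"
        unfolding forward_orbit_def using False *(4,5)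
        by (intro CollectI exI[of _ "\<lambda>s. c (- s)"] exI[of _ "- t"]) auto
      then show ?thesis ..
    qed
  qed
  show "forward_orbit X S y \<union> forward_orbit (\<lambda>y. - X y) S y \<subseteq> orbit X S y"
  proof
    fix z assume "z \<in> forward_orbit X S y \<union> forward_orbit (\<lambda>y. - X y) S y"
    then show "z \<in> orbit X S y"
    proof
      assume "z \<in> forward_orbit X S y"
      then obtain c T where *: "0 \<le> T" "integral_curve X S {0..T} c" "c 0 = y" "c T = z"
        unfolding forward_orbit_def by blast
      then show ?thesis
        unfolding mem_orbit_iff
        by (intro exI[of _ c] exI[of _ T] exI[of _ "{0..T}"]) (auto simp: is_interval_cc)
    next
      assume "z \<in> forward_orbit (\<lambda>y. - X y) S y"
      then obtain c T where *: "0 \<le> T" "integral_curve (\<lambda>y. - X y) S {0..T} c" "c 0 = y" "c T = z"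
        unfolding forward_orbit_def by blast
      have "integral_curve X S {- T..0} (\<lambda>s. c (- s))"
        using integral_curve_reverse[OF *(2)] by simp
      then show ?thesis
        unfolding mem_orbit_iff using *(1,3,4)
        by (intro exI[of _ "\<lambda>s. c (- s)"] exI[of _ "- T"] exI[of _ "{- T..0}"]) (auto simp: is_interval_cc)
    qed
  qed
qed

lemma locally_lipschitz_on_uminus:
  "locally_lipschitz_on X S \<Longrightarrow> locally_lipschitz_on (\<lambda>y. - X y) S"
  unfolding locally_lipschitz_on_def by (simp add: norm_minus_commute)

lemma forward_curve_unique:
  assumes lip: "locally_lipschitz_on X S"
    and c: "integral_curve X S {0..T} c" "integral_curve X S {0..T'} c'" "c 0 = c' 0"
    and t: "0 \<le> t" "t \<le> T" "t \<le> T'"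
  shows "c t = c' t"
proof (rule integral_curve_unique[OF lip, where I = "{0..t}" and ?t0.0 = 0])
  show "integral_curve X S {0..t} c" "integral_curve X S {0..t} c'"
    using integral_curve_subset[OF c(1)] integral_curve_subset[OF c(2)] t by auto
qed (use t c(3) in \<open>auto simp: is_interval_cc\<close>)

text \<open>The curve is stopped as soon as all points of \<open>A\<close> have been visited; a longer closed
  curve would have visited them already.\<close>

lemma injective_curve_through:
  assumes lip: "locally_lipschitz_on X S" and y: "y \<in> S"
    and A: "finite A" "A \<subseteq> forward_orbit X S y"
  obtains c T where "0 \<le> T" "integral_curve X S {0..T} c" "c 0 = y" "inj_on c {0..T}" "A \<subseteq> c ` {0..T}"
proof (cases "A = {}")
  case True
  have "integral_curve X S {0..0} (\<lambda>_. y)"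
    using y by (auto simp: integral_curve_def has_vector_derivative_def has_derivative_within_singleton_iff bounded_linear_scaleR_left)
  then show thesis using True by (intro that[of 0 "\<lambda>_. y"]) auto
next
  case False
  have "\<forall>z\<in>A. \<exists>c T. 0 \<le> T \<and> integral_curve X S {0..T} c \<and> c 0 = y \<and> c T = z"
    using A(2) unfolding forward_orbit_def by blast
  then obtain C \<theta> where C: "\<And>z. z \<in> A \<Longrightarrow> 0 \<le> \<theta> z" "\<And>z. z \<in> A \<Longrightarrow> integral_curve X S {0..\<theta> z} (C z)"
    "\<And>z. z \<in> A \<Longrightarrow> C z 0 = y" "\<And>z. z \<in> A \<Longrightarrow> C z (\<theta> z) = z"
    by metis
  have "Max (\<theta> ` A) \<in> \<theta> ` A" using A(1) False by (intro Max_in) auto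
  then obtain z0 where z0: "z0 \<in> A" "\<theta> z0 = Max (\<theta> ` A)" by auto
  \<comment> \<open>The curve of longest duration; by uniqueness it passes through the endpoints of
    all the others.\<close>
  define c where "c = C z0"
  define T where "T = \<theta> z0"
  have c: "integral_curve X S {0..T} c" "c 0 = y" and T: "0 \<le> T"
    using C(1-3)[OF z0(1)] by (simp_all add: c_def T_def)
  have hit: "c (\<theta> z) = z" "\<theta> z \<le> T" if "z \<in> A" for z
  proof -
    show "\<theta> z \<le> T" using that A(1) z0 by (simp add: T_def)
    then show "c (\<theta> z) = z"
      using forward_curve_unique[OF lip c(1) C(2)[OF that], of "\<theta> z"] C[OF that] c(2) by simp
  qed
  have "\<exists>\<tau>\<in>{0..T}. c \<tau> = z \<and> (\<forall>s\<in>{0..T}. c s = z \<longrightarrow> \<tau> \<le> s)" if z: "z \<in> A" for z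
  proof -
    have "closed {s\<in>{0..T}. c s = z}"
      using continuous_closed_preimage_constant[OF integral_curve_continuous[OF c(1)]] by simp
    moreover have "bounded {s\<in>{0..T}. c s = z}" by (rule bounded_subset[of "{0..T}"]) auto
    ultimately have K: "compact {s\<in>{0..T}. c s = z}" using compact_eq_bounded_closed by blast
    have "\<theta> z \<in> {s\<in>{0..T}. c s = z}" using hit[OF z] C(1)[OF z] by simp
    then obtain \<tau> where "\<tau> \<in> {s\<in>{0..T}. c s = z}" "\<forall>s\<in>{s\<in>{0..T}. c s = z}. \<tau> \<le> s"
      using compact_attains_inf[OF K] by blast
    then show ?thesis by auto
  qed
  then obtain h where h: "\<And>z. z \<in> A \<Longrightarrow> h z \<in> {0..T} \<and> c (h z) = z"
    "\<And>z s. z \<in> A \<Longrightarrow> s \<in> {0..T} \<Longrightarrow> c s = z \<Longrightarrow> h z \<le> s"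
    by metis
  have "Max (h ` A) \<in> h ` A" using A(1) False by (intro Max_in) auto
  then obtain z1 where z1: "z1 \<in> A" "h z1 = Max (h ` A)" by auto
  have le: "h z \<le> h z1" if "z \<in> A" for z using that A(1) z1 by simp
  have T1: "0 \<le> h z1" "h z1 \<le> T" using h(1)[OF z1(1)] by auto
  show thesis
  proof (rule that[OF T1(1)])
    show c1: "integral_curve X S {0..h z1} c" using integral_curve_subset[OF c(1)] T1 by auto
    show "c 0 = y" by (rule c(2))
    show "A \<subseteq> c ` {0..h z1}"
    proof
      fix z assume z: "z \<in> A"
      then have "h z \<in> {0..h z1}" using h(1) le by auto
      then show "z \<in> c ` {0..h z1}" using h(1)[OF z] by force
    qed
    \<comment> \<open>Cutting out a loop between s and t would bring the curve to \<open>z1\<close>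
      at the time \<open>h z1 - (t - s)\<close>, before its first visit.\<close>
    have False if st: "0 \<le> s" "s < t" "t \<le> h z1" "c s = c t" for s t
    proof -
      define d where "d = h z1 - t"
      have "integral_curve X S {0..d} (\<lambda>u. c (u + s))" "integral_curve X S {0..d} (\<lambda>u. c (u + t))"
        using st by (auto intro!: integral_curve_shift[OF c1] simp: d_def)
      from forward_curve_unique[OF lip this, of d] have "c (d + s) = c (h z1)"
        using st by (simp add: d_def)
      then have "c (d + s) = z1" using h(1)[OF z1(1)] by simp
      then have "h z1 \<le> d + s" using st T1 by (intro h(2)[OF z1(1)]) (auto simp: d_def)
      then show False using st by (simp add: d_def)
    qed
    then show "inj_on c {0..h z1}"
      by (intro inj_onI) (metis atLeastAtMost_iff linorder_neqE)
  qed
qed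

text \<open>Every finite subset of one half of the orbit lies on a single injective curve, where the
  bound on times applies. The two halves account for the factor 2.\<close>

lemma card_orbit_le:
  assumes lip: "locally_lipschitz_on X S" and y: "y \<in> S" and Z: "Z \<subseteq> orbit X S y"
    and bd: "\<And>J c. is_interval J \<Longrightarrow> 0 \<in> J \<Longrightarrow> integral_curve X S J c \<Longrightarrow> c 0 = y \<Longrightarrow> inj_on c J \<Longrightarrow>
      finite {t\<in>J. c t \<in> Z} \<and> card {t\<in>J. c t \<in> Z} \<le> N"
  shows "finite Z \<and> card Z \<le> 2 * N"
proof -
  have card: "card A \<le> N"
    if A: "finite A" "A \<subseteq> Z" "A \<subseteq> forward_orbit X S y \<or> A \<subseteq> forward_orbit (\<lambda>y. - X y) S y" for A
  proof -
    have "\<exists>J c. is_interval J \<and> 0 \<in> J \<and> integral_curve X S J c \<and> c 0 = y \<and> inj_on c J \<and> A \<subseteq> c ` J"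
      using A(3)
    proof
      assume "A \<subseteq> forward_orbit X S y"
      then obtain c T where "0 \<le> T" "integral_curve X S {0..T} c" "c 0 = y" "inj_on c {0..T}" "A \<subseteq> c ` {0..T}"
        by (rule injective_curve_through[OF lip y A(1)])
      then show ?thesis by (intro exI[of _ "{0..T}"] exI[of _ c]) (auto simp: is_interval_cc)
    next
      assume "A \<subseteq> forward_orbit (\<lambda>y. - X y) S y"
      then obtain c T where *: "0 \<le> T" "integral_curve (\<lambda>y. - X y) S {0..T} c" "c 0 = y" "inj_on c {0..T}" "A \<subseteq> c ` {0..T}"
        by (rule injective_curve_through[OF locally_lipschitz_on_uminus[OF lip] y A(1)])
      have "integral_curve X S {- T..0} (\<lambda>s. c (- s))"
        using integral_curve_reverse[OF *(2)] by simp
      moreover have "inj_on (\<lambda>s. c (- s)) {- T..0}"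
      proof (rule inj_onI)
        fix s t assume "s \<in> {- T..0}" "t \<in> {- T..0}" "c (- s) = c (- t)"
        then have "- s = - t" by (intro inj_onD[OF *(4)]) auto
        then show "s = t" by simp
      qed
      moreover have "A \<subseteq> (\<lambda>s. c (- s)) ` {- T..0}"
      proof
        fix z assume "z \<in> A"
        then obtain t where "t \<in> {0..T}" "z = c t" using *(5) by blast
        then show "z \<in> (\<lambda>s. c (- s)) ` {- T..0}" by (intro image_eqI[of _ _ "- t"]) auto
      qed
      ultimately show ?thesis using *(1,3)
        by (intro exI[of _ "{- T..0}"] exI[of _ "\<lambda>s. c (- s)"]) (auto simp: is_interval_cc)
    qed
    then obtain J c where J: "is_interval J" "0 \<in> J" "integral_curve X S J c" "c 0 = y" "inj_on c J" "A \<subseteq> c ` J"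
      by blast
    have fin: "finite {t\<in>J. c t \<in> Z}" and le: "card {t\<in>J. c t \<in> Z} \<le> N" using bd[OF J(1-5)] by auto
    have "A \<subseteq> c ` {t\<in>J. c t \<in> Z}" using J(6) A(2) by blast
    then have "card A \<le> card {t\<in>J. c t \<in> Z}" using fin surj_card_le by blast
    then show ?thesis using le by simp
  qed
  have *: "finite (Z \<inter> F) \<and> card (Z \<inter> F) \<le> N"
    if F: "F = forward_orbit X S y \<or> F = forward_orbit (\<lambda>y. - X y) S y" for F
  proof -
    have "finite (Z \<inter> F)"
    proof (rule ccontr)
      assume "infinite (Z \<inter> F)"
      then obtain A where "finite A" "card A = Suc N" "A \<subseteq> Z \<inter> F"
        using infinite_arbitrarily_large by blast
      then show False using card[of A] F by auto
    qed
    then show ?thesis using card[of "Z \<inter> F"] F by auto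
  qed
  have eq: "Z = Z \<inter> forward_orbit X S y \<union> Z \<inter> forward_orbit (\<lambda>y. - X y) S y"
    using Z orbit_eq_forward_backward[of X S y] by blast
  have "card Z \<le> card (Z \<inter> forward_orbit X S y) + card (Z \<inter> forward_orbit (\<lambda>y. - X y) S y)"
    by (subst eq) (rule card_Un_le)
  moreover have "finite Z" by (subst eq) (use * in blast)
  ultimately show ?thesis using *[of "forward_orbit X S y"] *[of "forward_orbit (\<lambda>y. - X y) S y"] by simp
qed

text \<open>Countably many curves exhaust the half orbit: a duration that is not the greatest
  possible one lies below a rational duration, whose curve passes through the same point. A greatest
  duration, if there is one, adds a single endpoint.\<close>

lemma countable_forward_orbit:
  assumes lip: "locally_lipschitz_on X S"
    and cnt: "\<And>T c. integral_curve X S {0..T} c \<Longrightarrow> 0 \<le> T \<Longrightarrow> c 0 = y \<Longrightarrow> countable {t\<in>{0..T}. c t \<in> Z}"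
  shows "countable (Z \<inter> forward_orbit X S y)"
proof -
  define D where "D = {T. 0 \<le> T \<and> (\<exists>c. integral_curve X S {0..T} c \<and> c 0 = y)}"
  have "\<forall>T\<in>D. \<exists>c. integral_curve X S {0..T} c \<and> c 0 = y" unfolding D_def by blast
  then obtain C where C: "\<And>T. T \<in> D \<Longrightarrow> integral_curve X S {0..T} (C T) \<and> C T 0 = y" by metis
  define E where "E = {T\<in>D. \<forall>T'\<in>D. T' \<le> T}"
  have sub: "Z \<inter> forward_orbit X S y \<subseteq> (\<Union>q\<in>D \<inter> \<rat>. C q ` {t\<in>{0..q}. C q t \<in> Z}) \<union> (\<lambda>T. C T T) ` E"
  proof
    fix z assume z: "z \<in> Z \<inter> forward_orbit X S y"
    then obtain c T where c: "0 \<le> T" "integral_curve X S {0..T} c" "c 0 = y" "c T = z"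
      unfolding forward_orbit_def by blast
    then have "T \<in> D" unfolding D_def by blast
    have val: "C q T = z" if "q \<in> D" "T \<le> q" for q
      using forward_curve_unique[OF lip _ c(2), of q "C q" T] C[OF that(1)] c that by simp
    show "z \<in> (\<Union>q\<in>D \<inter> \<rat>. C q ` {t\<in>{0..q}. C q t \<in> Z}) \<union> (\<lambda>T. C T T) ` E"
    proof (cases "T \<in> E")
      case True
      then show ?thesis using val[OF \<open>T \<in> D\<close>] by force
    next
      case False
      then obtain T' where T': "T' \<in> D" "T < T'" using \<open>T \<in> D\<close> unfolding E_def by force
      then obtain q where q: "q \<in> \<rat>" "T < q" "q < T'" using Rats_dense_in_real by blast
      have "integral_curve X S {0..q} (C T')"
        using integral_curve_subset[of X S "{0..T'}"] C[OF T'(1)] q by auto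
      then have "q \<in> D" unfolding D_def using C[OF T'(1)] c(1) q(2) by auto
      moreover have "z = C q T" "T \<in> {t\<in>{0..q}. C q t \<in> Z}"
        using val[OF \<open>q \<in> D\<close>] q c(1) z by auto
      ultimately show ?thesis using q(1) by blast
    qed
  qed
  have "countable (\<Union>q\<in>D \<inter> \<rat>. C q ` {t\<in>{0..q}. C q t \<in> Z})"
    using C cnt countable_rat by (intro countable_UN countable_image) (auto simp: D_def)
  moreover have "E \<subseteq> {T}" if "T \<in> E" for T
    using that unfolding E_def by force
  then have "countable E" by (metis countable_empty countable_insert countable_subset ex_in_conv)
  ultimately have "countable ((\<Union>q\<in>D \<inter> \<rat>. C q ` {t\<in>{0..q}. C q t \<in> Z}) \<union> (\<lambda>T. C T T) ` E)"
    by simp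
  then show ?thesis by (rule countable_subset[OF sub])
qed

text \<open>The iterated derivatives at y decide: if they all vanish, flatness spreads over the
  orbit; otherwise zeros are countable along every curve from y. This dichotomy is what converts a
  count of components into a count of points.\<close>

lemma analytic_zeros_on_orbit:
  fixes f :: "real^'n::finite \<Rightarrow> real"
  assumes f: "real_analytic_on f S" and X: "analytic_field_on X S"
  shows "(\<forall>z\<in>orbit X S y. f z = 0) \<or> countable {z\<in>orbit X S y. f z = 0}"
proof (cases "\<forall>k. (lie_deriv X ^^ k) f y = 0")
  case True
  have "f z = 0" if z: "z \<in> orbit X S y" for z
  proof -
    obtain c t I where *: "is_interval I" "0 \<in> I" "t \<in> I" "c 0 = y" "c t = z" "integral_curve X S I c"
      using z unfolding mem_orbit_iff by blast
    have "(lie_deriv X ^^ 0) f (c t) = 0"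
      using flat_along_curve(1)[OF f X *(6,1,2,3)] True *(4) by blast
    then show ?thesis using *(5) by simp
  qed
  then show ?thesis by blast
next
  case False
  then obtain k where k: "(lie_deriv X ^^ k) f y \<noteq> 0" by blast
  have lip: "locally_lipschitz_on X S" using X by (rule analytic_field_locally_lipschitz)
  have cnt: "countable {t\<in>I. f (c t) = 0}" if "integral_curve X S I c" "is_interval I" "0 \<in> I" "c 0 = y" for I c
    using countable_zeros_along_curve[OF f X that(1-3)] that(4) k by blast
  let ?Z = "{z. f z = 0}"
  have "countable (?Z \<inter> forward_orbit X S y)"
  proof (rule countable_forward_orbit[OF lip])
    fix T c assume "integral_curve X S {0..T} c" "0 \<le> T" "c 0 = y"
    then have "countable {t\<in>{0..T}. f (c t) = 0}" by (intro cnt) (auto simp: is_interval_cc)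
    then show "countable {t\<in>{0..T}. c t \<in> ?Z}" by simp
  qed
  moreover have "countable (?Z \<inter> forward_orbit (\<lambda>y. - X y) S y)"
  proof (rule countable_forward_orbit[OF locally_lipschitz_on_uminus[OF lip]])
    fix T c assume c: "integral_curve (\<lambda>y. - X y) S {0..T} c" "0 \<le> T" "c 0 = y"
    have "integral_curve X S {- T..0} (\<lambda>s. c (- s))"
      using integral_curve_reverse[OF c(1)] by simp
    then have "countable {t\<in>{- T..0}. f (c (- t)) = 0}"
      using c by (intro cnt) (auto simp: is_interval_cc)
    then have "countable (uminus ` {t\<in>{- T..0}. f (c (- t)) = 0})" by (rule countable_image)
    moreover have "{t\<in>{0..T}. c t \<in> ?Z} \<subseteq> uminus ` {t\<in>{- T..0}. f (c (- t)) = 0}"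
    proof
      fix t assume "t \<in> {t\<in>{0..T}. c t \<in> ?Z}"
      then show "t \<in> uminus ` {t\<in>{- T..0}. f (c (- t)) = 0}" by (intro image_eqI[of _ _ "- t"]) auto
    qed
    ultimately show "countable {t\<in>{0..T}. c t \<in> ?Z}" by (rule countable_subset[rotated])
  qed
  moreover have "{z\<in>orbit X S y. f z = 0} = ?Z \<inter> forward_orbit X S y \<union> ?Z \<inter> forward_orbit (\<lambda>y. - X y) S y"
    using orbit_eq_forward_backward[of X S y] by blast
  ultimately show ?thesis by simp
qed

text \<open>A countable set is totally disconnected, so its components count its points.\<close>

lemma b0_countable:
  fixes Z :: "'a::metric_space set"
  assumes "countable Z" "b0 Z \<le> enat N"
  shows "finite Z \<and> card Z \<le> N"
proof -
  have "components Z = (\<lambda>z. {z}) ` Z"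
  proof -
    have "connected_component_set Z z = {z}" if "z \<in> Z" for z
    proof -
      have "countable (connected_component_set Z z)"
        using assms(1) connected_component_subset countable_subset by blast
      moreover have "z \<in> connected_component_set Z z" using that by simp
      ultimately show ?thesis
        using connected_uncountable[OF connected_connected_component] by blast
    qed
    then show ?thesis unfolding components_def by force
  qed
  moreover have "finite (components Z)" "card (components Z) \<le> N"
    using assms(2) by (auto simp: b0_def split: if_splits)
  ultimately show ?thesis
    by (simp add: card_image finite_image_iff)
qed

lemma b0_finite:
  fixes Z :: "'a::topological_space set"
  assumes "finite Z" shows "b0 Z \<le> enat (card Z)"
proof -
  have "components Z = connected_component_set Z ` Z" by (auto simp: components_def)
  then show ?thesis using assms by (simp add: b0_def card_image_le)
qed

lemma b0_connected:
  fixes Z :: "'a::topological_space set"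
  assumes "connected Z" shows "b0 Z \<le> 1"
proof (cases "Z = {}")
  case False
  then have "components Z = {Z}"
    using assms components_eq_empty[of Z] connected_eq_components_subset_sing[of Z] by blast
  then show ?thesis by (simp add: b0_def one_enat_def)
qed (simp add: b0_def one_enat_def)

subsection \<open>Local rings\<close>

text \<open>If a were not invertible, Zorn's lemma would place its principal ideal in a maximal
  ideal, which can only be M.\<close>

lemma local_ring_inverse:
  fixes R (structure)
  assumes loc: "local_ring R" and M: "maximalideal M R" and a: "a \<in> carrier R" "a \<notin> M"
  shows "\<exists>b\<in>carrier R. b \<otimes> a = \<one>"
proof (rule ccontr)
  assume no: "\<not> ?thesis"
  interpret cring R using loc unfolding local_ring_def by blast
  define \<S> where "\<S> = {I. ideal I R \<and> PIdl a \<subseteq> I \<and> \<one> \<notin> I}"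
  have "PIdl a \<in> \<S>" using no a(1) cgenideal_ideal[OF a(1)] unfolding \<S>_def cgenideal_def by force
  then have "\<S> \<noteq> {}" by blast
  then obtain J where J: "J \<in> \<S>" "\<forall>I\<in>\<S>. J \<subseteq> I \<longrightarrow> I = J"
  proof (rule subset_Zorn_nonempty[THEN bexE])
    fix C assume C: "C \<noteq> {}" "subset.chain \<S> C"
    then have "subset.chain {I. ideal I R} C" unfolding subset.chain_def \<S>_def by blast
    moreover have "C \<subseteq> \<S>" using C(2) unfolding subset.chain_def by blast
    ultimately show "\<Union>C \<in> \<S>"
      using chain_Union_is_ideal[of C] C(1) unfolding \<S>_def by (auto split: if_splits)
  qed blast
  have "maximalideal J R"
  proof (rule maximalidealI)
    show "ideal J R" using J(1) by (simp add: \<S>_def)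
    show "carrier R \<noteq> J" using J(1) one_closed unfolding \<S>_def by blast
    fix I assume I: "ideal I R" "J \<subseteq> I" "I \<subseteq> carrier R"
    show "I = J \<or> I = carrier R"
    proof (cases "\<one> \<in> I")
      case True
      then show ?thesis using ideal.one_imp_carrier[OF I(1)] by blast
    next
      case False
      then have "I \<in> \<S>" using I J(1) unfolding \<S>_def by blast
      then show ?thesis using J(2) I(2) by blast
    qed
  qed
  then have "J = M" using loc M unfolding local_ring_def by blast
  moreover have "a \<in> J" using J(1) cgenideal_self[OF a(1)] unfolding \<S>_def by blast
  ultimately show False using a(2) by blast
qed

subsection \<open>Germs\<close>

lemma mem_germ: "g \<in> germ F f \<longleftrightarrow> eventually (\<lambda>y. g y = f y) F"
  by (simp add: germ_def)

lemma germ_self: "f \<in> germ F f"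
  by (simp add: mem_germ)

lemma germ_eq_iff: "germ F f = germ F g \<longleftrightarrow> eventually (\<lambda>y. f y = g y) F"
proof
  assume "germ F f = germ F g"
  then show "eventually (\<lambda>y. f y = g y) F" using germ_self[of f F] by (simp add: mem_germ)
next
  assume *: "eventually (\<lambda>y. f y = g y) F"
  show "germ F f = germ F g"
    unfolding germ_def
  proof (intro Collect_cong iffI)
    fix h
    show "eventually (\<lambda>y. h y = g y) F" if "eventually (\<lambda>y. h y = f y) F"
      using that * by eventually_elim simp
    show "eventually (\<lambda>y. h y = f y) F" if "eventually (\<lambda>y. h y = g y) F"
      using that * by eventually_elim simp
  qed
qed

lemma germ_eq_of_mem: "f \<in> germ F g \<Longrightarrow> germ F f = germ F g"
  by (simp add: germ_eq_iff mem_germ)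

lemma germ_mult: "germ F f \<otimes>\<^bsub>germ_ring F\<^esub> germ F g = germ F (\<lambda>y. f y * g y)"
proof -
  have "(\<exists>f'\<in>germ F f. \<exists>g'\<in>germ F g. eventually (\<lambda>y. h y = f' y * g' y) F) \<longleftrightarrow>
     eventually (\<lambda>y. h y = f y * g y) F" for h
  proof
    assume "\<exists>f'\<in>germ F f. \<exists>g'\<in>germ F g. eventually (\<lambda>y. h y = f' y * g' y) F"
    then obtain f' g' where "eventually (\<lambda>y. f' y = f y) F" "eventually (\<lambda>y. g' y = g y) F"
      "eventually (\<lambda>y. h y = f' y * g' y) F" by (auto simp: mem_germ)
    then show "eventually (\<lambda>y. h y = f y * g y) F" by eventually_elim simp
  qed (use germ_self in blast)
  then show ?thesis by (simp add: germ_ring_def germ_def[of F "\<lambda>y. f y * g y"])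
qed

lemma germ_add: "germ F f \<oplus>\<^bsub>germ_ring F\<^esub> germ F g = germ F (\<lambda>y. f y + g y)"
proof -
  have "(\<exists>f'\<in>germ F f. \<exists>g'\<in>germ F g. eventually (\<lambda>y. h y = f' y + g' y) F) \<longleftrightarrow>
     eventually (\<lambda>y. h y = f y + g y) F" for h
  proof
    assume "\<exists>f'\<in>germ F f. \<exists>g'\<in>germ F g. eventually (\<lambda>y. h y = f' y + g' y) F"
    then obtain f' g' where "eventually (\<lambda>y. f' y = f y) F" "eventually (\<lambda>y. g' y = g y) F"
      "eventually (\<lambda>y. h y = f' y + g' y) F" by (auto simp: mem_germ)
    then show "eventually (\<lambda>y. h y = f y + g y) F" by eventually_elim simp
  qed (use germ_self in blast)
  then show ?thesis by (simp add: germ_ring_def germ_def[of F "\<lambda>y. f y + g y"])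
qed

lemma germ_one: "\<one>\<^bsub>germ_ring F\<^esub> = germ F (\<lambda>_. 1)"
  and germ_zero: "\<zero>\<^bsub>germ_ring F\<^esub> = germ F (\<lambda>_. 0)"
  and germ_carrier: "carrier (germ_ring F) = range (germ F)"
  by (simp_all add: germ_ring_def)

lemmas germ_ops = germ_mult germ_add germ_one germ_zero germ_carrier

lemma restr_germ:
  assumes "near0 S \<le> F"
  shows "restr S (germ F f) = germ (near0 S) f"
proof -
  have "(\<exists>f'\<in>germ F f. eventually (\<lambda>y. h y = f' y) (near0 S)) \<longleftrightarrow> eventually (\<lambda>y. h y = f y) (near0 S)" for h
  proof
    assume "\<exists>f'\<in>germ F f. eventually (\<lambda>y. h y = f' y) (near0 S)"
    then obtain f' where "eventually (\<lambda>y. f' y = f y) F" "eventually (\<lambda>y. h y = f' y) (near0 S)"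
      by (auto simp: mem_germ)
    with assms have "eventually (\<lambda>y. f' y = f y) (near0 S)" "eventually (\<lambda>y. h y = f' y) (near0 S)"
      by (auto simp: le_filter_def)
    then show "eventually (\<lambda>y. h y = f y) (near0 S)" by eventually_elim simp
  qed (use germ_self in blast)
  then show ?thesis by (simp add: restr_def germ_def[of "near0 S"])
qed

lemma near0_mono: "S \<subseteq> T \<Longrightarrow> near0 S \<le> near0 T"
  unfolding near0_def by (intro inf_mono) auto

lemma eventually_near0:
  "eventually P (near0 S) \<longleftrightarrow> (\<exists>V. open V \<and> 0 \<in> V \<and> (\<forall>y\<in>V \<inter> S. P y))"
  unfolding near0_def eventually_inf_principal eventually_nhds by blast

subsection \<open>Rings of functions and ideals of germs\<close>

text \<open>Germs are handled through sets of representatives: identities between germs become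
  pointwise identities that hold eventually, and the same functions can be read along several
  filters.\<close>

definition function_ring :: "('a \<Rightarrow> real) set \<Rightarrow> bool" where
  "function_ring \<B> \<longleftrightarrow> (\<lambda>_. 1) \<in> \<B> \<and> (\<forall>f\<in>\<B>. (\<lambda>y. - f y) \<in> \<B>) \<and>
     (\<forall>f\<in>\<B>. \<forall>g\<in>\<B>. (\<lambda>y. f y + g y) \<in> \<B> \<and> (\<lambda>y. f y * g y) \<in> \<B>)"

lemma function_ring_closed:
  assumes "function_ring \<B>"
  shows "(\<lambda>_. 1) \<in> \<B>" "f \<in> \<B> \<Longrightarrow> (\<lambda>y. - f y) \<in> \<B>"
    "f \<in> \<B> \<Longrightarrow> g \<in> \<B> \<Longrightarrow> (\<lambda>y. f y + g y) \<in> \<B>"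
    "f \<in> \<B> \<Longrightarrow> g \<in> \<B> \<Longrightarrow> (\<lambda>y. f y * g y) \<in> \<B>"
  using assms unfolding function_ring_def by blast+

lemma function_ring_zero:
  assumes "function_ring \<B>" shows "(\<lambda>_. 0) \<in> \<B>"
  using function_ring_closed(3)[OF assms function_ring_closed(1)[OF assms]
      function_ring_closed(2)[OF assms function_ring_closed(1)[OF assms]]] by simp

lemma function_ring_diff:
  assumes "function_ring \<B>" "f \<in> \<B>" "g \<in> \<B>" shows "(\<lambda>y. f y - g y) \<in> \<B>"
  using function_ring_closed(3)[OF assms(1,2) function_ring_closed(2)[OF assms(1,3)]] by simp

lemma function_ring_sum:
  assumes "function_ring \<B>" "\<And>i. i \<in> T \<Longrightarrow> f i \<in> \<B>"
  shows "(\<lambda>y. \<Sum>i\<in>T. f i y) \<in> \<B>"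
  using assms(2)
proof (induction T rule: infinite_finite_induct)
  case (insert i T)
  then show ?case using function_ring_closed(3)[OF assms(1)] by simp
qed (use function_ring_zero[OF assms(1)] in auto)

abbreviation germs_of :: "'a filter \<Rightarrow> ('a \<Rightarrow> real) set \<Rightarrow> ('a \<Rightarrow> real) set ring" where
  "germs_of F \<B> \<equiv> sub_ring (germ_ring F) (germ F ` \<B>)"

lemma germs_of_cring:
  assumes B: "function_ring \<B>"
  shows "cring (germs_of F \<B>)"
proof (rule cringI)
  note cl = function_ring_closed[OF B] function_ring_zero[OF B]
  show "abelian_group (germs_of F \<B>)"
  proof (rule abelian_groupI)
    fix x assume "x \<in> carrier (germs_of F \<B>)"
    then obtain f where f: "f \<in> \<B>" "x = germ F f" by auto
    have "germ F (\<lambda>y. - f y) \<oplus>\<^bsub>germs_of F \<B>\<^esub> x = \<zero>\<^bsub>germs_of F \<B>\<^esub>"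
      by (simp add: f germ_ops)
    then show "\<exists>y\<in>carrier (germs_of F \<B>). y \<oplus>\<^bsub>germs_of F \<B>\<^esub> x = \<zero>\<^bsub>germs_of F \<B>\<^esub>"
      using cl(2)[OF f(1)] by auto
  qed (auto simp: germ_ops add_ac intro!: imageI cl)
  show "comm_monoid (germs_of F \<B>)"
    by (rule comm_monoidI) (auto simp: germ_ops mult_ac intro!: imageI cl)
qed (auto simp: germ_ops distrib_right)

lemma ideal_germsI:
  assumes B: "function_ring \<B>" and I: "I \<subseteq> germ F ` \<B>" "germ F (\<lambda>_. 0) \<in> I"
    and add: "\<And>f g. germ F f \<in> I \<Longrightarrow> germ F g \<in> I \<Longrightarrow> germ F (\<lambda>y. f y + g y) \<in> I"
    and mult: "\<And>b f. b \<in> \<B> \<Longrightarrow> germ F f \<in> I \<Longrightarrow> germ F (\<lambda>y. b y * f y) \<in> I"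
  shows "ideal I (germs_of F \<B>)"
proof -
  interpret cring "germs_of F \<B>" by (rule germs_of_cring[OF B])
  have rep: "\<exists>f. x = germ F f" if "x \<in> I" for x using that I(1) by blast
  show ?thesis
  proof (rule idealI)
    show "ring (germs_of F \<B>)" by (rule ring_axioms)
    show "subgroup I (add_monoid (germs_of F \<B>))"
    proof (rule add.subgroupI)
      show "I \<subseteq> carrier (germs_of F \<B>)" "I \<noteq> {}" using I by auto
      show "x \<oplus>\<^bsub>germs_of F \<B>\<^esub> y \<in> I" if "x \<in> I" "y \<in> I" for x y
        using that rep[OF that(1)] rep[OF that(2)] add by (auto simp: germ_ops)
      fix x assume x: "x \<in> I"
      then obtain f where f: "x = germ F f" "f \<in> \<B>" using I(1) by blast
      have "germ F (\<lambda>y. - 1 * f y) \<in> I"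
        using x f(1) by (intro mult function_ring_closed[OF B]) auto
      moreover have "\<ominus>\<^bsub>germs_of F \<B>\<^esub> x = germ F (\<lambda>y. - 1 * f y)"
        by (rule minus_equality) (use f function_ring_closed(2)[OF B f(2)] in \<open>auto simp: germ_ops\<close>)
      ultimately show "\<ominus>\<^bsub>germs_of F \<B>\<^esub> x \<in> I" by simp
    qed
    fix a x assume "a \<in> I" "x \<in> carrier (germs_of F \<B>)"
    then obtain f g where "a = germ F f" "x = germ F g" "g \<in> \<B>" "germ F f \<in> I" using I(1) by auto
    then show "x \<otimes>\<^bsub>germs_of F \<B>\<^esub> a \<in> I" "a \<otimes>\<^bsub>germs_of F \<B>\<^esub> x \<in> I"
      using mult[of g f] by (simp_all add: germ_ops mult.commute)
  qed
qed

lemma ideal_germsD: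
  assumes "ideal I (germs_of F \<B>)"
  shows "germ F (\<lambda>_. 0) \<in> I" "I \<subseteq> germ F ` \<B>"
    "\<And>f g. germ F f \<in> I \<Longrightarrow> germ F g \<in> I \<Longrightarrow> germ F (\<lambda>y. f y + g y) \<in> I"
    "\<And>b f. b \<in> \<B> \<Longrightarrow> germ F f \<in> I \<Longrightarrow> germ F (\<lambda>y. b y * f y) \<in> I"
proof -
  interpret ideal I "germs_of F \<B>" by (rule assms)
  show "germ F (\<lambda>_. 0) \<in> I"
    using additive_subgroup.zero_closed[OF ideal.axioms(1)[OF assms]] by (simp add: germ_ops)
  show "I \<subseteq> germ F ` \<B>" using a_subset by simp
  show "germ F (\<lambda>y. f y + g y) \<in> I" if "germ F f \<in> I" "germ F g \<in> I" for f g
    using additive_subgroup.a_closed[OF ideal.axioms(1)[OF assms] that] by (simp add: germ_ops)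
  show "germ F (\<lambda>y. b y * f y) \<in> I" if "b \<in> \<B>" "germ F f \<in> I" for b f
    using I_l_closed[OF that(2), of "germ F b"] that(1) by (simp add: germ_ops)
qed

section \<open>Linear combinations of germs, generated ideals and Nakayama's lemma\<close>

text \<open>The filter may be finer than the one along which \<B> represents a ring of germs. Along
  \<open>near0 W\<close> the relation holds only on W, while the coefficients remain functions on
  the quadrant, which can be differentiated.\<close>

definition spanned :: "'a filter \<Rightarrow> ('a \<Rightarrow> real) set \<Rightarrow> ('i \<Rightarrow> 'a \<Rightarrow> real) \<Rightarrow> 'i set \<Rightarrow> ('a \<Rightarrow> real) \<Rightarrow> bool" where
  "spanned F \<B> e T f \<longleftrightarrow>
     (\<exists>b. (\<forall>i\<in>T. b i \<in> \<B>) \<and> eventually (\<lambda>y. f y = (\<Sum>i\<in>T. b i y * e i y)) F)"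

lemma spanned_cong:
  assumes "spanned F \<B> e T f" "eventually (\<lambda>y. g y = f y) F"
  shows "spanned F \<B> e T g"
proof -
  obtain b where b: "\<forall>i\<in>T. b i \<in> \<B>" "eventually (\<lambda>y. f y = (\<Sum>i\<in>T. b i y * e i y)) F"
    using assms(1) unfolding spanned_def by blast
  have "eventually (\<lambda>y. g y = (\<Sum>i\<in>T. b i y * e i y)) F"
    using b(2) assms(2) by eventually_elim simp
  then show ?thesis unfolding spanned_def using b(1) by blast
qed

lemma spanned_le: "spanned F \<B> e T f \<Longrightarrow> G \<le> F \<Longrightarrow> spanned G \<B> e T f"
  unfolding spanned_def le_filter_def by blast

text \<open>Such a set serves as the range of the coefficients in \<open>spanned\<close>, so that
  membership in the product of an ideal with a differential ideal is again a statement about linear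
  combinations.\<close>

definition function_ideal :: "('a \<Rightarrow> real) set \<Rightarrow> ('a \<Rightarrow> real) set \<Rightarrow> bool" where
  "function_ideal \<B> \<M> \<longleftrightarrow> \<M> \<subseteq> \<B> \<and> (\<lambda>_. 0) \<in> \<M> \<and>
     (\<forall>a\<in>\<M>. \<forall>b\<in>\<M>. (\<lambda>y. a y + b y) \<in> \<M>) \<and> (\<forall>a\<in>\<B>. \<forall>b\<in>\<M>. (\<lambda>y. a y * b y) \<in> \<M>)"

lemma function_ideal_closed:
  assumes "function_ideal \<B> \<M>"
  shows "\<M> \<subseteq> \<B>" "(\<lambda>_. 0) \<in> \<M>" "a \<in> \<M> \<Longrightarrow> b \<in> \<M> \<Longrightarrow> (\<lambda>y. a y + b y) \<in> \<M>"
    "c \<in> \<B> \<Longrightarrow> b \<in> \<M> \<Longrightarrow> (\<lambda>y. c y * b y) \<in> \<M>"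
  using assms unfolding function_ideal_def by blast+

lemma function_ring_ideal: "function_ring \<B> \<Longrightarrow> function_ideal \<B> \<B>"
  unfolding function_ideal_def using function_ring_closed function_ring_zero by blast

lemma spanned_subset: "spanned F \<M> e T f \<Longrightarrow> \<M> \<subseteq> \<B> \<Longrightarrow> spanned F \<B> e T f"
  unfolding spanned_def by blast

lemma spanned_ideal_zero: "function_ideal \<B> \<M> \<Longrightarrow> spanned F \<M> e T (\<lambda>_. 0)"
  unfolding spanned_def by (rule exI[of _ "\<lambda>_ _. 0"]) (simp add: function_ideal_closed(2))

lemma spanned_ideal_add:
  assumes M: "function_ideal \<B> \<M>" and "spanned F \<M> e T f" "spanned F \<M> e T g"
  shows "spanned F \<M> e T (\<lambda>y. f y + g y)"
proof -
  obtain b where b: "\<forall>i\<in>T. b i \<in> \<M>" "eventually (\<lambda>y. f y = (\<Sum>i\<in>T. b i y * e i y)) F"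
    using assms(2) unfolding spanned_def by blast
  obtain c where c: "\<forall>i\<in>T. c i \<in> \<M>" "eventually (\<lambda>y. g y = (\<Sum>i\<in>T. c i y * e i y)) F"
    using assms(3) unfolding spanned_def by blast
  have "eventually (\<lambda>y. f y + g y = (\<Sum>i\<in>T. (b i y + c i y) * e i y)) F"
    using b(2) c(2) by eventually_elim (simp add: distrib_right sum.distrib)
  then show ?thesis
    unfolding spanned_def using b(1) c(1) function_ideal_closed(3)[OF M]
    by (intro exI[of _ "\<lambda>i y. b i y + c i y"]) auto
qed

lemma spanned_ideal_mult:
  assumes M: "function_ideal \<B> \<M>" and "m \<in> \<M>" "spanned F \<B> e T f"
  shows "spanned F \<M> e T (\<lambda>y. m y * f y)"
proof -
  obtain b where b: "\<forall>i\<in>T. b i \<in> \<B>" "eventually (\<lambda>y. f y = (\<Sum>i\<in>T. b i y * e i y)) F"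
    using assms(3) unfolding spanned_def by blast
  have "eventually (\<lambda>y. m y * f y = (\<Sum>i\<in>T. (b i y * m y) * e i y)) F"
    using b(2) by eventually_elim (simp add: sum_distrib_left mult_ac)
  then show ?thesis
    unfolding spanned_def using b(1) assms(2) function_ideal_closed(4)[OF M]
    by (intro exI[of _ "\<lambda>i y. b i y * m y"]) auto
qed

lemma spanned_ideal_sum:
  assumes M: "function_ideal \<B> \<M>" and "\<And>i. i \<in> I \<Longrightarrow> spanned F \<M> e T (f i)"
  shows "spanned F \<M> e T (\<lambda>y. \<Sum>i\<in>I. f i y)"
  using assms(2)
proof (induction I rule: infinite_finite_induct)
  case (insert i I)
  have "spanned F \<M> e T (\<lambda>y. f i y + (\<Sum>i\<in>I. f i y))"
    using insert by (intro spanned_ideal_add[OF M]) auto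
  then show ?case using insert.hyps by simp
qed (use spanned_ideal_zero[OF M] in auto)

lemma spanned_ideal_trans:
  assumes M: "function_ideal \<B> \<M>" and s: "spanned F \<M> e T f"
    and e: "\<And>i. i \<in> T \<Longrightarrow> spanned F \<B> e' T' (e i)"
  shows "spanned F \<M> e' T' f"
proof -
  obtain m where m: "\<forall>i\<in>T. m i \<in> \<M>" "eventually (\<lambda>y. f y = (\<Sum>i\<in>T. m i y * e i y)) F"
    using s unfolding spanned_def by blast
  have "spanned F \<M> e' T' (\<lambda>y. \<Sum>i\<in>T. m i y * e i y)"
    using m(1) e by (intro spanned_ideal_sum[OF M] spanned_ideal_mult[OF M]) auto
  then show ?thesis by (rule spanned_cong) (rule m(2))
qed

lemmas spanned_zero = spanned_ideal_zero[OF function_ring_ideal]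
  and spanned_add = spanned_ideal_add[OF function_ring_ideal]
  and spanned_sum = spanned_ideal_sum[OF function_ring_ideal]
  and spanned_trans = spanned_ideal_trans[OF function_ring_ideal]

lemma spanned_mult:
  assumes B: "function_ring \<B>" and "a \<in> \<B>" "spanned F \<B> e T f"
  shows "spanned F \<B> e T (\<lambda>y. a y * f y)"
  by (rule spanned_ideal_mult[OF function_ring_ideal[OF B] assms(2,3)])

lemma spanned_base:
  assumes B: "function_ring \<B>" and T: "finite T" "j \<in> T"
  shows "spanned F \<B> e T (e j)"
proof -
  have "(\<Sum>i\<in>T. (if i = j then 1 else 0) * e i y) = e j y" for y
    using T by (simp add: if_distrib[of "\<lambda>x. x * _"] sum.delta cong: if_cong)
  then show ?thesis
    unfolding spanned_def using function_ring_closed(1)[OF B] function_ring_zero[OF B]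
    by (intro exI[of _ "\<lambda>i y. if i = j then 1 else 0"]) auto
qed

lemma spanned_mono:
  assumes B: "function_ring \<B>" and T: "finite T'" "T \<subseteq> T'" and s: "spanned F \<B> e T f"
  shows "spanned F \<B> e T' f"
proof -
  obtain b where b: "\<forall>i\<in>T. b i \<in> \<B>" "eventually (\<lambda>y. f y = (\<Sum>i\<in>T. b i y * e i y)) F"
    using s unfolding spanned_def by blast
  have "spanned F \<B> e T' (\<lambda>y. \<Sum>i\<in>T. b i y * e i y)"
    using b(1) T by (intro spanned_sum spanned_mult spanned_base B) auto
  then show ?thesis by (rule spanned_cong) (rule b(2))
qed

text \<open>Germs of finite linear combinations form an ideal that contains the generators and lies
  in every ideal containing them. The index set A may be infinite, as it is for all iterated
  derivatives of a germ.\<close>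

lemma genideal_germs:
  assumes B: "function_ring \<B>" and e: "\<And>i. i \<in> A \<Longrightarrow> e i \<in> \<B>"
  shows "germ F f \<in> Idl\<^bsub>germs_of F \<B>\<^esub> ((\<lambda>i. germ F (e i)) ` A) \<longleftrightarrow>
    (\<exists>T\<subseteq>A. finite T \<and> spanned F \<B> e T f)"
proof -
  interpret cring "germs_of F \<B>" by (rule germs_of_cring[OF B])
  let ?G = "(\<lambda>i. germ F (e i)) ` A"
  have G: "?G \<subseteq> carrier (germs_of F \<B>)" using e by auto
  define I where "I = {germ F f | f. \<exists>T\<subseteq>A. finite T \<and> spanned F \<B> e T f}"
  have I_iff: "germ F f \<in> I \<longleftrightarrow> (\<exists>T\<subseteq>A. finite T \<and> spanned F \<B> e T f)" for f
  proof
    assume "germ F f \<in> I"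
    then obtain f' T where "germ F f = germ F f'" "T \<subseteq> A" "finite T" "spanned F \<B> e T f'"
      unfolding I_def by blast
    moreover from this(1) have "eventually (\<lambda>y. f y = f' y) F" by (simp add: germ_eq_iff)
    ultimately show "\<exists>T\<subseteq>A. finite T \<and> spanned F \<B> e T f"
      using spanned_cong by metis
  qed (auto simp: I_def)
  have I: "ideal I (germs_of F \<B>)"
  proof (rule ideal_germsI[OF B])
    show "I \<subseteq> germ F ` \<B>"
    proof
      fix x assume "x \<in> I"
      then obtain f T where f: "x = germ F f" "T \<subseteq> A" "finite T" "spanned F \<B> e T f"
        unfolding I_def by blast
      then obtain b where b: "\<forall>i\<in>T. b i \<in> \<B>" "eventually (\<lambda>y. f y = (\<Sum>i\<in>T. b i y * e i y)) F"
        unfolding spanned_def by blast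
      then have "x = germ F (\<lambda>y. \<Sum>i\<in>T. b i y * e i y)" using f(1) by (simp add: germ_eq_iff)
      moreover have "(\<lambda>y. \<Sum>i\<in>T. b i y * e i y) \<in> \<B>"
        using b(1) f(2) e by (intro function_ring_sum function_ring_closed(4) B) auto
      ultimately show "x \<in> germ F ` \<B>" by blast
    qed
    show "germ F (\<lambda>_. 0) \<in> I" unfolding I_iff using spanned_zero[OF B] by blast
    show "germ F (\<lambda>y. f y + g y) \<in> I" if fg: "germ F f \<in> I" "germ F g \<in> I" for f g
    proof -
      obtain T T' where T: "T \<subseteq> A" "finite T" "spanned F \<B> e T f" "T' \<subseteq> A" "finite T'" "spanned F \<B> e T' g"
        using fg unfolding I_iff by blast
      have "spanned F \<B> e (T \<union> T') (\<lambda>y. f y + g y)"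
        by (intro spanned_add[OF B] spanned_mono[OF B _ _ T(3)] spanned_mono[OF B _ _ T(6)]) (use T in auto)
      then show ?thesis unfolding I_iff using T by blast
    qed
    show "germ F (\<lambda>y. b y * f y) \<in> I" if "b \<in> \<B>" "germ F f \<in> I" for b f
      using that spanned_mult[OF B] unfolding I_iff by blast
  qed
  have "?G \<subseteq> I"
  proof
    fix x assume "x \<in> ?G"
    then obtain i where "i \<in> A" "x = germ F (e i)" by blast
    then show "x \<in> I" using I_iff spanned_base[OF B, of "{i}" i F e] by blast
  qed
  then have sub: "Idl\<^bsub>germs_of F \<B>\<^esub> ?G \<subseteq> I" using I by (rule genideal_minimal[rotated])
  have id: "ideal (Idl\<^bsub>germs_of F \<B>\<^esub> ?G) (germs_of F \<B>)" by (rule genideal_ideal[OF G])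
  note idl = ideal_germsD[OF id]
  have "germ F f \<in> Idl\<^bsub>germs_of F \<B>\<^esub> ?G" if T: "T \<subseteq> A" "finite T" and s: "spanned F \<B> e T f" for T
  proof -
    obtain b where b: "\<forall>i\<in>T. b i \<in> \<B>" "eventually (\<lambda>y. f y = (\<Sum>i\<in>T. b i y * e i y)) F"
      using s unfolding spanned_def by blast
    have "germ F (\<lambda>y. \<Sum>i\<in>T. b i y * e i y) \<in> Idl\<^bsub>germs_of F \<B>\<^esub> ?G"
      using T(2,1) b(1)
    proof (induction T rule: finite_induct)
      case empty then show ?case using idl(1) by simp
    next
      case (insert i T)
      have "germ F (e i) \<in> Idl\<^bsub>germs_of F \<B>\<^esub> ?G" using genideal_self[OF G] insert.prems by blast
      then have "germ F (\<lambda>y. b i y * e i y) \<in> Idl\<^bsub>germs_of F \<B>\<^esub> ?G"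
        using insert.prems by (intro idl(4)) auto
      then have "germ F (\<lambda>y. b i y * e i y + (\<Sum>i\<in>T. b i y * e i y)) \<in> Idl\<^bsub>germs_of F \<B>\<^esub> ?G"
        using insert by (intro idl(3)) auto
      then show ?case using insert.hyps by simp
    qed
    moreover have "germ F f = germ F (\<lambda>y. \<Sum>i\<in>T. b i y * e i y)" using b(2) by (simp add: germ_eq_iff)
    ultimately show ?thesis by simp
  qed
  then show ?thesis using sub I_iff by blast
qed

text \<open>Nakayama's lemma, by elimination of one generator at a time.\<close>

lemma nakayama_spanned:
  fixes n k :: nat
  assumes B: "function_ring \<B>" and \<M>: "\<M> \<subseteq> \<B>"
    and M_add: "\<And>a b. a \<in> \<M> \<Longrightarrow> b \<in> \<M> \<Longrightarrow> (\<lambda>y. a y + b y) \<in> \<M>"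
    and M_mult: "\<And>a b. a \<in> \<B> \<Longrightarrow> b \<in> \<M> \<Longrightarrow> (\<lambda>y. a y * b y) \<in> \<M>"
    and unit: "\<And>a. a \<in> \<M> \<Longrightarrow> \<exists>u\<in>\<B>. eventually (\<lambda>y. u y * (1 - a y) = 1) F"
    and f: "\<And>k. k < n \<Longrightarrow> spanned F \<B> e' T (f k)"
    and m: "\<And>k i. k < n \<Longrightarrow> i < n \<Longrightarrow> m k i \<in> \<M>"
    and eq: "\<And>k. k < n \<Longrightarrow> eventually (\<lambda>y. e k y = f k y + (\<Sum>i<n. m k i y * e i y)) F"
    and k: "k < n"
  shows "spanned F \<B> e' T (e k)"
  using f m eq k
proof (induction n arbitrary: f m k)
  case (Suc n)
  obtain u where u: "u \<in> \<B>" "eventually (\<lambda>y. u y * (1 - m n n y) = 1) F"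
    using unit[of "m n n"] Suc.prems(2) by blast
  have en: "eventually (\<lambda>y. e n y = u y * f n y + (\<Sum>i<n. u y * m n i y * e i y)) F"
    using u(2) Suc.prems(3)[of n, simplified]
  proof eventually_elim
    case (elim y)
    from elim(2) have "(1 - m n n y) * e n y = f n y + (\<Sum>i<n. m n i y * e i y)" by (simp add: algebra_simps)
    then have "u y * ((1 - m n n y) * e n y) = u y * f n y + (\<Sum>i<n. u y * m n i y * e i y)"
      by (simp add: distrib_left sum_distrib_left mult.assoc)
    then show ?case using elim(1) by (simp add: mult.assoc[symmetric])
  qed
  have IH: "spanned F \<B> e' T (e k)" if k: "k < n" for k
  \<comment> \<open>Substituting the solved last equation into the others changes the coefficients
    by products that again lie in the ideal, so the system keeps its shape with one unknown
    fewer.\<close>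
  proof (rule Suc.IH[where f = "\<lambda>k y. f k y + m k n y * (u y * f n y)"
        and m = "\<lambda>k i y. m k i y + m k n y * (u y * m n i y)"])
    show "spanned F \<B> e' T (\<lambda>y. f k y + m k n y * (u y * f n y))" if "k < n" for k
      using that Suc.prems(1)[of k] Suc.prems(1)[of n] Suc.prems(2)[of k n] \<M> u(1)
      by (intro spanned_add spanned_mult B) auto
    show "(\<lambda>y. m k i y + m k n y * (u y * m n i y)) \<in> \<M>" if "k < n" "i < n" for k i
      using that Suc.prems(2) u(1) \<M> by (intro M_add M_mult) (auto simp: subset_iff)
    show "eventually (\<lambda>y. e k y = f k y + m k n y * (u y * f n y)
        + (\<Sum>i<n. (m k i y + m k n y * (u y * m n i y)) * e i y)) F" if "k < n" for k
      using Suc.prems(3)[OF less_SucI[OF that]] en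
    proof eventually_elim
      case (elim y)
      have "e k y = f k y + ((\<Sum>i<n. m k i y * e i y) + m k n y * e n y)" using elim(1) by simp
      also have "\<dots> = f k y + ((\<Sum>i<n. m k i y * e i y) + m k n y * (u y * f n y + (\<Sum>i<n. u y * m n i y * e i y)))"
        by (subst elim(2)) simp
      finally show ?case by (simp add: sum.distrib distrib_left distrib_right sum_distrib_left mult.assoc add_ac)
    qed
  qed (rule k)
  show ?case
  proof (cases "k = n")
    case True
    have "spanned F \<B> e' T (\<lambda>y. u y * f n y + (\<Sum>i<n. u y * m n i y * e i y))"
      using Suc.prems(1)[of n] Suc.prems(2) \<M> u(1) IH
      by (intro spanned_add spanned_mult spanned_sum function_ring_closed(4) B) (auto simp: subset_iff)
    then show ?thesis unfolding True by (rule spanned_cong) (rule en)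
  next
    case False
    then show ?thesis using IH Suc.prems(4) by simp
  qed
qed simp

section \<open>Representatives, derivatives of germs and small corners\<close>

definition germ_reps :: "'a filter \<Rightarrow> ('a \<Rightarrow> real) set set \<Rightarrow> ('a \<Rightarrow> real) set" where
  "germ_reps F C = {f. germ F f \<in> C}"

lemma mem_germ_reps: "f \<in> germ_reps F C \<longleftrightarrow> germ F f \<in> C"
  by (simp add: germ_reps_def)

lemma germ_image_reps: "C \<subseteq> range (germ F) \<Longrightarrow> germ F ` germ_reps F C = C"
  by (auto simp: germ_reps_def)

lemma germ_ring_cring: "cring (germ_ring F)"
proof -
  have "function_ring UNIV" by (simp add: function_ring_def)
  from germs_of_cring[OF this, of F] show ?thesis by (simp add: germ_carrier[symmetric])
qed

lemma germ_uminus: "\<ominus>\<^bsub>germ_ring F\<^esub> germ F f = germ F (\<lambda>y. - f y)"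
proof -
  interpret cring "germ_ring F" by (rule germ_ring_cring)
  show ?thesis by (rule minus_equality) (auto simp: germ_ops)
qed

lemma function_ring_reps:
  assumes "subring C (germ_ring F)"
  shows "function_ring (germ_reps F C)"
  unfolding function_ring_def mem_germ_reps
proof (intro conjI ballI)
  show "germ F (\<lambda>_. 1) \<in> C" using subringE(3)[OF assms] by (simp add: germ_one)
  show "germ F (\<lambda>y. - f y) \<in> C" if "f \<in> germ_reps F C" for f
    using subringE(5)[OF assms, of "germ F f"] that by (simp add: germ_uminus mem_germ_reps)
  fix f g assume "f \<in> germ_reps F C" "g \<in> germ_reps F C"
  then have *: "germ F f \<in> C" "germ F g \<in> C" by (simp_all add: mem_germ_reps)
  show "germ F (\<lambda>y. f y + g y) \<in> C" using subringE(7)[OF assms *] by (simp add: germ_add)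
  show "germ F (\<lambda>y. f y * g y) \<in> C" using subringE(6)[OF assms *] by (simp add: germ_mult)
qed

lemma germ_finsum:
  assumes "finite I"
  shows "(\<Oplus>\<^bsub>germ_ring F\<^esub> i\<in>I. germ F (f i)) = germ F (\<lambda>y. \<Sum>i\<in>I. f i y)"
proof -
  interpret cring "germ_ring F" by (rule germ_ring_cring)
  show ?thesis using assms
  proof (induction I rule: finite_induct)
    case (insert i I)
    then show ?case by (subst finsum_insert) (auto simp: germ_carrier germ_add)
  qed (simp add: germ_zero)
qed

lemma open_quadrant: "open (quadrant P :: (real^'n::finite) set)"
proof -
  have "quadrant P = (\<Inter>i\<in>P. {y :: real^'n. 0 < y $ i})" by (auto simp: quadrant_def)
  then show ?thesis by (auto intro!: open_INT open_Collect_less continuous_intros)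
qed

lemma frechet_derivative_cong_open:
  assumes "open U" "y \<in> U" "\<And>z. z \<in> U \<Longrightarrow> f z = g z"
  shows "frechet_derivative f (at y) = frechet_derivative g (at y)"
proof -
  have "(f has_derivative f') (at y) \<longleftrightarrow> (g has_derivative f') (at y)" for f'
    using has_derivative_transform_within_open[of f f' y UNIV U g]
      has_derivative_transform_within_open[of g f' y UNIV U f] assms by auto
  then show ?thesis by (simp add: frechet_derivative_def)
qed

lemma eventually_near0_ball:
  fixes S :: "'a::real_normed_vector set"
  shows "eventually Q (near0 S) \<longleftrightarrow> (\<exists>r>0. \<forall>y\<in>S \<inter> ball 0 r. Q y)"
proof
  assume "eventually Q (near0 S)"
  then obtain V where V: "open V" "0 \<in> V" "\<forall>y\<in>V \<inter> S. Q y" by (auto simp: eventually_near0)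
  then obtain r where "0 < r" "ball 0 r \<subseteq> V" using open_contains_ball by blast
  then show "\<exists>r>0. \<forall>y\<in>S \<inter> ball 0 r. Q y" using V(3) by blast
next
  assume "\<exists>r>0. \<forall>y\<in>S \<inter> ball 0 r. Q y"
  then obtain r where "0 < r" "\<forall>y\<in>S \<inter> ball 0 r. Q y" by blast
  then show "eventually Q (near0 S)"
    unfolding eventually_near0 by (intro exI[of _ "ball 0 r"]) auto
qed

text \<open>The quadrant is open, so a property valid on it near 0 holds around each of its points
  close to 0. This makes derivatives of germs independent of the representative.\<close>

lemma eventually_quadrant_nhd:
  fixes Q :: "real^'n::finite \<Rightarrow> bool"
  assumes "eventually Q (near0 (quadrant P))"
  shows "eventually (\<lambda>y. \<exists>U. open U \<and> y \<in> U \<and> (\<forall>z\<in>U. Q z)) (near0 (quadrant P))"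
proof -
  obtain r where r: "r > 0" "\<forall>y\<in>quadrant P \<inter> ball 0 r. Q y"
    using assms by (auto simp: eventually_near0_ball)
  show ?thesis unfolding eventually_near0_ball
    by (rule exI[of _ r]) (use r open_quadrant[of P] in \<open>auto intro!: exI[of _ "quadrant P \<inter> ball 0 r"]\<close>)
qed

lemma germ_pd_germ: "germ_pd P j (qgerm P f) = qgerm P (\<lambda>y. frechet_derivative f (at y) (axis j 1))"
proof -
  have "(\<exists>f'\<in>qgerm P f. eventually (\<lambda>y. h y = frechet_derivative f' (at y) (axis j 1)) (near0 (quadrant P)))
    \<longleftrightarrow> eventually (\<lambda>y. h y = frechet_derivative f (at y) (axis j 1)) (near0 (quadrant P))" for h
  proof
    assume "\<exists>f'\<in>qgerm P f. eventually (\<lambda>y. h y = frechet_derivative f' (at y) (axis j 1)) (near0 (quadrant P))"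
    then obtain f' where f': "eventually (\<lambda>y. f' y = f y) (near0 (quadrant P))"
      and h: "eventually (\<lambda>y. h y = frechet_derivative f' (at y) (axis j 1)) (near0 (quadrant P))"
      by (auto simp: mem_germ)
    show "eventually (\<lambda>y. h y = frechet_derivative f (at y) (axis j 1)) (near0 (quadrant P))"
      using eventually_quadrant_nhd[OF f'] h
    proof eventually_elim
      case (elim y)
      then obtain U where U: "open U" "y \<in> U" "\<And>z. z \<in> U \<Longrightarrow> f' z = f z" by blast
      show ?case using elim(2) frechet_derivative_cong_open[OF U] by simp
    qed
  qed (use germ_self in blast)
  then show ?thesis by (simp add: germ_pd_def germ_def[of _ "\<lambda>y. frechet_derivative f (at y) (axis j 1)"])
qed

text \<open>A basis of the neighbourhoods of 0 in the quadrant; finitely many local requirements are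
  met together by taking the smallest radius.\<close>

abbreviation corner :: "'n set \<Rightarrow> real \<Rightarrow> (real^'n::finite) set" where
  "corner P r \<equiv> quadrant P \<inter> ball 0 r"

text \<open>All clauses pass to subsets directly except the last one, on boundary orbits: an orbit
  in the smaller closure lies in an orbit of the larger closure, hence in the boundary.\<close>

lemma admissible_corner:
  assumes adm: "admissible P \<xi> U X"
  obtains r0 where "0 < r0" "corner P r0 \<subseteq> U" "\<And>r. 0 < r \<Longrightarrow> r \<le> r0 \<Longrightarrow> admissible P \<xi> (corner P r) X"
proof -
  obtain V where V: "open V" "0 \<in> V" "U = quadrant P \<inter> V" using adm unfolding admissible_def by blast
  then obtain r0 where r0: "0 < r0" "ball 0 r0 \<subseteq> V" using open_contains_ball by blast
  show thesis
  proof (rule that[OF r0(1)])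
    show "corner P r0 \<subseteq> U" using r0 V by blast
    fix r :: real assume r: "0 < r" "r \<le> r0"
    then have sub: "corner P r \<subseteq> U" using r0 V by auto
    then have cl: "closure (corner P r) \<subseteq> closure U" by (rule closure_mono)
    show "admissible P \<xi> (corner P r) X"
      unfolding admissible_def
    proof (intro conjI allI)
      show "\<exists>V. open V \<and> 0 \<in> V \<and> corner P r = quadrant P \<inter> V"
        using r by (intro exI[of _ "ball 0 r"]) simp
      show "(\<lambda>y. X y $ j) \<in> \<xi> j" for j using adm unfolding admissible_def by blast
      show "real_analytic_on (\<lambda>y. X y $ j) (corner P r)" for j
        using adm sub unfolding admissible_def real_analytic_on_def by blast
      show "continuous_on (closure (corner P r)) X"
        using adm cl unfolding admissible_def by (meson continuous_on_subset)
      show "{y \<in> closure (corner P r). X y = 0} \<subseteq> bdry P \<inter> closure (corner P r)"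
        using adm cl unfolding admissible_def by blast
      have "union_of_orbits X (closure U) (bdry P \<inter> closure U)"
        using adm unfolding admissible_def by blast
      then have "orbit X (closure (corner P r)) y \<subseteq> bdry P \<inter> closure (corner P r)"
        if "y \<in> bdry P \<inter> closure (corner P r)" for y
        using union_of_orbits_orbit_subset[of X "closure U" _ y] orbit_mono[OF cl, of X X y]
          orbit_subset[of X "closure (corner P r)" y] that cl by blast
      then show "union_of_orbits X (closure (corner P r)) (bdry P \<inter> closure (corner P r))"
        unfolding union_of_orbits_def using orbit_base by blast
    qed
  qed
qed

section \<open>A reference ring with one representative of the vector field\<close>

text \<open>One field X on one admissible set is fixed. Any other admissible field for \<xi> agrees
  with X on a small corner, by \<open>fields_agree\<close>, so X can be used with the data supplied
  by every hypothesis.\<close>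

locale chi_setting =
  fixes P :: "'n::finite set" and B :: "(real^'n \<Rightarrow> real) set set"
    and \<xi> :: "'n \<Rightarrow> (real^'n \<Rightarrow> real) set" and Us :: "(real^'n) set" and X :: "real^'n \<Rightarrow> real^'n"
  assumes ref: "reference_ring P B" and xi: "\<xi> \<in> Xi P B" and adm: "admissible P \<xi> Us X"
begin

abbreviation "\<Q> \<equiv> near0 (quadrant P)"
abbreviation "\<B> \<equiv> germ_reps \<Q> B"
abbreviation "D \<equiv> lie_deriv X"

lemma B_sub: "B \<subseteq> range (qgerm P)"
  using ref unfolding reference_ring_def cont_ext_germs_def by blast

lemma B_ring: "function_ring \<B>"
  using ref unfolding reference_ring_def by (intro function_ring_reps) blast

lemma germ_reps_image: "qgerm P ` \<B> = B"
  by (rule germ_image_reps[OF B_sub])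

lemma \<xi>_eq: "\<xi> j = qgerm P (\<lambda>y. X y $ j)"
proof -
  have "\<xi> j \<in> B" "(\<lambda>y. X y $ j) \<in> \<xi> j" using xi adm unfolding Xi_def admissible_def by blast+
  then show ?thesis using B_sub germ_eq_of_mem by blast
qed

text \<open>The derivation of germs becomes the pointwise operator \<open>D\<close> on functions,
  which can be evaluated along curves.\<close>

lemma vf_apply_germ: "vf_apply P \<xi> (qgerm P f) = qgerm P (D f)"
proof -
  have "vf_apply P \<xi> (qgerm P f) =
      (\<Oplus>\<^bsub>qring P\<^esub> j\<in>UNIV. qgerm P (\<lambda>y. X y $ j * frechet_derivative f (at y) (axis j 1)))"
    unfolding vf_apply_def \<xi>_eq germ_pd_germ germ_mult ..
  also have "\<dots> = qgerm P (D f)" by (subst germ_finsum) (simp_all add: lie_deriv_def[abs_def])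
  finally show ?thesis .
qed

lemma vf_apply_iterate_germ: "(vf_apply P \<xi> ^^ k) (qgerm P f) = qgerm P ((D ^^ k) f)"
  by (induction k) (simp_all add: vf_apply_germ)

lemma stable_D:
  assumes "vf_stable P \<xi> C" "f \<in> germ_reps \<Q> C"
  shows "D f \<in> germ_reps \<Q> C"
proof -
  have "vf_apply P \<xi> (qgerm P f) \<in> C"
    using assms unfolding vf_stable_def mem_germ_reps by blast
  then show ?thesis by (simp add: vf_apply_germ mem_germ_reps)
qed

lemma D_closed: "f \<in> \<B> \<Longrightarrow> D f \<in> \<B>"
  using xi by (intro stable_D) (simp_all add: Xi_def vf_stable_def)

lemma D_iterate_closed: "f \<in> \<B> \<Longrightarrow> (D ^^ k) f \<in> \<B>"
  by (induction k) (simp_all add: D_closed)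

lemma stable_iterate:
  assumes "vf_stable P \<xi> C" "f \<in> germ_reps \<Q> C"
  shows "(D ^^ k) f \<in> germ_reps \<Q> C"
  by (induction k) (simp_all add: stable_D[OF assms(1)] assms(2))

lemma analytic_representative:
  assumes "a \<in> B"
  obtains f r where "a = qgerm P f" "0 < r" "real_analytic_on f (corner P r)"
proof -
  obtain f V where f: "a = qgerm P f" "open V" "0 \<in> V" "real_analytic_on f (V \<inter> quadrant P)"
    using assms ref unfolding reference_ring_def cont_ext_germs_def by blast
  obtain r where "0 < r" "ball 0 r \<subseteq> V" using f(2,3) open_contains_ball by blast
  then show thesis using that[of f r] f unfolding real_analytic_on_def by blast
qed

text \<open>Only some representative is analytic by definition; any other one coincides with it in a
  neighbourhood of each point of the quadrant near 0.\<close>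

lemma eventually_differentiable:
  assumes "f \<in> \<B>"
  shows "eventually (\<lambda>y. f differentiable (at y)) \<Q>"
proof -
  obtain g r where g: "qgerm P f = qgerm P g" "0 < r" "real_analytic_on g (corner P r)"
    using analytic_representative assms unfolding mem_germ_reps by metis
  then have "eventually (\<lambda>y. f y = g y) \<Q>" by (simp add: germ_eq_iff)
  then have "eventually (\<lambda>y. \<exists>U. open U \<and> y \<in> U \<and> (\<forall>z\<in>U. f z = g z)) \<Q>"
    by (rule eventually_quadrant_nhd)
  moreover have "eventually (\<lambda>y. g differentiable (at y)) \<Q>"
    unfolding eventually_near0_ball using g(2,3) real_analytic_at_differentiable
    unfolding real_analytic_on_def by blast
  ultimately show ?thesis
  proof eventually_elim
    case (elim y)
    then obtain U g' where U: "open U" "y \<in> U" "\<And>z. z \<in> U \<Longrightarrow> g z = f z" and "(g has_derivative g') (at y)"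
      unfolding differentiable_def by metis
    then show ?case
      using has_derivative_transform_within_open[of g g' y UNIV U f] unfolding differentiable_def by blast
  qed
qed

text \<open>The continuous extension of the germ to 0 gives the bound. It supplies the constants for
  Gronwall's inequality.\<close>

lemma eventually_bounded:
  assumes "f \<in> \<B>"
  obtains C where "0 \<le> C" "eventually (\<lambda>y. \<bar>f y\<bar> \<le> C) \<Q>"
proof -
  obtain f0 V g where f0: "qgerm P f = qgerm P f0" "open V" "0 \<in> V"
    "continuous_on (V \<inter> closure (quadrant P)) g" "\<forall>y\<in>V \<inter> quadrant P. g y = f0 y"
    using assms ref unfolding mem_germ_reps reference_ring_def cont_ext_germs_def by blast
  have "(0 :: real^'n) \<in> closure (quadrant P)"
  proof (rule closure_approachable[THEN iffD2], intro allI impI)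
    fix e :: real assume e: "0 < e"
    \<comment> \<open>All coordinates are equal and positive, so the point lies in the quadrant
      whatever P is; its l1 norm is e / 2.\<close>
    define y where "y = (e / (2 * CARD('n))) *\<^sub>R (1 :: real^'n)"
    have "norm y \<le> (\<Sum>i\<in>UNIV. \<bar>y $ i\<bar>)" by (rule norm_le_l1_cart)
    also have "\<dots> = e / 2" using e by (simp add: y_def)
    also have "\<dots> < e" using e by simp
    finally have "dist y 0 < e" by simp
    moreover have "y \<in> quadrant P" using e by (simp add: quadrant_def y_def)
    ultimately show "\<exists>y\<in>quadrant P. dist y 0 < e" by blast
  qed
  then obtain d where d: "0 < d"
    "\<And>y. y \<in> V \<inter> closure (quadrant P) \<Longrightarrow> dist y 0 < d \<Longrightarrow> dist (g y) (g 0) < 1"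
    using f0(3,4) unfolding continuous_on_iff by (metis IntI zero_less_one)
  obtain r where r: "0 < r" "ball 0 r \<subseteq> V" using f0(2,3) open_contains_ball by blast
  have "eventually (\<lambda>y. \<bar>f0 y\<bar> \<le> \<bar>g 0\<bar> + 1) \<Q>"
    unfolding eventually_near0_ball
  proof (rule exI[of _ "min d r"], intro conjI ballI)
    fix y assume y: "y \<in> corner P (min d r)"
    then have "y \<in> V \<inter> quadrant P" using r by auto
    moreover from this have "dist (g y) (g 0) < 1"
      using d(2)[of y] y closure_subset by (auto simp: dist_commute)
    ultimately show "\<bar>f0 y\<bar> \<le> \<bar>g 0\<bar> + 1" using f0(5) by (auto simp: dist_real_def)
  qed (use d r in simp)
  moreover have "eventually (\<lambda>y. f y = f0 y) \<Q>" using f0(1) by (simp add: germ_eq_iff)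
  ultimately have "eventually (\<lambda>y. \<bar>f y\<bar> \<le> \<bar>g 0\<bar> + 1) \<Q>" by eventually_elim simp
  then show thesis by (intro that[of "\<bar>g 0\<bar> + 1"]) auto
qed

lemma D_add:
  assumes "f \<in> \<B>" "g \<in> \<B>"
  shows "eventually (\<lambda>y. D (\<lambda>y. f y + g y) y = D f y + D g y) \<Q>"
  using eventually_differentiable[OF assms(1)] eventually_differentiable[OF assms(2)]
proof eventually_elim
  case (elim y)
  then have "((\<lambda>y. f y + g y) has_derivative (\<lambda>h. frechet_derivative f (at y) h + frechet_derivative g (at y) h)) (at y)"
    by (intro has_derivative_add) (simp_all add: frechet_derivative_works[symmetric])
  from frechet_derivative_at[OF this, symmetric] show ?case
    by (simp add: lie_deriv_def distrib_left sum.distrib)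
qed

lemma D_mult:
  assumes "f \<in> \<B>" "g \<in> \<B>"
  shows "eventually (\<lambda>y. D (\<lambda>y. f y * g y) y = D f y * g y + f y * D g y) \<Q>"
  using eventually_differentiable[OF assms(1)] eventually_differentiable[OF assms(2)]
proof eventually_elim
  case (elim y)
  then have "((\<lambda>y. f y * g y) has_derivative (\<lambda>h. f y * frechet_derivative g (at y) h + frechet_derivative f (at y) h * g y)) (at y)"
    by (intro has_derivative_mult) (simp_all add: frechet_derivative_works[symmetric])
  from frechet_derivative_at[OF this, symmetric] show ?case
    by (simp add: lie_deriv_def distrib_left sum.distrib sum_distrib_left sum_distrib_right mult_ac)
qed

lemma D_sum:
  assumes "finite I" "\<And>i. i \<in> I \<Longrightarrow> f i \<in> \<B>"
  shows "eventually (\<lambda>y. D (\<lambda>y. \<Sum>i\<in>I. f i y) y = (\<Sum>i\<in>I. D (f i) y)) \<Q>"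
  using assms
proof (induction I rule: finite_induct)
  case empty
  show ?case by (simp add: lie_deriv_def frechet_derivative_const)
next
  case (insert i I)
  have "(\<lambda>y. \<Sum>i\<in>I. f i y) \<in> \<B>" using insert by (intro function_ring_sum[OF B_ring]) auto
  from D_add[OF _ this, of "f i"] insert
  have "eventually (\<lambda>y. D (\<lambda>y. f i y + (\<Sum>i\<in>I. f i y)) y = D (f i) y + D (\<lambda>y. \<Sum>i\<in>I. f i y) y) \<Q>" by auto
  moreover have "eventually (\<lambda>y. D (\<lambda>y. \<Sum>i\<in>I. f i y) y = (\<Sum>i\<in>I. D (f i) y)) \<Q>" using insert by auto
  ultimately show ?case
  proof eventually_elim
    case (elim y)
    then show ?case using insert.hyps by simp
  qed
qed

lemma fields_agree:
  assumes "admissible P \<xi> U' X'"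
  obtains r0 where "0 < r0" "corner P r0 \<subseteq> U'" "\<And>y. y \<in> corner P r0 \<Longrightarrow> X' y = X y"
proof -
  have "eventually (\<lambda>y. X' y $ j = X y $ j) \<Q>" for j
    using assms unfolding admissible_def \<xi>_eq mem_germ by blast
  then have "eventually (\<lambda>y. \<forall>j. X' y $ j = X y $ j) \<Q>" by (simp add: eventually_all_finite)
  then obtain r1 where r1: "0 < r1" "\<forall>y\<in>corner P r1. \<forall>j. X' y $ j = X y $ j"
    unfolding eventually_near0_ball by blast
  obtain r2 where r2: "0 < r2" "corner P r2 \<subseteq> U'" by (rule admissible_corner[OF assms])
  show thesis
  proof (rule that[of "min r1 r2"])
    show "corner P (min r1 r2) \<subseteq> U'" using r2(2) by auto
    show "X' y = X y" if "y \<in> corner P (min r1 r2)" for y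
      using that r1(2) by (simp add: vec_eq_iff)
  qed (use r1 r2 in simp)
qed

lemma field_corner:
  "\<exists>r0>0. \<forall>r. 0 < r \<longrightarrow> r \<le> r0 \<longrightarrow> admissible P \<xi> (corner P r) X \<and> analytic_field_on X (corner P r)"
proof -
  obtain r0 where r0: "0 < r0" "corner P r0 \<subseteq> Us" "\<And>r. 0 < r \<Longrightarrow> r \<le> r0 \<Longrightarrow> admissible P \<xi> (corner P r) X"
    using admissible_corner[OF adm] by blast
  then show ?thesis unfolding admissible_def analytic_field_on_def by (intro exI[of _ r0]) blast
qed

text \<open>Invariance is given for some other field and set. Agreement of the fields near 0 and
  monotonicity of orbits carry it over to X and to all small corners at once.\<close>

lemma invariant_corner:
  assumes "invariant_germ P \<xi> W"
  obtains r0 where "0 < r0" "\<And>r y. r \<le> r0 \<Longrightarrow> y \<in> W \<Longrightarrow> y \<in> corner P r \<Longrightarrow> orbit X (corner P r) y \<subseteq> W"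
proof -
  obtain U' X' where U': "admissible P \<xi> U' X'" "union_of_orbits X' U' (W \<inter> U')"
    using assms unfolding invariant_germ_def by blast
  obtain r0 where r0: "0 < r0" "corner P r0 \<subseteq> U'" "\<And>y. y \<in> corner P r0 \<Longrightarrow> X' y = X y"
    using fields_agree[OF U'(1)] by blast
  have "orbit X (corner P r) y \<subseteq> W" if "r \<le> r0" "y \<in> W" "y \<in> corner P r" for r y
  proof -
    have sub: "corner P r \<subseteq> corner P r0" using that by auto
    have "orbit X (corner P r) y \<subseteq> orbit X' U' y"
      by (rule orbit_mono) (use sub r0 in auto)
    also have "\<dots> \<subseteq> W \<inter> U'"
      using union_of_orbits_orbit_subset[OF U'(2)] that sub r0(2) by blast
    finally show ?thesis by blast
  qed
  then show thesis using that r0(1) by blast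
qed

text \<open>A germ vanishing on an invariant set is constant along the curves in this set.\<close>

lemma D_cong_on_invariant:
  assumes W: "invariant_germ P \<xi> W" "W \<subseteq> quadrant P" and fg: "f \<in> \<B>" "g \<in> \<B>"
    and eq: "eventually (\<lambda>y. f y = g y) (near0 W)"
  shows "eventually (\<lambda>y. D f y = D g y) (near0 W)"
proof -
  obtain r1 where r1: "0 < r1" "\<And>r y. r \<le> r1 \<Longrightarrow> y \<in> W \<Longrightarrow> y \<in> corner P r \<Longrightarrow> orbit X (corner P r) y \<subseteq> W"
    using invariant_corner[OF W(1)] by blast
  obtain r2 where r2: "0 < r2" "\<And>r. 0 < r \<Longrightarrow> r \<le> r2 \<Longrightarrow> analytic_field_on X (corner P r)"
    using field_corner by meson
  have "eventually (\<lambda>y. f differentiable (at y) \<and> g differentiable (at y)) \<Q>"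
    by (intro eventually_conj eventually_differentiable fg)
  then obtain r3 where r3: "0 < r3" "\<And>y. y \<in> corner P r3 \<Longrightarrow> f differentiable (at y) \<and> g differentiable (at y)"
    unfolding eventually_near0_ball by blast
  obtain r4 where r4: "0 < r4" "\<And>y. y \<in> W \<inter> ball 0 r4 \<Longrightarrow> f y = g y"
    using eq unfolding eventually_near0_ball by blast
  define r where "r = min (min r1 r2) (min r3 r4)"
  have r: "0 < r" "r \<le> r1" "r \<le> r2" "r \<le> r3" "r \<le> r4" using r1 r2 r3 r4 by (auto simp: r_def)
  have "D f y = D g y" if y: "y \<in> W \<inter> ball 0 r" for y
  proof -
    have yc: "y \<in> corner P r" using y W(2) by blast
    have "open (corner P r)" using open_quadrant by blast
    \<comment> \<open>The curve stays in W by invariance, so \<open>f - g\<close> vanishes along it,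
      and its derivative at time 0 is the difference of the two values to be compared.\<close>
    then obtain \<epsilon> c where c: "0 < \<epsilon>" "c 0 = y" "integral_curve X (corner P r) {0..\<epsilon>} c"
      using local_integral_curve[OF analytic_field_locally_lipschitz[OF r2(2)[OF r(1,3)]] _ yc] by blast
    have "c t \<in> W \<inter> ball 0 r4" if "t \<in> {0..\<epsilon>}" for t
    proof -
      have "c t \<in> orbit X (corner P r) y"
        using orbitI[OF c(3), of t] c(1,2) that by (auto simp: is_interval_cc)
      then show ?thesis
        using r1(2)[OF r(2)] y yc orbit_subset[of X "corner P r" y] r(5) by auto
    qed
    then have z: "f (c t) - g (c t) = 0" if "t \<in> {0..\<epsilon>}" for t using r4(2) that by simp
    have d: "f differentiable (at (c 0))" "g differentiable (at (c 0))"
      using r3(2)[of y] yc r(4) c(2) by auto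
    have "((\<lambda>t. f (c t) - g (c t)) has_real_derivative D f (c 0) - D g (c 0)) (at 0 within {0..\<epsilon>})"
      using c(1) by (intro DERIV_diff lie_deriv_along_curve[OF c(3)] d) auto
    then have "((\<lambda>t. 0) has_real_derivative D f (c 0) - D g (c 0)) (at 0 within {0..\<epsilon>})"
      by (rule has_field_derivative_transform_within[of _ _ _ _ 1]) (use z c(1) in auto)
    moreover have "((\<lambda>t. 0 :: real) has_real_derivative 0) (at 0 within {0..\<epsilon>})" by simp
    \<comment> \<open>A one-sided derivative is unique because the interval is not
      degenerate.\<close>
    moreover have "at 0 within {0..\<epsilon>} \<noteq> bot" using c(1) by (simp add: at_within_Icc_at_right)
    ultimately have "D f (c 0) - D g (c 0) = 0"
      unfolding has_field_derivative_iff using tendsto_unique by blast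
    then show ?thesis using c(2) by simp
  qed
  then show ?thesis unfolding eventually_near0_ball using r(1) by blast
qed

end

subsection \<open>Counting zeros along orbits\<close>

text \<open>The sum of the squares of the unknowns satisfies Gronwall's hypothesis with constant
  \<open>2 * C * l\<close>, since twice a product is at most the sum of the two squares.\<close>

lemma gronwall_linear_system:
  fixes v :: "nat \<Rightarrow> real \<Rightarrow> real"
  assumes I: "is_interval I" "t0 \<in> I" "t \<in> I"
    and der: "\<And>i s. i < l \<Longrightarrow> s \<in> I \<Longrightarrow> (v i has_real_derivative (\<Sum>j<l. a i j s * v j s)) (at s within I)"
    and bd: "\<And>i j s. i < l \<Longrightarrow> j < l \<Longrightarrow> s \<in> I \<Longrightarrow> \<bar>a i j s\<bar> \<le> C"
    and zero: "\<And>i. i < l \<Longrightarrow> v i t0 = 0" and i: "i < l"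
  shows "v i t = 0"
proof -
  define w where "w s = (\<Sum>i<l. (v i s)\<^sup>2)" for s
  define w' where "w' s = (\<Sum>i<l. 2 * (v i s * (\<Sum>j<l. a i j s * v j s)))" for s
  have "w t = 0"
  proof (rule gronwall_zero[OF I(1,2) _ _ _ _ I(3)])
    show "w t0 = 0" using zero by (simp add: w_def)
    fix s assume s: "s \<in> I"
    show "0 \<le> w s" by (simp add: w_def sum_nonneg)
    show "(w has_real_derivative w' s) (at s within I)"
      unfolding w_def[abs_def] w'_def
      using der s by (intro DERIV_sum) (auto intro!: derivative_eq_intros simp: mult_ac)
    have "\<bar>2 * (v i s * (\<Sum>j<l. a i j s * v j s))\<bar> \<le> (\<Sum>j<l. C * ((v i s)\<^sup>2 + (v j s)\<^sup>2))" if i: "i < l" for i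
    proof -
      have "2 * (v i s * (\<Sum>j<l. a i j s * v j s)) = (\<Sum>j<l. a i j s * (2 * v i s * v j s))"
        by (simp add: sum_distrib_left mult_ac)
      also have "\<bar>\<dots>\<bar> \<le> (\<Sum>j<l. \<bar>a i j s * (2 * v i s * v j s)\<bar>)" by (rule sum_abs)
      also have "\<dots> \<le> (\<Sum>j<l. C * ((v i s)\<^sup>2 + (v j s)\<^sup>2))"
      proof (rule sum_mono)
        fix j assume "j \<in> {..<l}"
        then have j: "\<bar>a i j s\<bar> \<le> C" using bd[OF i _ s] by simp
        have "\<bar>2 * v i s * v j s\<bar> \<le> (v i s)\<^sup>2 + (v j s)\<^sup>2"
          using sum_squares_bound[of "\<bar>v i s\<bar>" "\<bar>v j s\<bar>"] by (simp add: abs_mult)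
        then show "\<bar>a i j s * (2 * v i s * v j s)\<bar> \<le> C * ((v i s)\<^sup>2 + (v j s)\<^sup>2)"
          unfolding abs_mult[of "a i j s"] using j by (intro mult_mono) auto
      qed
      finally show ?thesis .
    qed
    then have "\<bar>w' s\<bar> \<le> (\<Sum>i<l. \<Sum>j<l. C * ((v i s)\<^sup>2 + (v j s)\<^sup>2))"
      unfolding w'_def by (intro sum_abs[THEN order_trans] sum_mono) auto
    also have "\<dots> = (2 * C * l) * w s"
      by (simp add: w_def sum_distrib_left[symmetric] sum.distrib distrib_left sum_distrib_right[symmetric] algebra_simps)
    finally show "\<bar>w' s\<bar> \<le> (2 * C * l) * w s" .
  qed
  then have "\<forall>i\<in>{..<l}. (v i t)\<^sup>2 = 0"
    unfolding w_def by (subst (asm) sum_nonneg_eq_0_iff) auto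
  then show ?thesis using i by simp
qed

text \<open>The perturbing terms together have size at most \<open>l / (2 * (l + 1))\<close> times
  the dominant one, a factor below 1 also for l = 0.\<close>

lemma perturbed_dominant_nonzero:
  fixes v m :: "nat \<Rightarrow> real"
  assumes "v k \<noteq> 0" "\<And>i. i < l \<Longrightarrow> \<bar>v i\<bar> \<le> \<bar>v k\<bar>" "\<And>i. i < l \<Longrightarrow> \<bar>m i\<bar> \<le> 1 / (2 * (real l + 1))"
  shows "v k + (\<Sum>i<l. m i * v i) \<noteq> 0"
proof -
  have "\<bar>\<Sum>i<l. m i * v i\<bar> \<le> (\<Sum>i<l. \<bar>m i * v i\<bar>)" by (rule sum_abs)
  also have "\<dots> \<le> of_nat (card {..<l}) * (1 / (2 * (real l + 1)) * \<bar>v k\<bar>)"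
  proof (rule sum_bounded_above)
    show "\<bar>m i * v i\<bar> \<le> 1 / (2 * (real l + 1)) * \<bar>v k\<bar>" if "i \<in> {..<l}" for i
      unfolding abs_mult using that by (intro mult_mono assms(2,3)) auto
  qed
  also have "\<dots> = real l / (2 * (real l + 1)) * \<bar>v k\<bar>" by simp
  also have "\<dots> < 1 * \<bar>v k\<bar>" using assms(1) by (intro mult_strict_right_mono) (auto simp: field_simps)
  finally show ?thesis by linarith
qed

context chi_setting
begin

text \<open>Points are counted, and an orbit on which \<open>h\<close> vanishes identically is set
  apart. The bound is uniform over small corners, so finitely many functions can share one
  radius.\<close>

definition few_zeros_on :: "(real^'n) set \<Rightarrow> (real^'n \<Rightarrow> real) \<Rightarrow> nat \<Rightarrow> real \<Rightarrow> bool" where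
  "few_zeros_on U0 h N \<rho> \<longleftrightarrow> 0 < \<rho> \<and>
    (\<forall>r y. 0 < r \<longrightarrow> r \<le> \<rho> \<longrightarrow> y \<in> corner P r \<longrightarrow> orbit X (corner P r) y \<subseteq> U0 \<longrightarrow>
      (\<forall>z\<in>orbit X (corner P r) y. h z = 0) \<or>
      finite {z\<in>orbit X (corner P r) y. h z = 0} \<and> card {z\<in>orbit X (corner P r) y. h z = 0} \<le> N)"

text \<open>Components are counted here: F may vanish on a whole orbit, which is then a single
  component.\<close>

definition zeros_bounded_on :: "(real^'n) set \<Rightarrow> (real^'n \<Rightarrow> real) \<Rightarrow> nat \<Rightarrow> real \<Rightarrow> bool" where
  "zeros_bounded_on W F N \<rho> \<longleftrightarrow> 0 < \<rho> \<and>
    (\<forall>r y. 0 < r \<longrightarrow> r \<le> \<rho> \<longrightarrow> y \<in> corner P r \<longrightarrow> y \<in> W \<longrightarrow>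
      b0 (orbit X (corner P r) y \<inter> {z. F z = 0}) \<le> enat N)"

text \<open>An orbit in a corner is only a part of an orbit of the admissible set for which
  regularity is known. A bound on components would be lost on the part; the dichotomy of analytic
  zeros first turns it into a bound on points, which survives.\<close>

lemma regular_on_orbits:
  assumes reg: "chi_regular P \<xi> U0 (qgerm P h)"
  shows "\<exists>N \<rho>. few_zeros_on U0 h N \<rho>"
proof -
  obtain U' X' f where U': "admissible P \<xi> U' X'" and f: "f \<in> qgerm P h" "real_analytic_on f U'"
    and "proj_degree_on X' U' ({y\<in>U'. f y = 0} \<inter> U0) < \<infinity>"
    using reg unfolding chi_regular_def zero_degree_def Inf_less_iff by blast
  then obtain N where N: "proj_degree_on X' U' ({y\<in>U'. f y = 0} \<inter> U0) = enat N" by auto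
  obtain r1 where r1: "0 < r1" "corner P r1 \<subseteq> U'" "\<And>y. y \<in> corner P r1 \<Longrightarrow> X' y = X y"
    using fields_agree[OF U'] by blast
  obtain r2 where r2: "0 < r2" "\<forall>y\<in>corner P r2. f y = h y"
    using f(1) unfolding mem_germ eventually_near0_ball by blast
  have "few_zeros_on U0 h N (min r1 r2)"
    unfolding few_zeros_on_def
  proof (intro conjI allI impI)
    fix r y assume r: "0 < r" "r \<le> min r1 r2" and y: "y \<in> corner P r" and sub: "orbit X (corner P r) y \<subseteq> U0"
    have c: "corner P r \<subseteq> corner P r1" "corner P r \<subseteq> corner P r2" using r by auto
    define \<gamma> where "\<gamma> = orbit X' U' y"
    have \<gamma>: "orbit X (corner P r) y \<subseteq> \<gamma>"
      unfolding \<gamma>_def by (rule orbit_mono) (use c r1 in auto)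
    have fh: "f z = h z" if "z \<in> orbit X (corner P r) y" for z
      using that orbit_subset[of X "corner P r" y] c r2(2) by blast
    have "analytic_field_on X' U'" using U' unfolding admissible_def analytic_field_on_def by blast
    from analytic_zeros_on_orbit[OF f(2) this, of y]
    show "(\<forall>z\<in>orbit X (corner P r) y. h z = 0) \<or>
      finite {z\<in>orbit X (corner P r) y. h z = 0} \<and> card {z\<in>orbit X (corner P r) y. h z = 0} \<le> N"
    proof
      assume "\<forall>z\<in>orbit X' U' y. f z = 0"
      then show ?thesis using \<gamma> fh unfolding \<gamma>_def by fastforce
    next
      assume cnt: "countable {z\<in>orbit X' U' y. f z = 0}"
      define Z where "Z = \<gamma> \<inter> ({y\<in>U'. f y = 0} \<inter> U0)"
      have "countable Z" using cnt by (rule countable_subset[rotated]) (auto simp: Z_def \<gamma>_def)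
      moreover have "b0 Z \<le> enat N"
        unfolding N[symmetric] proj_degree_on_def Z_def \<gamma>_def
        by (rule SUP_upper) (use y c r1 in blast)
      ultimately have Z: "finite Z \<and> card Z \<le> N" by (rule b0_countable)
      have "{z\<in>orbit X (corner P r) y. h z = 0} \<subseteq> Z"
        using \<gamma> sub fh orbit_subset[of X' U' y] unfolding Z_def \<gamma>_def by auto
      then show ?thesis using Z card_mono[of Z] finite_subset[of _ Z] by (meson order_trans)
    qed
  qed (use r1 r2 in simp)
  then show ?thesis by blast
qed

text \<open>The linear relations concern the piece W, regularity the whole of \<open>U0\<close>. The
  relations \<open>eq\<close> with small coefficients make \<open>(D ^^ k) F\<close> nonzero where
  \<open>(D ^^ k) G\<close> dominates; \<open>span_F\<close> makes F vanish on the orbits where the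
  first l iterates of G all vanish.\<close>

lemma zeros_on_orbits_bounded:
  assumes W: "invariant_germ P \<xi> W" "W \<subseteq> U0" "W \<subseteq> quadrant P" and F: "F \<in> \<B>" and G: "G \<in> \<B>"
    and reg: "\<And>i j. i < l \<Longrightarrow> j < l \<Longrightarrow> chi_regular P \<xi> U0 (qgerm P (\<lambda>y. ((D ^^ i) G y)\<^sup>2 - ((D ^^ j) G y)\<^sup>2))"
    and span_F: "spanned (near0 W) \<B> (\<lambda>i. (D ^^ i) G) {..<l} F"
    and span_G: "\<And>i. spanned (near0 W) \<B> (\<lambda>i. (D ^^ i) G) {..<l} ((D ^^ i) G)"
    and m: "\<And>k i. k < l \<Longrightarrow> i < l \<Longrightarrow> (m k i \<longlongrightarrow> 0) \<Q>"
    and eq: "\<And>k. k < l \<Longrightarrow>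
      eventually (\<lambda>y. (D ^^ k) F y = (D ^^ k) G y + (\<Sum>i<l. m k i y * (D ^^ i) G y)) (near0 W)"
  shows "\<exists>N \<rho>. zeros_bounded_on W F N \<rho>"
proof -
  let ?e = "\<lambda>i. (D ^^ i) G"
  have WQ: "near0 W \<le> \<Q>" using W(3) by (rule near0_mono)
  obtain b where b: "eventually (\<lambda>y. F y = (\<Sum>i<l. b i y * ?e i y)) (near0 W)"
    using span_F unfolding spanned_def by blast
  have "\<forall>i. \<exists>a. (\<forall>j\<in>{..<l}. a j \<in> \<B>) \<and> eventually (\<lambda>y. ?e (Suc i) y = (\<Sum>j<l. a j y * ?e j y)) (near0 W)"
    using span_G unfolding spanned_def by blast
  from choice[OF this] obtain a where a0: "\<forall>i. (\<forall>j\<in>{..<l}. a i j \<in> \<B>) \<and>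
      eventually (\<lambda>y. ?e (Suc i) y = (\<Sum>j<l. a i j y * ?e j y)) (near0 W)" by blast
  have a: "a i j \<in> \<B>" if "j < l" for i j using a0 that by blast
  have a_eq: "eventually (\<lambda>y. ?e (Suc i) y = (\<Sum>j<l. a i j y * ?e j y)) (near0 W)" for i
    using a0 by blast
  \<comment> \<open>A bound for each coefficient near 0; the sum of the bounds is a single constant
    for the linear system.\<close>
  define C where "C i j = (SOME C. 0 \<le> C \<and> eventually (\<lambda>y. \<bar>a i j y\<bar> \<le> C) \<Q>)" for i j
  have C': "0 \<le> C i j \<and> eventually (\<lambda>y. \<bar>a i j y\<bar> \<le> C i j) \<Q>" if "j < l" for i j
    unfolding C_def by (rule someI_ex) (metis eventually_bounded[OF a[OF that]])
  have C: "0 \<le> C i j" "eventually (\<lambda>y. \<bar>a i j y\<bar> \<le> C i j) \<Q>" if "j < l" for i j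
    using C'[OF that] by blast+
  define C0 where "C0 = (\<Sum>i<l. \<Sum>j<l. C i j)"
  have C0: "C i j \<le> C0" if "i < l" "j < l" for i j
  proof -
    have "C i j \<le> (\<Sum>j<l. C i j)" using that C(1) by (intro member_le_sum) auto
    also have "\<dots> \<le> C0" unfolding C0_def using that C(1)
      by (intro member_le_sum[of i "{..<l}" "\<lambda>i. \<Sum>j<l. C i j"]) (auto intro!: sum_nonneg)
    finally show ?thesis .
  qed
  have "eventually (\<lambda>y. (\<forall>i\<in>{..l}. ?e i differentiable (at y) \<and> (D ^^ i) F differentiable (at y))) \<Q>"
    by (intro eventually_ball_finite ballI eventually_conj eventually_differentiable D_iterate_closed F G) auto
  moreover have "eventually (\<lambda>y. \<forall>i\<in>{..<l}. \<forall>j\<in>{..<l}. \<bar>a i j y\<bar> \<le> C i j) \<Q>"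
    using C(2) by (intro eventually_ball_finite ballI) auto
  \<comment> \<open>The threshold at which l perturbing terms cannot cancel a dominant one.\<close>
  moreover have "eventually (\<lambda>y. \<forall>k\<in>{..<l}. \<forall>i\<in>{..<l}. \<bar>m k i y\<bar> < 1 / (2 * (real l + 1))) \<Q>"
  proof (intro eventually_ball_finite ballI)
    fix k i assume "k \<in> {..<l}" "i \<in> {..<l}"
    then have "(m k i \<longlongrightarrow> 0) \<Q>" using m by simp
    from tendstoD[OF this, of "1 / (2 * (real l + 1))"]
    show "eventually (\<lambda>y. \<bar>m k i y\<bar> < 1 / (2 * (real l + 1))) \<Q>" by simp
  qed auto
  ultimately have "eventually (\<lambda>y. (\<forall>i\<in>{..l}. ?e i differentiable (at y) \<and> (D ^^ i) F differentiable (at y)) \<and>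
      (\<forall>i\<in>{..<l}. \<forall>j\<in>{..<l}. \<bar>a i j y\<bar> \<le> C i j) \<and>
      (\<forall>k\<in>{..<l}. \<forall>i\<in>{..<l}. \<bar>m k i y\<bar> < 1 / (2 * (real l + 1)))) \<Q>"
    by (intro eventually_conj)
  note on_W = filter_leD[OF WQ this]
  have "eventually (\<lambda>y. ((\<forall>i\<in>{..l}. ?e i differentiable (at y) \<and> (D ^^ i) F differentiable (at y)) \<and>
      (\<forall>i\<in>{..<l}. \<forall>j\<in>{..<l}. \<bar>a i j y\<bar> \<le> C i j) \<and>
      (\<forall>k\<in>{..<l}. \<forall>i\<in>{..<l}. \<bar>m k i y\<bar> < 1 / (2 * (real l + 1)))) \<and>
      F y = (\<Sum>i<l. b i y * ?e i y) \<and>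
      (\<forall>i\<in>{..<l}. ?e (Suc i) y = (\<Sum>j<l. a i j y * ?e j y)) \<and>
      (\<forall>k\<in>{..<l}. (D ^^ k) F y = ?e k y + (\<Sum>i<l. m k i y * ?e i y))) (near0 W)"
    by (rule eventually_conj[OF on_W], intro eventually_conj b eventually_ball_finite ballI a_eq)
      (use eq in auto)
  then obtain r1 where r1: "0 < r1" and near:
    "\<And>y i. y \<in> W \<inter> ball 0 r1 \<Longrightarrow> i \<le> l \<Longrightarrow> ?e i differentiable (at y)"
    "\<And>y i. y \<in> W \<inter> ball 0 r1 \<Longrightarrow> i \<le> l \<Longrightarrow> (D ^^ i) F differentiable (at y)"
    "\<And>y i j. y \<in> W \<inter> ball 0 r1 \<Longrightarrow> i < l \<Longrightarrow> j < l \<Longrightarrow> \<bar>a i j y\<bar> \<le> C i j"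
    "\<And>y k i. y \<in> W \<inter> ball 0 r1 \<Longrightarrow> k < l \<Longrightarrow> i < l \<Longrightarrow> \<bar>m k i y\<bar> < 1 / (2 * (real l + 1))"
    "\<And>y. y \<in> W \<inter> ball 0 r1 \<Longrightarrow> F y = (\<Sum>i<l. b i y * ?e i y)"
    "\<And>y i. y \<in> W \<inter> ball 0 r1 \<Longrightarrow> i < l \<Longrightarrow> ?e (Suc i) y = (\<Sum>j<l. a i j y * ?e j y)"
    "\<And>y k. y \<in> W \<inter> ball 0 r1 \<Longrightarrow> k < l \<Longrightarrow> (D ^^ k) F y = ?e k y + (\<Sum>i<l. m k i y * ?e i y)"
    unfolding eventually_near0_ball by auto
  obtain r2 where r2: "0 < r2" "\<And>r y. r \<le> r2 \<Longrightarrow> y \<in> W \<Longrightarrow> y \<in> corner P r \<Longrightarrow> orbit X (corner P r) y \<subseteq> W"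
    using invariant_corner[OF W(1)] by blast
  obtain r3 where r3: "0 < r3" "\<And>r. 0 < r \<Longrightarrow> r \<le> r3 \<Longrightarrow> analytic_field_on X (corner P r)"
    using field_corner by meson
  define d where "d i j z = (?e i z)\<^sup>2 - (?e j z)\<^sup>2" for i j z
  have "\<exists>N \<rho>. few_zeros_on U0 (d i j) N \<rho>" if "i < l" "j < l" for i j
    using regular_on_orbits[OF reg[OF that]] unfolding d_def .
  then obtain N \<rho> where N: "\<And>i j. i < l \<Longrightarrow> j < l \<Longrightarrow> few_zeros_on U0 (d i j) (N i j) (\<rho> i j)"
    by metis
  define N0 where "N0 = (\<Sum>i<l. \<Sum>j<l. N i j)"
  have N0: "N i j \<le> N0" if "i < l" "j < l" for i j
  proof -
    have "N i j \<le> (\<Sum>j<l. N i j)" using that by (intro member_le_sum) auto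
    also have "\<dots> \<le> N0" unfolding N0_def using that
      by (intro member_le_sum[of i "{..<l}" "\<lambda>i. \<Sum>j<l. N i j"]) auto
    finally show ?thesis .
  qed
  define R where "R = insert r1 (insert r2 (insert r3 ((\<lambda>(i, j). \<rho> i j) ` ({..<l} \<times> {..<l}))))"
  have R: "finite R" "R \<noteq> {}" "\<And>x. x \<in> R \<Longrightarrow> 0 < x"
    using r1 r2 r3 N by (auto simp: R_def few_zeros_on_def)
  define r0 where "r0 = Min R"
  have r0: "0 < r0" "r0 \<le> r1" "r0 \<le> r2" "r0 \<le> r3" "\<And>i j. i < l \<Longrightarrow> j < l \<Longrightarrow> r0 \<le> \<rho> i j"
  proof -
    show "0 < r0" using R Min_in unfolding r0_def by blast
    have le: "r0 \<le> x" if "x \<in> R" for x unfolding r0_def using R(1) that by (rule Min_le)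
    show "r0 \<le> r1" "r0 \<le> r2" "r0 \<le> r3" by (rule le; simp add: R_def)+
    show "r0 \<le> \<rho> i j" if "i < l" "j < l" for i j
      by (rule le) (use that in \<open>auto simp: R_def image_iff\<close>)
  qed
  define N1 where "N1 = 2 ^ (l * l * N0) * (l + 1)"
  \<comment> \<open>The 1 covers orbits on which F vanishes identically; \<open>2 * N1\<close>
    covers the others, with at most \<open>N1\<close> zeros on an injective curve in either
    direction of time.\<close>
  have "zeros_bounded_on W F (max 1 (2 * N1)) r0"
    unfolding zeros_bounded_on_def
  proof (intro conjI allI impI r0(1))
    fix r y assume r: "0 < r" "r \<le> r0" and y: "y \<in> corner P r" "y \<in> W"
    define \<gamma> where "\<gamma> = orbit X (corner P r) y"
    have \<gamma>W: "\<gamma> \<subseteq> W" unfolding \<gamma>_def using r2(2) r r0(3) y by simp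
    moreover have "\<gamma> \<subseteq> ball 0 r1" using orbit_subset[of X "corner P r" y] r r0(2) by (auto simp: \<gamma>_def)
    ultimately have \<gamma>: "z \<in> W \<inter> ball 0 r1" if "z \<in> \<gamma>" for z using that by blast
    have on: "c t \<in> \<gamma>" if "integral_curve X (corner P r) I c" "is_interval I" "0 \<in> I" "c 0 = y" "t \<in> I" for c I t
      using orbitI[OF that(1-3,5)] that(4) by (simp add: \<gamma>_def)
    \<comment> \<open>By \<open>span_G\<close> the first l iterates solve a homogeneous linear
      system along the curve, with coefficients bounded by \<open>C0\<close>. A common zero at one
      time is therefore a common zero at all times.\<close>
    have propagate: "?e i (c t) = 0"
      if c: "integral_curve X (corner P r) I c" "is_interval I" "0 \<in> I" "c 0 = y"
        and t: "s \<in> I" "t \<in> I" and zero: "\<And>i. i < l \<Longrightarrow> ?e i (c s) = 0" and i: "i < l" for c I s t i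
    proof (rule gronwall_linear_system[OF c(2) t, where v = "\<lambda>i t. ?e i (c t)" and l = l and C = C0
          and a = "\<lambda>i j t. a i j (c t)"])
      fix i \<tau> assume i: "i < l" and \<tau>: "\<tau> \<in> I"
      have z: "c \<tau> \<in> W \<inter> ball 0 r1" using \<gamma>[OF on[OF c \<tau>]] .
      have "((\<lambda>t. ?e i (c t)) has_real_derivative D (?e i) (c \<tau>)) (at \<tau> within I)"
        using i by (intro lie_deriv_along_curve[OF c(1) \<tau>] near(1)[OF z]) auto
      then show "((\<lambda>t. ?e i (c t)) has_real_derivative (\<Sum>j<l. a i j (c \<tau>) * ?e j (c \<tau>))) (at \<tau> within I)"
        using near(6)[OF z i] by simp
      show "\<bar>a i j (c \<tau>)\<bar> \<le> C0" if "j < l" for j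
        using near(3)[OF z i that] C0[OF i that] by simp
    qed (use zero i in auto)
    have "b0 (\<gamma> \<inter> {z. F z = 0}) \<le> enat (max 1 (2 * N1))"
    proof (cases "\<forall>i<l. ?e i y = 0")
      case True
      have "F z = 0" if z: "z \<in> \<gamma>" for z
      proof -
        obtain c t I where c: "is_interval I" "0 \<in> I" "t \<in> I" "c 0 = y" "c t = z" "integral_curve X (corner P r) I c"
          using z unfolding \<gamma>_def mem_orbit_iff by blast
        have "?e i z = 0" if "i < l" for i
          using propagate[OF c(6,1,2,4) c(2,3) _ that] True c(4,5) by simp
        then show ?thesis using near(5)[OF \<gamma>[OF z]] by simp
      qed
      then have "\<gamma> \<inter> {z. F z = 0} = \<gamma>" by blast
      then have "b0 (\<gamma> \<inter> {z. F z = 0}) \<le> 1"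
        using b0_connected[OF connected_orbit[of X "corner P r" y]] by (simp add: \<gamma>_def)
      then show ?thesis by (simp add: one_enat_def order_trans[of _ "enat 1"])
    next
      case False
      have lip: "locally_lipschitz_on X (corner P r)"
        using r r0(4) by (intro analytic_field_locally_lipschitz r3(2)) auto
      have "finite (\<gamma> \<inter> {z. F z = 0}) \<and> card (\<gamma> \<inter> {z. F z = 0}) \<le> 2 * N1"
      proof (rule card_orbit_le[OF lip y(1)])
        show "\<gamma> \<inter> {z. F z = 0} \<subseteq> orbit X (corner P r) y" by (simp add: \<gamma>_def)
        fix J c assume c: "is_interval J" "0 \<in> J" "integral_curve X (corner P r) J c" "c 0 = y" and inj: "inj_on c J"
        note z = \<gamma>[OF on[OF c(3,1,2,4)]]
        have "finite {t\<in>J. (D ^^ 0) F (c t) = 0} \<and>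
            card {t\<in>J. (D ^^ 0) F (c t) = 0} < 2 ^ (l * l * N0) * (l + 1)"
        proof (rule zeros_of_dominated[where u = "\<lambda>k t. (D ^^ k) F (c t)" and v = "\<lambda>i t. ?e i (c t)", OF c(1)])
          show "((\<lambda>t. (D ^^ i) F (c t)) has_real_derivative (D ^^ Suc i) F (c t)) (at t within J)"
            if "i < l" "t \<in> J" for i t
            using lie_deriv_along_curve[OF c(3) that(2) near(2)[OF z[OF that(2)]], of i] that(1) by simp
          show "continuous_on J (\<lambda>t. ?e i (c t))" if "i < l" for i
            unfolding continuous_on_eq_continuous_within
          proof
            fix t assume t: "t \<in> J"
            have "((\<lambda>t. ?e i (c t)) has_real_derivative D (?e i) (c t)) (at t within J)"
              using that by (intro lie_deriv_along_curve[OF c(3) t] near(1)[OF z[OF t]]) auto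
            then show "continuous (at t within J) (\<lambda>t. ?e i (c t))" by (rule DERIV_continuous)
          qed
          show "\<exists>i<l. ?e i (c t) \<noteq> 0" if t: "t \<in> J" for t
          proof (rule ccontr)
            assume no: "\<not> ?thesis"
            then have "?e i (c 0) = 0" if "i < l" for i
              using propagate[OF c(3,1,2,4) t c(2) _ that] by blast
            then show False using False c(4) by simp
          qed
          show "(D ^^ k) F (c t) \<noteq> 0"
            if k: "k < l" "t \<in> J" "?e k (c t) \<noteq> 0" "\<And>i. i < l \<Longrightarrow> \<bar>?e i (c t)\<bar> \<le> \<bar>?e k (c t)\<bar>" for k t
            unfolding near(7)[OF z[OF k(2)] k(1)]
            using k(3,4) near(4)[OF z[OF k(2)] k(1)]
            by (intro perturbed_dominant_nonzero) (auto intro: less_imp_le)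
          fix i j assume ij: "i < l" "j < l"
          have U: "orbit X (corner P r) y \<subseteq> U0" using \<gamma>W W(2) by (auto simp: \<gamma>_def)
          have "r \<le> \<rho> i j" using r(2) r0(5)[OF ij] by simp
          then have "(\<forall>z\<in>orbit X (corner P r) y. d i j z = 0) \<or> finite {z\<in>orbit X (corner P r) y. d i j z = 0} \<and>
              card {z\<in>orbit X (corner P r) y. d i j z = 0} \<le> N i j"
            using N[OF ij] r(1) y(1) U unfolding few_zeros_on_def by blast
          then have "(\<forall>t\<in>J. d i j (c t) = 0) \<or> finite {t\<in>J. d i j (c t) = 0} \<and> card {t\<in>J. d i j (c t) = 0} \<le> N0"
          proof
            assume "\<forall>z\<in>orbit X (corner P r) y. d i j z = 0"
            then show ?thesis using on[OF c(3,1,2,4)] by (auto simp: \<gamma>_def)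
          next
            assume fin: "finite {z\<in>orbit X (corner P r) y. d i j z = 0} \<and> card {z\<in>orbit X (corner P r) y. d i j z = 0} \<le> N i j"
            \<comment> \<open>Injectivity of c bounds the number of times by the number of points of
              the orbit, which is what regularity controls.\<close>
            have inj': "inj_on c {t\<in>J. d i j (c t) = 0}" using inj by (rule inj_on_subset) auto
            have sub: "c ` {t\<in>J. d i j (c t) = 0} \<subseteq> {z\<in>orbit X (corner P r) y. d i j z = 0}"
              using on[OF c(3,1,2,4)] by (auto simp: \<gamma>_def)
            have "finite {t\<in>J. d i j (c t) = 0}" using inj_on_finite[OF inj' sub] fin by blast
            moreover have "card {t\<in>J. d i j (c t) = 0} \<le> N0"
              using card_inj_on_le[OF inj' sub] fin N0[OF ij] by linarith
            ultimately show ?thesis by blast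
          qed
          then show "(\<forall>t\<in>J. (?e i (c t))\<^sup>2 - (?e j (c t))\<^sup>2 = 0) \<or>
              finite {t\<in>J. (?e i (c t))\<^sup>2 - (?e j (c t))\<^sup>2 = 0} \<and>
              card {t\<in>J. (?e i (c t))\<^sup>2 - (?e j (c t))\<^sup>2 = 0} \<le> N0"
            unfolding d_def .
        qed
        moreover have "{t\<in>J. c t \<in> \<gamma> \<inter> {z. F z = 0}} = {t\<in>J. (D ^^ 0) F (c t) = 0}"
          using on[OF c(3,1,2,4)] by auto
        ultimately show "finite {t\<in>J. c t \<in> \<gamma> \<inter> {z. F z = 0}} \<and> card {t\<in>J. c t \<in> \<gamma> \<inter> {z. F z = 0}} \<le> N1"
          by (simp add: N1_def)
      qed
      then show ?thesis using b0_finite[of "\<gamma> \<inter> {z. F z = 0}"] by (meson enat_ord_simps(1) le_max_iff_disj order_trans)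
    qed
    then show "b0 (orbit X (corner P r) y \<inter> {z. F z = 0}) \<le> enat (max 1 (2 * N1))" by (simp add: \<gamma>_def)
  qed
  then show ?thesis by blast
qed

end

subsection \<open>Perturbations of finitely generated differential ideals\<close>

context chi_setting
begin

lemma sub_ring_eq: "sub_ring (qring P) B = germs_of \<Q> \<B>"
  by (simp add: germ_reps_image)

lemma function_ideal_reps:
  assumes "ideal M (sub_ring (qring P) B)"
  shows "function_ideal \<B> (germ_reps \<Q> M)"
proof -
  have M: "ideal M (germs_of \<Q> \<B>)" using assms by (simp add: sub_ring_eq)
  note * = ideal_germsD[OF M]
  have "germ_reps \<Q> M \<subseteq> \<B>" using *(2) germ_reps_image by (auto simp: mem_germ_reps)
  then show ?thesis unfolding function_ideal_def using *(1,3,4) by (auto simp: mem_germ_reps)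
qed

text \<open>If 1 - m were in M, adding m would put 1 into M; outside the unique maximal ideal every
  element is invertible.\<close>

lemma local_inverse:
  assumes M: "maximalideal M (sub_ring (qring P) B)" and m: "m \<in> germ_reps \<Q> M"
  shows "\<exists>u\<in>\<B>. eventually (\<lambda>y. u y * (1 - m y) = 1) \<Q>"
proof -
  have M': "maximalideal M (germs_of \<Q> \<B>)" using M by (simp add: sub_ring_eq)
  interpret maximalideal M "germs_of \<Q> \<B>" by (rule M')
  have loc: "local_ring (germs_of \<Q> \<B>)"
    using ref unfolding reference_ring_def sub_ring_eq[symmetric] by blast
  have "m \<in> \<B>" using m ideal_germsD(2)[OF is_ideal] germ_reps_image by (auto simp: mem_germ_reps)
  then have "(\<lambda>y. 1 - m y) \<in> \<B>"
    using function_ring_diff[OF B_ring function_ring_closed(1)[OF B_ring]] by blast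
  then have c: "qgerm P (\<lambda>y. 1 - m y) \<in> carrier (germs_of \<Q> \<B>)" by simp
  have "qgerm P (\<lambda>y. 1 - m y) \<notin> M"
  proof
    assume "qgerm P (\<lambda>y. 1 - m y) \<in> M"
    from ideal_germsD(3)[OF is_ideal this m[unfolded mem_germ_reps]]
    have "qgerm P (\<lambda>y. (1 - m y) + m y) \<in> M" .
    then have "\<one>\<^bsub>germs_of \<Q> \<B>\<^esub> \<in> M" by (simp add: germ_one)
    then show False using one_imp_carrier I_notcarr by blast
  qed
  then obtain v where v: "v \<in> carrier (germs_of \<Q> \<B>)"
    "v \<otimes>\<^bsub>germs_of \<Q> \<B>\<^esub> qgerm P (\<lambda>y. 1 - m y) = \<one>\<^bsub>germs_of \<Q> \<B>\<^esub>"
    using local_ring_inverse[OF loc M' c] by blast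
  obtain u where "u \<in> \<B>" "v = qgerm P u" using v(1) by auto
  then show ?thesis using v(2) by (auto simp: germ_ops germ_eq_iff)
qed

text \<open>The ring is local, so M is the maximal ideal of germs vanishing at 0 that the definition
  of a reference ring singles out. Membership in M thereby becomes numerical smallness.\<close>

lemma maximal_tendsto_0:
  assumes M: "maximalideal M (sub_ring (qring P) B)" and m: "m \<in> germ_reps \<Q> M"
  shows "(m \<longlongrightarrow> 0) \<Q>"
proof -
  have "M = {a\<in>B. vanishes_at_0 P a}"
    using ref M unfolding reference_ring_def local_ring_def by blast
  then have "vanishes_at_0 P (qgerm P m)" using m by (simp add: mem_germ_reps)
  then obtain f where "eventually (\<lambda>y. f y = m y) \<Q>" "(f \<longlongrightarrow> 0) \<Q>"
    unfolding vanishes_at_0_def mem_germ[symmetric] by blast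
  then show ?thesis using tendsto_cong by blast
qed

lemma diff_ideal_iff:
  assumes G: "G \<in> \<B>"
  shows "qgerm P f \<in> diff_ideal P B \<xi> (qgerm P G) \<longleftrightarrow> (\<exists>n. spanned \<Q> \<B> (\<lambda>i. (D ^^ i) G) {..<n} f)"
proof -
  have "qgerm P f \<in> diff_ideal P B \<xi> (qgerm P G) \<longleftrightarrow>
    (\<exists>T\<subseteq>UNIV. finite T \<and> spanned \<Q> \<B> (\<lambda>i. (D ^^ i) G) T f)"
    unfolding diff_ideal_def vf_apply_iterate_germ sub_ring_eq
    by (rule genideal_germs[OF B_ring]) (rule D_iterate_closed[OF G])
  also have "\<dots> \<longleftrightarrow> (\<exists>n. spanned \<Q> \<B> (\<lambda>i. (D ^^ i) G) {..<n} f)"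
  proof
    assume "\<exists>T\<subseteq>UNIV. finite T \<and> spanned \<Q> \<B> (\<lambda>i. (D ^^ i) G) T f"
    then obtain T where T: "finite T" "spanned \<Q> \<B> (\<lambda>i. (D ^^ i) G) T f" by blast
    obtain n where "T \<subseteq> {..<n}" using finite_nat_iff_bounded T(1) by blast
    then show "\<exists>n. spanned \<Q> \<B> (\<lambda>i. (D ^^ i) G) {..<n} f"
      using spanned_mono[OF B_ring _ _ T(2)] by blast
  qed blast
  finally show ?thesis .
qed

lemma diff_ideal_subset:
  assumes G: "G \<in> \<B>" shows "diff_ideal P B \<xi> (qgerm P G) \<subseteq> B"
proof -
  interpret cring "germs_of \<Q> \<B>" by (rule germs_of_cring[OF B_ring])
  have "range (\<lambda>n. (vf_apply P \<xi> ^^ n) (qgerm P G)) \<subseteq> carrier (germs_of \<Q> \<B>)"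
    using D_iterate_closed[OF G] by (auto simp: vf_apply_iterate_germ)
  from ideal.Icarr[OF genideal_ideal[OF this]] show ?thesis
    unfolding diff_ideal_def sub_ring_eq by (auto simp: germ_reps_image)
qed

lemma restr_qgerm:
  assumes "W \<subseteq> quadrant P" shows "restr W (qgerm P f) = germ (near0 W) f"
  by (rule restr_germ[OF near0_mono[OF assms]])

lemma restr_B:
  assumes "W \<subseteq> quadrant P" shows "restr W ` B = germ (near0 W) ` \<B>"
proof -
  have "restr W ` B = restr W ` qgerm P ` \<B>" by (simp add: germ_reps_image)
  then show ?thesis by (simp add: image_image restr_qgerm[OF assms])
qed

lemma restr_diff_ideal_iff:
  assumes W: "W \<subseteq> quadrant P" and G: "G \<in> \<B>"
  shows "germ (near0 W) f \<in> restr W ` diff_ideal P B \<xi> (qgerm P G) \<longleftrightarrow>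
    (\<exists>n. spanned (near0 W) \<B> (\<lambda>i. (D ^^ i) G) {..<n} f)"
proof
  assume "germ (near0 W) f \<in> restr W ` diff_ideal P B \<xi> (qgerm P G)"
  then obtain a where a: "a \<in> diff_ideal P B \<xi> (qgerm P G)" "germ (near0 W) f = restr W a" by blast
  then obtain f' where f': "a = qgerm P f'" using diff_ideal_subset[OF G] B_sub by blast
  then obtain n where "spanned \<Q> \<B> (\<lambda>i. (D ^^ i) G) {..<n} f'"
    using a(1) diff_ideal_iff[OF G] by blast
  then have "spanned (near0 W) \<B> (\<lambda>i. (D ^^ i) G) {..<n} f'"
    by (rule spanned_le[OF _ near0_mono[OF W]])
  moreover have "eventually (\<lambda>y. f y = f' y) (near0 W)"
    using a(2) unfolding f' restr_qgerm[OF W] germ_eq_iff .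
  ultimately show "\<exists>n. spanned (near0 W) \<B> (\<lambda>i. (D ^^ i) G) {..<n} f" using spanned_cong by blast
next
  assume "\<exists>n. spanned (near0 W) \<B> (\<lambda>i. (D ^^ i) G) {..<n} f"
  then obtain n b where b: "\<forall>i\<in>{..<n}. b i \<in> \<B>"
    "eventually (\<lambda>y. f y = (\<Sum>i<n. b i y * (D ^^ i) G y)) (near0 W)"
    unfolding spanned_def by blast
  define f' where "f' y = (\<Sum>i<n. b i y * (D ^^ i) G y)" for y
  have "spanned \<Q> \<B> (\<lambda>i. (D ^^ i) G) {..<n} f'"
    unfolding spanned_def f'_def using b(1) by (intro exI[of _ b]) simp
  then have "qgerm P f' \<in> diff_ideal P B \<xi> (qgerm P G)" using diff_ideal_iff[OF G] by blast
  moreover have "germ (near0 W) f = restr W (qgerm P f')"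
    using b(2) unfolding restr_qgerm[OF W] germ_eq_iff f'_def .
  ultimately show "germ (near0 W) f \<in> restr W ` diff_ideal P B \<xi> (qgerm P G)" by blast
qed

text \<open>Finitely many generators involve finitely many iterates of G, so an initial segment of
  the iterates generates. Conversely, relations for all iterates reduce every combination to the
  first l of them.\<close>

lemma restr_fin_gen_iff:
  assumes W: "W \<subseteq> quadrant P" and G: "G \<in> \<B>"
  shows "restr_fin_gen P B \<xi> W (qgerm P G) \<longleftrightarrow>
    (\<exists>l. \<forall>i. spanned (near0 W) \<B> (\<lambda>i. (D ^^ i) G) {..<l} ((D ^^ i) G))"
proof
  let ?e = "\<lambda>i. (D ^^ i) G"
  let ?J = "restr W ` diff_ideal P B \<xi> (qgerm P G)"
  note J_iff = restr_diff_ideal_iff[OF W G]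
  {
    assume "restr_fin_gen P B \<xi> W (qgerm P G)"
    then obtain S where S: "finite S" "S \<subseteq> germ (near0 W) ` \<B>" "?J = Idl\<^bsub>germs_of (near0 W) \<B>\<^esub> S"
      unfolding restr_fin_gen_def fin_gen_ideal_def restr_B[OF W] by auto
    have "\<forall>s\<in>S. \<exists>g. g \<in> \<B> \<and> s = germ (near0 W) g" using S(2) by blast
    then obtain g where g: "\<And>s. s \<in> S \<Longrightarrow> g s \<in> \<B>" "\<And>s. s \<in> S \<Longrightarrow> s = germ (near0 W) (g s)" by metis
    have S_image: "S = (\<lambda>s. germ (near0 W) (g s)) ` S" using g(2) by force
    interpret cring "germs_of (near0 W) \<B>" by (rule germs_of_cring[OF B_ring])
    have "\<exists>n. spanned (near0 W) \<B> ?e {..<n} (g s)" if "s \<in> S" for s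
    proof -
      have "s \<in> ?J" unfolding S(3) using genideal_self[of S] S(2) that by auto
      then show ?thesis using J_iff g(2)[OF that] by metis
    qed
    then obtain n where n: "\<And>s. s \<in> S \<Longrightarrow> spanned (near0 W) \<B> ?e {..<n s} (g s)" by metis
    \<comment> \<open>The 0 covers an empty set of generators, in which case all iterates vanish on
      W near 0.\<close>
    define l where "l = Max (insert 0 (n ` S))"
    have l: "spanned (near0 W) \<B> ?e {..<l} (g s)" if "s \<in> S" for s
    proof (rule spanned_mono[OF B_ring _ _ n[OF that]])
      have "n s \<le> l" unfolding l_def using S(1) that by (intro Max_ge) auto
      then show "{..<n s} \<subseteq> {..<l}" by auto
    qed simp
    have "spanned (near0 W) \<B> ?e {..<l} (?e i)" for i
    proof -
      have "spanned (near0 W) \<B> ?e {..<Suc i} (?e i)" by (rule spanned_base[OF B_ring]) auto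
      then have "germ (near0 W) (?e i) \<in> ?J" using J_iff by blast
      then have "germ (near0 W) (?e i) \<in> Idl\<^bsub>germs_of (near0 W) \<B>\<^esub> ((\<lambda>s. germ (near0 W) (g s)) ` S)"
        using S(3) S_image by simp
      then obtain T where T: "T \<subseteq> S" "spanned (near0 W) \<B> g T (?e i)"
        using genideal_germs[where A = S and e = g and F = "near0 W", OF B_ring g(1)] by blast
      show ?thesis by (rule spanned_trans[OF B_ring T(2)]) (use l T(1) in blast)
    qed
    then show "\<exists>l. \<forall>i. spanned (near0 W) \<B> ?e {..<l} (?e i)" by blast
  next
    assume "\<exists>l. \<forall>i. spanned (near0 W) \<B> ?e {..<l} (?e i)"
    then obtain l where l: "\<And>i. spanned (near0 W) \<B> ?e {..<l} (?e i)" by blast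
    interpret cring "germs_of (near0 W) \<B>" by (rule germs_of_cring[OF B_ring])
    define S where "S = (\<lambda>i. germ (near0 W) (?e i)) ` {..<l}"
    have S: "finite S" "S \<subseteq> carrier (germs_of (near0 W) \<B>)"
      using D_iterate_closed[OF G] by (auto simp: S_def)
    have idl_iff: "germ (near0 W) f \<in> Idl\<^bsub>germs_of (near0 W) \<B>\<^esub> S \<longleftrightarrow>
        (\<exists>T\<subseteq>{..<l}. finite T \<and> spanned (near0 W) \<B> ?e T f)" for f
      unfolding S_def by (rule genideal_germs[OF B_ring]) (rule D_iterate_closed[OF G])
    have iff: "germ (near0 W) f \<in> ?J \<longleftrightarrow> germ (near0 W) f \<in> Idl\<^bsub>germs_of (near0 W) \<B>\<^esub> S" for f
    proof
      assume "germ (near0 W) f \<in> ?J"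
      then obtain n where "spanned (near0 W) \<B> ?e {..<n} f" using J_iff by blast
      then have "spanned (near0 W) \<B> ?e {..<l} f" using l by (rule spanned_trans[OF B_ring])
      then show "germ (near0 W) f \<in> Idl\<^bsub>germs_of (near0 W) \<B>\<^esub> S" using idl_iff by blast
    next
      assume "germ (near0 W) f \<in> Idl\<^bsub>germs_of (near0 W) \<B>\<^esub> S"
      then obtain T where T: "T \<subseteq> {..<l}" "spanned (near0 W) \<B> ?e T f" using idl_iff by blast
      have "spanned (near0 W) \<B> ?e {..<l} f" by (rule spanned_mono[OF B_ring _ T]) simp
      then show "germ (near0 W) f \<in> ?J" using J_iff by blast
    qed
    have "?J \<subseteq> restr W ` B" using diff_ideal_subset[OF G] by blast
    then have J: "?J \<subseteq> range (germ (near0 W))" unfolding restr_B[OF W] by blast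
    have I: "Idl\<^bsub>germs_of (near0 W) \<B>\<^esub> S \<subseteq> range (germ (near0 W))"
      using ideal.Icarr[OF genideal_ideal[OF S(2)]] by auto
    have "?J = Idl\<^bsub>germs_of (near0 W) \<B>\<^esub> S"
    proof (intro equalityI subsetI)
      fix x assume x: "x \<in> ?J"
      then obtain f where "x = germ (near0 W) f" using J by blast
      then show "x \<in> Idl\<^bsub>germs_of (near0 W) \<B>\<^esub> S" using x iff by simp
    next
      fix x assume x: "x \<in> Idl\<^bsub>germs_of (near0 W) \<B>\<^esub> S"
      then obtain f where "x = germ (near0 W) f" using I by blast
      then show "x \<in> ?J" using x iff by simp
    qed
    then show "restr_fin_gen P B \<xi> W (qgerm P G)"
      unfolding restr_fin_gen_def fin_gen_ideal_def restr_B[OF W] using S by blast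
  }
qed

text \<open>By Leibniz' rule \<open>b * (D ^^ i) G\<close> gives
  \<open>D b * (D ^^ i) G + b * (D ^^ Suc i) G\<close>: stability keeps both coefficients in the
  ideal, and one more iterate appears. The relation holds on W only, and invariance of W allows it
  to be differentiated.\<close>

lemma spanned_deriv:
  assumes M: "function_ideal \<B> \<M>" and M_stable: "\<And>m. m \<in> \<M> \<Longrightarrow> D m \<in> \<M>"
    and W: "invariant_germ P \<xi> W" "W \<subseteq> quadrant P" and G: "G \<in> \<B>" and f: "f \<in> \<B>"
    and s: "spanned (near0 W) \<M> (\<lambda>i. (D ^^ i) G) {..<n} f"
  shows "spanned (near0 W) \<M> (\<lambda>i. (D ^^ i) G) {..<Suc n} (D f)"
proof -
  let ?e = "\<lambda>i. (D ^^ i) G"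
  obtain b where b: "\<forall>i\<in>{..<n}. b i \<in> \<M>" "eventually (\<lambda>y. f y = (\<Sum>i<n. b i y * ?e i y)) (near0 W)"
    using s unfolding spanned_def by blast
  have bB: "b i \<in> \<B>" if "i < n" for i using b(1) function_ideal_closed(1)[OF M] that by blast
  have eB: "?e i \<in> \<B>" for i by (rule D_iterate_closed[OF G])
  have be: "(\<lambda>y. b i y * ?e i y) \<in> \<B>" if "i < n" for i
    by (rule function_ring_closed(4)[OF B_ring bB[OF that] eB])
  have "(\<lambda>y. \<Sum>i<n. b i y * ?e i y) \<in> \<B>" using be by (intro function_ring_sum[OF B_ring]) auto
  then have 1: "eventually (\<lambda>y. D f y = D (\<lambda>y. \<Sum>i<n. b i y * ?e i y) y) (near0 W)"
    using D_cong_on_invariant[OF W f _ b(2)] by blast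
  have "eventually (\<lambda>y. D (\<lambda>y. \<Sum>i<n. b i y * ?e i y) y = (\<Sum>i<n. D (\<lambda>y. b i y * ?e i y) y)) \<Q>"
    using be by (intro D_sum) auto
  moreover have "eventually (\<lambda>y. \<forall>i\<in>{..<n}. D (\<lambda>y. b i y * ?e i y) y = D (b i) y * ?e i y + b i y * D (?e i) y) \<Q>"
    using D_mult[OF bB eB] by (intro eventually_ball_finite ballI) auto
  ultimately have "eventually (\<lambda>y. D (\<lambda>y. \<Sum>i<n. b i y * ?e i y) y
      = (\<Sum>i<n. D (b i) y * ?e i y + b i y * ?e (Suc i) y)) \<Q>"
    by eventually_elim simp
  from filter_leD[OF near0_mono[OF W(2)] this] 1
  have eq: "eventually (\<lambda>y. D f y = (\<Sum>i<n. D (b i) y * ?e i y + b i y * ?e (Suc i) y)) (near0 W)"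
    by eventually_elim simp
  have base: "spanned (near0 W) \<B> ?e {..<Suc n} (?e i)" if "i < Suc n" for i
    by (rule spanned_base[OF B_ring]) (use that in auto)
  have "spanned (near0 W) \<M> ?e {..<Suc n} (\<lambda>y. \<Sum>i<n. D (b i) y * ?e i y + b i y * ?e (Suc i) y)"
    using b(1) M_stable
    by (intro spanned_ideal_sum[OF M] spanned_ideal_add[OF M] spanned_ideal_mult[OF M] base) auto
  then show ?thesis using eq by (rule spanned_cong)
qed

lemma spanned_diff_iterate:
  assumes M: "function_ideal \<B> \<M>" and M_stable: "\<And>m. m \<in> \<M> \<Longrightarrow> D m \<in> \<M>"
    and W: "invariant_germ P \<xi> W" "W \<subseteq> quadrant P" and F: "F \<in> \<B>" and G: "G \<in> \<B>"
    and s: "spanned (near0 W) \<M> (\<lambda>i. (D ^^ i) G) {..<n} (\<lambda>y. F y - G y)"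
  shows "spanned (near0 W) \<M> (\<lambda>i. (D ^^ i) G) {..<n + k} (\<lambda>y. (D ^^ k) F y - (D ^^ k) G y)"
proof (induction k)
  case (Suc k)
  let ?d = "\<lambda>y. (D ^^ k) F y - (D ^^ k) G y"
  have d: "?d \<in> \<B>" by (rule function_ring_diff[OF B_ring D_iterate_closed[OF F] D_iterate_closed[OF G]])
  have "spanned (near0 W) \<M> (\<lambda>i. (D ^^ i) G) {..<Suc (n + k)} (D ?d)"
    by (rule spanned_deriv[OF M M_stable W G d Suc])
  \<comment> \<open>The k-th iterate of F is the difference plus the k-th iterate of G, so
    additivity of \<open>D\<close> replaces a rule for differences.\<close>
  moreover have "eventually (\<lambda>y. D (\<lambda>y. ?d y + (D ^^ k) G y) y = D ?d y + D ((D ^^ k) G) y) \<Q>"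
    by (rule D_add[OF d D_iterate_closed[OF G]])
  then have "eventually (\<lambda>y. (D ^^ Suc k) F y - (D ^^ Suc k) G y = D ?d y) \<Q>"
    by eventually_elim simp
  then have "eventually (\<lambda>y. (D ^^ Suc k) F y - (D ^^ Suc k) G y = D ?d y) (near0 W)"
    by (rule filter_leD[OF near0_mono[OF W(2)]])
  ultimately show ?case using spanned_cong by simp
qed (use s in simp)

end

section \<open>Passage from g to its perturbation f\<close>

context chi_setting
begin

lemma perturbed_spanned:
  assumes M: "maximalideal M (sub_ring (qring P) B)"
    and M0: "ideal M0 (sub_ring (qring P) B)" "M0 \<subseteq> M" "vf_stable P \<xi> M0"
    and W: "invariant_germ P \<xi> W" "W \<subseteq> quadrant P" and F: "F \<in> \<B>" and G: "G \<in> \<B>"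
    and s: "spanned (near0 W) (germ_reps \<Q> M0) (\<lambda>i. (D ^^ i) G) {..<n} (\<lambda>y. F y - G y)"
    and span_G: "\<And>i. spanned (near0 W) \<B> (\<lambda>i. (D ^^ i) G) {..<l} ((D ^^ i) G)"
  shows "\<exists>m. (\<forall>k. \<forall>i<l. m k i \<in> germ_reps \<Q> M0) \<and>
    (\<forall>k. eventually (\<lambda>y. (D ^^ k) F y = (D ^^ k) G y + (\<Sum>i<l. m k i y * (D ^^ i) G y)) (near0 W)) \<and>
    (\<forall>i. spanned (near0 W) \<B> (\<lambda>i. (D ^^ i) F) {..<l} ((D ^^ i) F)) \<and>
    spanned (near0 W) \<B> (\<lambda>i. (D ^^ i) G) {..<l} F"
proof -
  let ?M = "germ_reps \<Q> M0"
  let ?e = "\<lambda>i. (D ^^ i) G" and ?f = "\<lambda>i. (D ^^ i) F"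
  have fi: "function_ideal \<B> ?M" by (rule function_ideal_reps[OF M0(1)])
  \<comment> \<open>Differentiation raises the number of iterates to n + k; \<open>span_G\<close>
    brings it back to l, with coefficients still in the ideal.\<close>
  have diff: "spanned (near0 W) ?M ?e {..<l} (\<lambda>y. ?f k y - ?e k y)" for k
    by (rule spanned_ideal_trans[OF fi spanned_diff_iterate[OF fi stable_D[OF M0(3)] W F G s] span_G])
  have "\<forall>k. \<exists>b. (\<forall>i\<in>{..<l}. b i \<in> ?M) \<and> eventually (\<lambda>y. ?f k y - ?e k y = (\<Sum>i<l. b i y * ?e i y)) (near0 W)"
    using diff unfolding spanned_def by blast
  from choice[OF this] obtain m where m: "\<forall>k. (\<forall>i\<in>{..<l}. m k i \<in> ?M) \<and>
      eventually (\<lambda>y. ?f k y - ?e k y = (\<Sum>i<l. m k i y * ?e i y)) (near0 W)" by blast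
  have mM: "m k i \<in> ?M" if "i < l" for k i using m that by blast
  have m_eq: "eventually (\<lambda>y. ?f k y - ?e k y = (\<Sum>i<l. m k i y * ?e i y)) (near0 W)" for k using m by blast
  \<comment> \<open>The relations are read backwards: an iterate of G is the same iterate of F plus
    a combination of iterates of G with coefficients in \<open>M0\<close>. The minus sign is written
    as a product with -1, which the ideal absorbs.\<close>
  have e_f: "spanned (near0 W) \<B> ?f {..<l} (?e k)" if k: "k < l" for k
  proof (rule nakayama_spanned[OF B_ring function_ideal_closed(1)[OF fi], where n = l and e = ?e and f = ?f
        and m = "\<lambda>k i y. - 1 * m k i y"])
    show "(\<lambda>y. a y + b y) \<in> ?M" if "a \<in> ?M" "b \<in> ?M" for a b
      by (rule function_ideal_closed(3)[OF fi that])
    show c: "(\<lambda>y. a y * b y) \<in> ?M" if "a \<in> \<B>" "b \<in> ?M" for a b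
      by (rule function_ideal_closed(4)[OF fi that])
    show "\<exists>u\<in>\<B>. eventually (\<lambda>y. u y * (1 - a y) = 1) (near0 W)" if "a \<in> ?M" for a
    proof -
      have "a \<in> germ_reps \<Q> M" using that M0(2) by (auto simp: mem_germ_reps)
      then show ?thesis using local_inverse[OF M] filter_leD[OF near0_mono[OF W(2)]] by blast
    qed
    show "spanned (near0 W) \<B> ?f {..<l} (?f k)" if "k < l" for k
      by (rule spanned_base[OF B_ring]) (use that in auto)
    show "(\<lambda>y. - 1 * m k i y) \<in> ?M" if "k < l" "i < l" for k i
      by (rule c[OF function_ring_closed(2)[OF B_ring function_ring_closed(1)[OF B_ring]] mM[OF that(2)]])
    show "eventually (\<lambda>y. ?e k y = ?f k y + (\<Sum>i<l. - 1 * m k i y * ?e i y)) (near0 W)" for k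
      using m_eq[of k] by eventually_elim (simp add: sum_negf)
  qed (rule k)
  show ?thesis
  proof (intro exI[of _ m] conjI allI impI)
    show "m k i \<in> ?M" if "i < l" for k i by (rule mM[OF that])
    show "eventually (\<lambda>y. ?f k y = ?e k y + (\<Sum>i<l. m k i y * ?e i y)) (near0 W)" for k
      using m_eq[of k] by eventually_elim simp
    have diff': "spanned (near0 W) \<B> ?e {..<l} (\<lambda>y. ?f i y - ?e i y)" for i
      by (rule spanned_subset[OF diff function_ideal_closed(1)[OF fi]])
    have f_e: "spanned (near0 W) \<B> ?e {..<l} (?f i)" for i
      by (rule spanned_cong[OF spanned_add[OF B_ring diff'[of i] span_G[of i]]]) simp
    show "spanned (near0 W) \<B> ?f {..<l} (?f i)" for i
      by (rule spanned_trans[OF B_ring f_e[of i]]) (use e_f in auto)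
    show "spanned (near0 W) \<B> ?e {..<l} F" using f_e[of 0] by simp
  qed
qed

text \<open>A product ideal consists of finite sums of products, each a combination of iterates of G
  with coefficients in \<open>M0\<close>, and the germ from the vanishing ideal disappears on
  \<open>U0\<close>. Every representative F is covered, because an analytic one is chosen
  afterwards.\<close>

lemma perturbation_class_spanned:
  assumes M0: "ideal M0 (sub_ring (qring P) B)" and B0: "B0 \<subseteq> B" and U0: "U0 \<subseteq> quadrant P"
    and f: "f \<in> perturbation_class P B \<xi> U0 B0 M0"
  obtains G n where "G \<in> germ_reps \<Q> B0" "f \<in> B"
    "\<And>F. f = qgerm P F \<Longrightarrow>
      spanned (near0 U0) (germ_reps \<Q> M0) (\<lambda>i. (D ^^ i) G) {..<n} (\<lambda>y. F y - G y)"
proof -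
  let ?M = "germ_reps \<Q> M0"
  let ?R = "sub_ring (qring P) B"
  have fi: "function_ideal \<B> ?M" by (rule function_ideal_reps[OF M0])
  obtain g p v where g: "g \<in> B0" and p: "p \<in> ideal_prod ?R M0 (diff_ideal P B \<xi> g)"
    and v: "v \<in> vanishing_ideal B U0" and f_eq: "f = g \<oplus>\<^bsub>?R\<^esub> (p \<oplus>\<^bsub>?R\<^esub> v)"
    using f unfolding perturbation_class_def Let_def a_l_coset_def' set_add_def' by blast
  obtain G where G: "g = qgerm P G" using g B0 B_sub by blast
  have GB: "G \<in> \<B>" "G \<in> germ_reps \<Q> B0" using g B0 unfolding G mem_germ_reps by auto
  let ?e = "\<lambda>i. (D ^^ i) G"
  have "\<exists>\<phi> n. \<phi> \<in> \<B> \<and> p = qgerm P \<phi> \<and> spanned \<Q> ?M ?e {..<n} \<phi>"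
    using p
  proof (induction rule: ideal_prod.induct)
    case (prod i j)
    have "i \<in> B" using ideal.Icarr[OF M0 prod(1)] by simp
    then obtain m where m: "i = qgerm P m" using B_sub by blast
    have "j \<in> B" using prod(2) diff_ideal_subset[OF GB(1)] unfolding G by blast
    then obtain \<psi> where \<psi>: "j = qgerm P \<psi>" using B_sub by blast
    obtain n where n: "spanned \<Q> \<B> ?e {..<n} \<psi>"
      using prod(2) diff_ideal_iff[OF GB(1)] unfolding G \<psi> by blast
    have "m \<in> ?M" using prod(1) by (simp add: m mem_germ_reps)
    then have "spanned \<Q> ?M ?e {..<n} (\<lambda>y. m y * \<psi> y)" using n by (rule spanned_ideal_mult[OF fi])
    moreover have "(\<lambda>y. m y * \<psi> y) \<in> \<B>"
      using \<open>i \<in> B\<close> \<open>j \<in> B\<close> by (intro function_ring_closed(4)[OF B_ring]) (auto simp: m \<psi> mem_germ_reps)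
    ultimately show ?case by (intro exI[of _ "\<lambda>y. m y * \<psi> y"] exI[of _ n]) (simp add: m \<psi> germ_mult)
  next
    case (sum s1 s2)
    obtain \<phi> n where \<phi>: "\<phi> \<in> \<B>" "s1 = qgerm P \<phi>" "spanned \<Q> ?M ?e {..<n} \<phi>" using sum.IH(1) by blast
    obtain \<psi> k where \<psi>: "\<psi> \<in> \<B>" "s2 = qgerm P \<psi>" "spanned \<Q> ?M ?e {..<k} \<psi>" using sum.IH(2) by blast
    have base: "spanned \<Q> \<B> ?e {..<max n k} (?e i)" if "i < max n k" for i
      by (rule spanned_base[OF B_ring]) (use that in auto)
    have "spanned \<Q> ?M ?e {..<max n k} (\<lambda>y. \<phi> y + \<psi> y)"
      by (intro spanned_ideal_add[OF fi] spanned_ideal_trans[OF fi \<phi>(3)] spanned_ideal_trans[OF fi \<psi>(3)] base) auto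
    moreover have "(\<lambda>y. \<phi> y + \<psi> y) \<in> \<B>" by (rule function_ring_closed(3)[OF B_ring \<phi>(1) \<psi>(1)])
    ultimately show ?case
      by (intro exI[of _ "\<lambda>y. \<phi> y + \<psi> y"] exI[of _ "max n k"]) (simp add: \<phi>(2) \<psi>(2) germ_add)
  qed
  then obtain \<phi> n where \<phi>: "\<phi> \<in> \<B>" "p = qgerm P \<phi>" "spanned \<Q> ?M ?e {..<n} \<phi>" by blast
  have "v \<in> B" using v unfolding vanishing_ideal_def by blast
  then obtain \<nu> where \<nu>: "v = qgerm P \<nu>" using B_sub by blast
  have \<nu>0: "eventually (\<lambda>y. \<nu> y = 0) (near0 U0)"
  proof -
    have "germ (near0 U0) \<nu> = germ (near0 U0) (\<lambda>_. 0)"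
      using v unfolding vanishing_ideal_def \<nu> germ_zero restr_qgerm[OF U0, symmetric] by blast
    then show ?thesis by (simp add: germ_eq_iff)
  qed
  have f_germ: "f = qgerm P (\<lambda>y. G y + (\<phi> y + \<nu> y))" by (simp add: f_eq G \<phi>(2) \<nu> germ_add)
  show thesis
  proof (rule that[OF GB(2)])
    have "(\<lambda>y. G y + (\<phi> y + \<nu> y)) \<in> \<B>"
      using GB(1) \<phi>(1) \<open>v \<in> B\<close> by (intro function_ring_closed(3)[OF B_ring]) (auto simp: \<nu> mem_germ_reps)
    then show "f \<in> B" by (simp add: f_germ mem_germ_reps)
    fix F assume "f = qgerm P F"
    then have "qgerm P F = qgerm P (\<lambda>y. G y + (\<phi> y + \<nu> y))" using f_germ by simp
    then have "eventually (\<lambda>y. F y = G y + (\<phi> y + \<nu> y)) \<Q>" by (simp add: germ_eq_iff)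
    from filter_leD[OF near0_mono[OF U0] this] \<nu>0
    have "eventually (\<lambda>y. F y - G y = \<phi> y) (near0 U0)" by eventually_elim simp
    with spanned_le[OF \<phi>(3) near0_mono[OF U0]]
    show "spanned (near0 U0) ?M ?e {..<n} (\<lambda>y. F y - G y)" by (rule spanned_cong)
  qed
qed

text \<open>The finite and the locally finite case are treated together: Q records what else is
  known about the subdivision, and it passes through unchanged because f keeps the pieces found for
  g.\<close>

lemma perturbation_finite:
  assumes M: "maximalideal M (sub_ring (qring P) B)"
    and M0: "ideal M0 (sub_ring (qring P) B)" "M0 \<subseteq> M" "vf_stable P \<xi> M0"
    and U0: "U0 \<subseteq> quadrant P" "invariant_germ P \<xi> U0"
    and B0: "subalgebra_of P B0 B" "vf_stable P \<xi> B0"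
    and reg: "\<And>h. h \<in> B0 \<Longrightarrow> chi_regular P \<xi> U0 h"
    and loc: "\<And>g. g \<in> B0 \<Longrightarrow> \<exists>\<U>. finite \<U> \<and> \<Union>\<U> = U0 \<and> Q \<U> \<and>
      (\<forall>W\<in>\<U>. invariant_germ P \<xi> W \<and> restr_fin_gen P B \<xi> W g)"
    and f: "f \<in> perturbation_class P B \<xi> U0 B0 M0"
  shows "chi_regular P \<xi> U0 f \<and>
    (\<exists>\<U>. finite \<U> \<and> \<Union>\<U> = U0 \<and> Q \<U> \<and> (\<forall>W\<in>\<U>. invariant_germ P \<xi> W \<and> restr_fin_gen P B \<xi> W f))"
proof -
  let ?M = "germ_reps \<Q> M0"
  have B0B: "B0 \<subseteq> B" and B0_ring: "function_ring (germ_reps \<Q> B0)"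
    using B0(1) unfolding subalgebra_of_def by (blast intro: function_ring_reps)+
  obtain G n where G: "G \<in> germ_reps \<Q> B0" and fB: "f \<in> B" and
    span: "\<And>F. f = qgerm P F \<Longrightarrow> spanned (near0 U0) ?M (\<lambda>i. (D ^^ i) G) {..<n} (\<lambda>y. F y - G y)"
    using perturbation_class_spanned[OF M0(1) B0B U0(1) f] by blast
  have GB: "G \<in> \<B>" using G B0B by (auto simp: mem_germ_reps)
  \<comment> \<open>The degree of the zero set admits only representatives that are analytic on the
    admissible set.\<close>
  obtain F r1 where F: "f = qgerm P F" "0 < r1" "real_analytic_on F (corner P r1)"
    by (rule analytic_representative[OF fB])
  have FB: "F \<in> \<B>" using fB F(1) by (simp add: mem_germ_reps)
  have "qgerm P G \<in> B0" using G by (simp add: mem_germ_reps)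
  from loc[OF this] obtain \<U> where \<U>: "finite \<U>" "\<Union>\<U> = U0" "Q \<U>"
    and \<U>_fin: "\<And>W. W \<in> \<U> \<Longrightarrow> invariant_germ P \<xi> W" "\<And>W. W \<in> \<U> \<Longrightarrow> restr_fin_gen P B \<xi> W (qgerm P G)"
    by blast
  \<comment> \<open>Both closure properties of \<open>B0\<close> enter here: stability under the
    field for the iterates, the ring structure for their squares and differences.\<close>
  have reg_d: "chi_regular P \<xi> U0 (qgerm P (\<lambda>y. ((D ^^ i) G y)\<^sup>2 - ((D ^^ j) G y)\<^sup>2))" for i j
  proof -
    have "(\<lambda>y. (D ^^ i) G y * (D ^^ i) G y - (D ^^ j) G y * (D ^^ j) G y) \<in> germ_reps \<Q> B0"
      by (intro function_ring_diff[OF B0_ring] function_ring_closed(4)[OF B0_ring] stable_iterate[OF B0(2) G])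
    then show ?thesis using reg by (simp add: mem_germ_reps power2_eq_square)
  qed
  have W: "restr_fin_gen P B \<xi> W f \<and> (\<exists>N \<rho>. zeros_bounded_on W F N \<rho>)" if WU: "W \<in> \<U>" for W
  proof -
    have inv: "invariant_germ P \<xi> W" using \<U>_fin(1) WU .
    have sub: "W \<subseteq> U0" "W \<subseteq> quadrant P" using WU \<U>(2) U0(1) by auto
    obtain l where l: "\<And>i. spanned (near0 W) \<B> (\<lambda>i. (D ^^ i) G) {..<l} ((D ^^ i) G)"
      using \<U>_fin(2)[OF WU] restr_fin_gen_iff[OF sub(2) GB] by blast
    have s: "spanned (near0 W) ?M (\<lambda>i. (D ^^ i) G) {..<n} (\<lambda>y. F y - G y)"
      by (rule spanned_le[OF span[OF F(1)] near0_mono[OF sub(1)]])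
    obtain m where m: "\<And>k i. i < l \<Longrightarrow> m k i \<in> ?M"
      "\<And>k. eventually (\<lambda>y. (D ^^ k) F y = (D ^^ k) G y + (\<Sum>i<l. m k i y * (D ^^ i) G y)) (near0 W)"
      and span_F: "\<And>i. spanned (near0 W) \<B> (\<lambda>i. (D ^^ i) F) {..<l} ((D ^^ i) F)"
      "spanned (near0 W) \<B> (\<lambda>i. (D ^^ i) G) {..<l} F"
      using perturbed_spanned[OF M M0 inv sub(2) FB GB s l] by blast
    have "(m k i \<longlongrightarrow> 0) \<Q>" if "i < l" for k i
      using m(1)[OF that, of k] M0(2) by (intro maximal_tendsto_0[OF M]) (auto simp: mem_germ_reps)
    then have "\<exists>N \<rho>. zeros_bounded_on W F N \<rho>"
      by (intro zeros_on_orbits_bounded[OF inv sub FB GB reg_d span_F(2) l _ m(2)])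
    moreover have "restr_fin_gen P B \<xi> W f"
      unfolding F(1) restr_fin_gen_iff[OF sub(2) FB] using span_F(1) by blast
    ultimately show ?thesis by blast
  qed
  then obtain N \<rho> where N: "\<And>W. W \<in> \<U> \<Longrightarrow> zeros_bounded_on W F (N W) (\<rho> W)" by metis
  obtain r2 where r2: "0 < r2" "\<And>r y. r \<le> r2 \<Longrightarrow> y \<in> U0 \<Longrightarrow> y \<in> corner P r \<Longrightarrow> orbit X (corner P r) y \<subseteq> U0"
    using invariant_corner[OF U0(2)] by blast
  obtain r3 where r3: "0 < r3" "\<And>r. 0 < r \<Longrightarrow> r \<le> r3 \<Longrightarrow> admissible P \<xi> (corner P r) X"
    using field_corner by meson
  define R where "R = insert r1 (insert r2 (insert r3 (\<rho> ` \<U>)))"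
  have R: "finite R" "R \<noteq> {}" "\<And>x. x \<in> R \<Longrightarrow> 0 < x"
    using F(2) r2 r3 N \<U>(1) by (auto simp: R_def zeros_bounded_on_def)
  define r where "r = Min R"
  have r_le: "r \<le> x" if "x \<in> R" for x unfolding r_def using R(1) that by (rule Min_le)
  have r: "0 < r" "r \<le> r1" "r \<le> r2" "r \<le> r3" "\<And>W. W \<in> \<U> \<Longrightarrow> r \<le> \<rho> W"
  proof -
    show "0 < r" using R Min_in unfolding r_def by blast
    show "r \<le> r1" "r \<le> r2" "r \<le> r3" by (rule r_le; simp add: R_def)+
    show "r \<le> \<rho> W" if "W \<in> \<U>" for W by (rule r_le) (use that in \<open>simp add: R_def\<close>)
  qed
  \<comment> \<open>The orbit of a point of W has at most \<open>N W\<close> components of zeros;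
    the sum is a common bound for the finitely many pieces.\<close>
  define N0 where "N0 = sum N \<U>"
  have "zero_degree P \<xi> U0 f \<le> proj_degree_on X (corner P r) ({y\<in>corner P r. F y = 0} \<inter> U0)"
    unfolding zero_degree_def
  proof (rule Inf_lower, intro CollectI exI conjI)
    show "admissible P \<xi> (corner P r) X" using r3(2) r(1,4) by blast
    show "F \<in> f" unfolding F(1) by (rule germ_self)
    show "real_analytic_on F (corner P r)" using F(3) r(2) unfolding real_analytic_on_def by auto
  qed (rule refl)
  also have "\<dots> \<le> enat N0"
    unfolding proj_degree_on_def
  proof (rule SUP_least)
    fix \<gamma> assume "\<gamma> \<in> orbit X (corner P r) ` corner P r"
    then obtain y where y: "y \<in> corner P r" and \<gamma>: "\<gamma> = orbit X (corner P r) y" by blast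
    show "b0 (\<gamma> \<inter> ({y\<in>corner P r. F y = 0} \<inter> U0)) \<le> enat N0"
    proof (cases "y \<in> U0")
      case True
      then obtain W where "W \<in> \<U>" "y \<in> W" using \<U>(2) by blast
      have "\<gamma> \<inter> ({y\<in>corner P r. F y = 0} \<inter> U0) = orbit X (corner P r) y \<inter> {z. F z = 0}"
        using r2(2)[OF r(3) True y] orbit_subset[of X "corner P r" y] unfolding \<gamma> by blast
      also have "b0 \<dots> \<le> enat (N W)"
        using N[OF \<open>W \<in> \<U>\<close>] r(1) r(5)[OF \<open>W \<in> \<U>\<close>] y \<open>y \<in> W\<close> unfolding zeros_bounded_on_def by blast
      also have "\<dots> \<le> enat N0"
        unfolding N0_def using \<U>(1) \<open>W \<in> \<U>\<close> by (simp add: member_le_sum)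
      finally show ?thesis .
    next
      case False
      \<comment> \<open>Orbits are symmetric: if the orbit of y met \<open>U0\<close> at z,
        invariance would put y, which lies on the orbit of z, into \<open>U0\<close>.\<close>
      have "z \<notin> U0" if "z \<in> \<gamma>" for z
        using r2(2)[OF r(3), of z] orbit_sym[of z X "corner P r" y] orbit_subset[of X "corner P r" y] that False
        unfolding \<gamma> by blast
      then have "\<gamma> \<inter> ({y\<in>corner P r. F y = 0} \<inter> U0) = {}" by blast
      then show ?thesis by (simp add: b0_def)
    qed
  qed
  finally have "chi_regular P \<xi> U0 f"
    unfolding chi_regular_def using enat_ord_simps(4) le_less_trans by blast
  then show ?thesis using \<U> \<U>_fin(1) W by blast
qed

end

theorem mainTheorem2:
  fixes P :: "'n::finite set"
    and B B0 M M0 :: "(real^'n \<Rightarrow> real) set set"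
    and \<xi> :: "'n \<Rightarrow> (real^'n \<Rightarrow> real) set"
    and U0 :: "(real^'n) set"
  assumes "reference_ring P B"
    and "maximalideal M (sub_ring (qring P) B)"
    and "\<xi> \<in> Xi P B"
    and "U0 \<subseteq> quadrant P"
    and "0 \<in> closure U0"
    and "invariant_germ P \<xi> U0"
    and "subalgebra_of P B0 B"
    and "vf_stable P \<xi> B0"
    and "ideal M0 (sub_ring (qring P) B)"
    and "M0 \<subseteq> M"
    and "vf_stable P \<xi> M0"
  shows "(chi_finite_class P B \<xi> U0 B0 \<longrightarrow>
            chi_finite_class P B \<xi> U0 (perturbation_class P B \<xi> U0 B0 M0)) \<and>
         (locally_chi_finite_class P B \<xi> U0 B0 \<longrightarrow>
            locally_chi_finite_class P B \<xi> U0 (perturbation_class P B \<xi> U0 B0 M0))"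
proof -
  obtain Us X where "admissible P \<xi> Us X"
    using assms(6) unfolding invariant_germ_def by blast
  then interpret chi_setting P B \<xi> Us X using assms(1,3) by unfold_locales
  note finite = perturbation_finite[OF assms(2,9,10,11,4,6,7,8)]
  show ?thesis
  proof (intro conjI impI)
    assume C: "chi_finite_class P B \<xi> U0 B0"
    \<comment> \<open>The global case is the subdivision into the single piece
      \<open>U0\<close>.\<close>
    have "chi_regular P \<xi> U0 f \<and> (\<exists>\<U>. finite \<U> \<and> \<Union>\<U> = U0 \<and> \<U> = {U0} \<and>
        (\<forall>W\<in>\<U>. invariant_germ P \<xi> W \<and> restr_fin_gen P B \<xi> W f))"
      if "f \<in> perturbation_class P B \<xi> U0 B0 M0" for f
      by (rule finite[where Q = "\<lambda>\<U>. \<U> = {U0}", OF _ _ that])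
        (use C assms(6) in \<open>auto simp: chi_finite_class_def chi_finite_def\<close>)
    then show "chi_finite_class P B \<xi> U0 (perturbation_class P B \<xi> U0 B0 M0)"
      unfolding chi_finite_class_def chi_finite_def by blast
  next
    assume C: "locally_chi_finite_class P B \<xi> U0 B0"
    let ?Q = "\<lambda>\<U>. partition_on U0 \<U> \<and> (\<forall>W\<in>\<U>. 0 \<in> closure W)"
    have reg: "chi_regular P \<xi> U0 h" if "h \<in> B0" for h
      using C that unfolding locally_chi_finite_class_def locally_chi_finite_def by blast
    have loc: "\<exists>\<U>. finite \<U> \<and> \<Union>\<U> = U0 \<and> ?Q \<U> \<and>
        (\<forall>W\<in>\<U>. invariant_germ P \<xi> W \<and> restr_fin_gen P B \<xi> W g)" if "g \<in> B0" for g
    proof -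
      obtain \<U> where "finite \<U>" "partition_on U0 \<U>"
        "\<forall>W\<in>\<U>. 0 \<in> closure W \<and> invariant_germ P \<xi> W \<and> restr_fin_gen P B \<xi> W g"
        using C \<open>g \<in> B0\<close> unfolding locally_chi_finite_class_def locally_chi_finite_def by blast
      then show ?thesis by (intro exI[of _ \<U>]) (auto simp: partition_on_def)
    qed
    show "locally_chi_finite_class P B \<xi> U0 (perturbation_class P B \<xi> U0 B0 M0)"
      unfolding locally_chi_finite_class_def
    proof
      fix f assume f: "f \<in> perturbation_class P B \<xi> U0 B0 M0"
      have "chi_regular P \<xi> U0 f \<and> (\<exists>\<U>. finite \<U> \<and> \<Union>\<U> = U0 \<and> ?Q \<U> \<and>
          (\<forall>W\<in>\<U>. invariant_germ P \<xi> W \<and> restr_fin_gen P B \<xi> W f))"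
        by (rule finite[where Q = ?Q, OF _ _ f]) (erule reg, erule loc)
      then obtain \<U> where
        "chi_regular P \<xi> U0 f" "finite \<U>" "partition_on U0 \<U>" "\<forall>W\<in>\<U>. 0 \<in> closure W"
        "\<forall>W\<in>\<U>. invariant_germ P \<xi> W \<and> restr_fin_gen P B \<xi> W f"
        by (elim conjE exE)
      then show "locally_chi_finite P B \<xi> U0 f"
        unfolding locally_chi_finite_def by (intro conjI exI[of _ \<U>]) simp_all
    qed
  qed
qed

end
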